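(* Let $(q_n),(r_n)$ be complex sequences vanishing faster than any negative power of $|n|$ as $n\to\pm\infty$ with $1-q_nr_n\neq0$ and $1+q_nr_{n+1}\ne0$ for all $n$. With the notation of the context, for all integers $m>n$, $$\begin{bmatrix}\bar M_{nm}&M_{nm}\end{bmatrix}+\begin{bmatrix}0&\bar\Omega_{n+m}\\ \Omega_{n+m}&0\end{bmatrix}+\sum_{l=n+1}^\infty\begin{bmatrix}\bar M_{nl}&M_{nl}\end{bmatrix}\begin{bmatrix}0&\bar\Omega_{l+m}\\ \Omega_{l+m}&0\end{bmatrix}=\begin{bmatrix}0&0\\0&0\end{bmatrix}.$$
   Context: System (Q): $\begin{bmatrix}\alpha_n\\ \beta_n\end{bmatrix}=\begin{bmatrix} z & (z-z^{-1})q_n\\ z r_n & z^{-1}+(z-z^{-1})q_nr_n\end{bmatrix}\begin{bmatrix}\alpha_{n+1}\\ \beta_{n+1}\end{bmatrix}$, $n\in\mathbb Z$. For $|z|=1$ its Jost solutions (overbars never complex conjugation) are $\psi_n=\begin{bmatrix}o(1)\\ z^n[1+o(1)]\end{bmatrix}$, $\bar\psi_n=\begin{bmatrix}z^{-n}[1+o(1)]\\ o(1)\end{bmatrix}$ as $n\to+\infty$ and $\phi_n=\begin{bmatrix}z^{-n}[1+o(1)]\\ o(1)\end{bmatrix}$, $\bar\phi_n=\begin{bmatrix}o(1)\\ z^{n}[1+o(1)]\end{bmatrix}$ as $n\to-\infty$; the transmission coefficients $T,\bar T$ and reflection coefficients $R,\bar R$ are defined by $\phi_n=\begin{bmatrix}(1/T)z^{-n}[1+o(1)]\\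 (R/T)z^{n}[1+o(1)]\end{bmatrix}$ and $\bar\phi_n=\begin{bmatrix}(\bar R/\bar T)z^{-n}[1+o(1)]\\ (1/\bar T)z^{n}[1+o(1)]\end{bmatrix}$ as $n\to+\infty$; $T$ is meromorphic in $|z|<1$, $\bar T$ in $|z|>1$. Coefficients: $K_{nm}:=\frac1{2\pi i}\oint\psi_n z^{-m-1}dz$ and $\bar K_{nm}:=\frac1{2\pi i}\oint\bar\psi_n z^{m-1}dz$ (column vectors; $\oint$ is over the unit circle counterclockwise), so that $\psi_n=\sum_{l\ge n}K_{nl}z^l$ and $\bar\psi_n=\sum_{l\ge n}\bar K_{nl}z^{-l}$. The $2\times2$ matrix $\begin{bmatrix}\bar K_{nn}&K_{nn}\end{bmatrix}$ is invertible, and $\begin{bmatrix}\bar M_{nm}&M_{nm}\end{bmatrix}:=\begin{bmatrix}\bar K_{nn}&K_{nn}\end{bmatrix}^{-1}\begin{bmatrix}\bar K_{nm}&K_{nm}\end{bmatrix}$. Bound-state data: the poles of $T$ in $0<|z|<1$ are $\pm z_j$ ($1\le j\le N$) of multiplicity $m_j$, those of $\bar T$ in $|z|>1$ are $\pm\bar z_j$ ($1\le j\le\bar N$) of multiplicity $\bar m_j$. Residues $t_{jk}$, $\bar t_{jk}$: $T=\sum_{k=1}^{m_j}t_{jk}(z-z_j)^{-k}+O(1)$ as $z\to z_j$, $\bar T=\sum_{k=1}^{\bar m_j}\bar t_{jk}(z-\bar z_j)^{-k}+O(1)$ as $z\to\bar z_j$. Dependency constants: $\frac{d^k\phi_n(z_j)}{dz^k}=\sum_{l=0}^k\binom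 kl\gamma_{j(k-l)}\frac{d^l\psi_n(z_j)}{dz^l}$ ($0\le k\le m_j-1$, all $n$), and $\bar\gamma_{jk}$ analogously with barred quantities. Norming constants: $c_{jk}=-2\sum_{l=0}^{m_j-1-k}t_{j(k+1+l)}\gamma_{jl}/l!$, $\bar c_{jk}=2\sum_{l=0}^{\bar m_j-1-k}\bar t_{j(k+1+l)}\bar\gamma_{jl}/l!$. Triplets: $A_j$ is the $m_j\times m_j$ Jordan block with eigenvalue $z_j$ (ones on the superdiagonal), $B_j=\begin{bmatrix}0&\cdots&0&1\end{bmatrix}^T$ ($m_j\times1$), $C_j=\begin{bmatrix}c_{j(m_j-1)}&\cdots&c_{j1}&c_{j0}\end{bmatrix}$; $A=\mathrm{diag}(A_1,\dots,A_N)$, $B=\begin{bmatrix}B_1^T&\cdots&B_N^T\end{bmatrix}^T$, $C=\begin{bmatrix}C_1&\cdots&C_N\end{bmatrix}$; $(\bar A,\bar B,\bar C)$ analogously from $\bar z_j,\bar m_j,\bar c_{jk}$. Kernels: $\hat R_k:=\frac1{2\pi i}\oint R z^{k-1}dz$, $\hat{\bar R}_k:=\frac1{2\pi i}\oint\bar R z^{-k-1}dz$; for $k$ even $\Omega_k:=\hat R_k+CA^{k-1}B$, $\bar\Omega_k:=\hat{\bar R}_k+\bar C(\bar A)^{-k-1}\bar B$, and for $k$ odd $\Omega_k:=\bar\Omega_k:=0$. *)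

theory Defs
  imports "HOL-Complex_Analysis.Complex_Analysis"
          "Jordan_Normal_Form.Jordan_Normal_Form"
          "Jordan_Normal_Form.Gauss_Jordan_Elimination"
begin

text \<open>Conventions.  A column vector with two complex components that depends on
  n and z is represented as a function  f :: int => nat => complex => complex,
  where  f n 0 z  is the upper and  f n 1 z  the lower component.
  Overbars of the paper are written with a suffix  b  (never complex conjugation).\<close>

definition solves_Q ::
  "(int \<Rightarrow> complex) \<Rightarrow> (int \<Rightarrow> complex) \<Rightarrow> (int \<Rightarrow> nat \<Rightarrow> complex \<Rightarrow> complex) \<Rightarrow> bool" where
  "solves_Q q r f \<longleftrightarrow> (\<forall>n z. norm z = 1 \<longrightarrow>
      f n 0 z = z * f (n+1) 0 z + (z - inverse z) * q n * f (n+1) 1 z \<and>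
      f n 1 z = z * r n * f (n+1) 0 z
                + (inverse z + (z - inverse z) * q n * r n) * f (n+1) 1 z)"

definition cint :: "(complex \<Rightarrow> complex) \<Rightarrow> complex" where
  "cint f = contour_integral (circlepath 0 1) f / (2 * of_real pi * \<i>)"

definition Kc :: "(int \<Rightarrow> nat \<Rightarrow> complex \<Rightarrow> complex) \<Rightarrow> int \<Rightarrow> int \<Rightarrow> nat \<Rightarrow> complex" where
  "Kc psi n m i = cint (\<lambda>z. psi n i z * z powi (- m - 1))"

definition Kbc :: "(int \<Rightarrow> nat \<Rightarrow> complex \<Rightarrow> complex) \<Rightarrow> int \<Rightarrow> int \<Rightarrow> nat \<Rightarrow> complex" where
  "Kbc psib n m i = cint (\<lambda>z. psib n i z * z powi (m - 1))"

definition KKmat :: "(int \<Rightarrow> nat \<Rightarrow> complex \<Rightarrow> complex) \<Rightarrow> (int \<Rightarrow> nat \<Rightarrow> complex \<Rightarrow> complex)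
    \<Rightarrow> int \<Rightarrow> int \<Rightarrow> complex mat" where
  "KKmat psi psib n m = mat 2 2 (\<lambda>(i,j). if j = 0 then Kbc psib n m i else Kc psi n m i)"

definition MMmat :: "(int \<Rightarrow> nat \<Rightarrow> complex \<Rightarrow> complex) \<Rightarrow> (int \<Rightarrow> nat \<Rightarrow> complex \<Rightarrow> complex)
    \<Rightarrow> int \<Rightarrow> int \<Rightarrow> complex mat" where
  "MMmat psi psib n m = the (mat_inverse (KKmat psi psib n n)) * KKmat psi psib n m"

definition mat_powi :: "complex mat \<Rightarrow> int \<Rightarrow> complex mat" where
  "mat_powi A e = (if 0 \<le> e then A ^\<^sub>m nat e else (the (mat_inverse A)) ^\<^sub>m nat (- e))"

definition cnorm :: "(nat \<Rightarrow> nat) \<Rightarrow> (nat \<Rightarrow> nat \<Rightarrow> complex) \<Rightarrow> (nat \<Rightarrow> nat \<Rightarrow> complex)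
    \<Rightarrow> nat \<Rightarrow> nat \<Rightarrow> complex" where
  "cnorm ms t gam j k = - 2 * (\<Sum>l = 0..ms j - 1 - k. t j (k + 1 + l) * gam j l / of_nat (fact l))"

definition cbnorm :: "(nat \<Rightarrow> nat) \<Rightarrow> (nat \<Rightarrow> nat \<Rightarrow> complex) \<Rightarrow> (nat \<Rightarrow> nat \<Rightarrow> complex)
    \<Rightarrow> nat \<Rightarrow> nat \<Rightarrow> complex" where
  "cbnorm ms t gam j k = 2 * (\<Sum>l = 0..ms j - 1 - k. t j (k + 1 + l) * gam j l / of_nat (fact l))"

definition Ablk :: "complex \<Rightarrow> nat \<Rightarrow> complex mat" where
  "Ablk z m = jordan_block m z"

definition Bblk :: "nat \<Rightarrow> complex mat" where
  "Bblk m = mat m 1 (\<lambda>(i,_). if i = m - 1 then 1 else 0)"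

definition Cblk :: "(nat \<Rightarrow> complex) \<Rightarrow> nat \<Rightarrow> complex mat" where
  "Cblk c m = mat 1 m (\<lambda>(_,i). c (m - 1 - i))"

definition Atrip :: "nat \<Rightarrow> (nat \<Rightarrow> complex) \<Rightarrow> (nat \<Rightarrow> nat) \<Rightarrow> complex mat" where
  "Atrip N zs ms = diag_block_mat (map (\<lambda>j. Ablk (zs j) (ms j)) [1..<N+1])"

definition Btrip :: "nat \<Rightarrow> (nat \<Rightarrow> nat) \<Rightarrow> complex mat" where
  "Btrip N ms = foldr (\<lambda>j M. Bblk (ms j) @\<^sub>r M) [1..<N+1] (0\<^sub>m 0 1)"

definition Ctrip :: "nat \<Rightarrow> (nat \<Rightarrow> nat) \<Rightarrow> (nat \<Rightarrow> nat \<Rightarrow> complex) \<Rightarrow> complex mat" where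
  "Ctrip N ms cn = transpose_mat
     (foldr (\<lambda>j M. transpose_mat (Cblk (cn j) (ms j)) @\<^sub>r M) [1..<N+1] (0\<^sub>m 0 1))"

definition Omega :: "(complex \<Rightarrow> complex) \<Rightarrow> nat \<Rightarrow> (nat \<Rightarrow> complex) \<Rightarrow> (nat \<Rightarrow> nat)
    \<Rightarrow> (nat \<Rightarrow> nat \<Rightarrow> complex) \<Rightarrow> int \<Rightarrow> complex" where
  "Omega R N zs ms cn k = (if even k then
      cint (\<lambda>z. R z * z powi (k - 1))
      + (Ctrip N ms cn * mat_powi (Atrip N zs ms) (k - 1) * Btrip N ms) $$ (0,0)
    else 0)"

definition Omegab :: "(complex \<Rightarrow> complex) \<Rightarrow> nat \<Rightarrow> (nat \<Rightarrow> complex) \<Rightarrow> (nat \<Rightarrow> nat)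
    \<Rightarrow> (nat \<Rightarrow> nat \<Rightarrow> complex) \<Rightarrow> int \<Rightarrow> complex" where
  "Omegab Rb N zs ms cn k = (if even k then
      cint (\<lambda>z. Rb z * z powi (- k - 1))
      + (Ctrip N ms cn * mat_powi (Atrip N zs ms) (- k - 1) * Btrip N ms) $$ (0,0)
    else 0)"

definition OmMat :: "complex \<Rightarrow> complex \<Rightarrow> complex mat" where
  "OmMat om omb = mat 2 2 (\<lambda>(i,j). if i = 0 \<and> j = 1 then omb else if i = 1 \<and> j = 0 then om else 0)"

end

theory Submission
  imports Defs
begin

text \<open>The proof works on one side of the unit circle at a time; \<open>\<sigma> = 1\<close> stands for the punctured disc
  (with \<open>\<psi>, \<phi>, T\<close>) and \<open>\<sigma> = -1\<close> for the exterior (with the barred quantities), and \<open>u = z\<^sup>\<sigma>\<close>.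
  A Gronwall argument for the Fourier coefficients of a Jost solution \<open>f\<^sub>n\<close> shows that they are absolutely
  summable and vanish below \<open>n\<close>, so \<open>f\<^sub>n = \<Sum>\<^sub>l\<^sub>\<ge>\<^sub>n K\<^sub>n\<^sub>l u\<^sup>l\<close> on the closed side. On the circle
  \<open>T \<phi>\<^sub>n\<close> is the barred \<open>\<psi>\<^sub>n\<close> plus \<open>R \<psi>\<^sub>n\<close>. Multiplying by \<open>u\<^sup>m / z\<close> and integrating turns the right-hand
  side into the barred \<open>K\<^sub>n\<^sub>m\<close> plus the sum of \<open>K\<^sub>n\<^sub>l\<close> times the Fourier coefficients of \<open>R\<close>. The left-hand side
  is a sum of residues at the poles of \<open>T\<close>: nothing comes from \<open>0\<close> (or \<open>\<infinity>\<close>) because \<open>m > n\<close> and because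
  \<open>1/T\<close> is a Wronskian whose leading coefficient is a product of factors \<open>1 - q\<^sub>k r\<^sub>k\<close> (or \<open>1 + q\<^sub>k r\<^sub>k\<^sub>+\<^sub>1\<close>).
  The dependency constants replace \<open>\<phi>\<^sub>n\<close> by \<open>\<psi>\<^sub>n\<close> in the residues, and since the \<open>s\<close>-th Taylor
  coefficients of \<open>z\<^sup>e\<close> at \<open>z\<^sub>j\<close> form the vector \<open>A\<^sub>j\<^sup>e B\<^sub>j\<close>, the residues are \<open>- \<Sum>\<^sub>l K\<^sub>n\<^sub>l C A\<^sup>e B\<close> with
  \<open>e = \<sigma>(l + m) - 1\<close>. The symmetry \<open>z \<mapsto> -z\<close> pairs the poles and disposes of odd \<open>n + m\<close>.\<close>

subsection \<open>The two sides of the unit circle\<close>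

text \<open>The hypotheses impose (Q), the asymptotics and the relation between \<open>T\<close>,
  \<open>R\<close> and the solutions on the circle only. Facts about a whole side are therefore
  first proved on the circle, mostly by uniqueness for the recursion, and then carried inward by the
  principle that a function continuous up to the circle, holomorphic inside off finitely many points
  and zero on the circle is zero. This is how the power series and the parity of the solutions are
  obtained, and how the identity of \<open>T\<close> with a reciprocal Wronskian spreads from the
  circle. The constants -2 and 2 of the norming constants are both \<open>-2 * \<sigma>\<close>. The
  integrand is odd, so its residues at \<open>z_j\<close> and \<open>-z_j\<close> agree, which gives
  the 2. The factor \<open>\<sigma>\<close> is the orientation: seen from outside, the circle runs
  clockwise around the poles. The minus sign appears when the residues are moved to the side of the
  integral with \<open>R\<close>.\<close>

definition side :: "int \<Rightarrow> complex set" where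
  "side \<sigma> = {z. z \<noteq> 0 \<and> norm (z powi \<sigma>) < 1}"

text \<open>In HOL \<open>0 powi (-1)\<close> is 0, so for \<open>\<sigma> = -1\<close> the norm
  condition alone would admit the point 0, both here and in \<open>side\<close>.\<close>

definition cside :: "int \<Rightarrow> complex set" where
  "cside \<sigma> = {z. z \<noteq> 0 \<and> norm (z powi \<sigma>) \<le> 1}"

lemma side_pos: "side 1 = ball 0 1 - {0}"
  by (auto simp: side_def)

lemma cside_pos: "cside 1 = cball 0 1 - {0}"
  by (auto simp: cside_def)

lemma side_neg: "side (-1) = {z. 1 < norm z}"
  by (auto simp: side_def norm_inverse power_int_minus one_less_inverse_iff inverse_less_1_iff)

lemma cside_neg: "cside (-1) = {z. 1 \<le> norm z}"
  by (auto simp: cside_def norm_inverse power_int_minus inverse_le_1_iff)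

lemma side_subset_cside: "side \<sigma> \<subseteq> cside \<sigma>"
  by (auto simp: side_def cside_def)

lemma nonzero_side: "z \<in> side \<sigma> \<Longrightarrow> z \<noteq> 0" and nonzero_cside: "z \<in> cside \<sigma> \<Longrightarrow> z \<noteq> 0"
  by (auto simp: side_def cside_def)

lemma uminus_side_iff: "\<sigma> = 1 \<or> \<sigma> = -1 \<Longrightarrow> - z \<in> side \<sigma> \<longleftrightarrow> z \<in> side \<sigma>"
  and uminus_cside_iff: "\<sigma> = 1 \<or> \<sigma> = -1 \<Longrightarrow> - z \<in> cside \<sigma> \<longleftrightarrow> z \<in> cside \<sigma>"
  by (auto simp: side_def cside_def power_int_minus)

lemma cside_cases:
  assumes "z \<in> cside \<sigma>" "\<sigma> = 1 \<or> \<sigma> = -1"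
  shows "norm z = 1 \<or> z \<in> side \<sigma>"
  using assms by (auto simp: side_def cside_def power_int_minus norm_inverse)

lemma sphere_in_cside: "norm z = 1 \<Longrightarrow> z \<in> cside \<sigma>"
  by (auto simp: cside_def norm_power_int)

lemma powi_mem_side:
  assumes "\<sigma> = 1 \<or> \<sigma> = -1"
  shows "z powi \<sigma> \<in> side \<sigma> \<longleftrightarrow> z \<in> side 1" "z powi \<sigma> \<in> cside \<sigma> \<longleftrightarrow> z \<in> cside 1"
  using assms by (auto simp: side_def cside_def power_int_minus)

text \<open>This involution is the change of variable between either side and the punctured disc;
  statements about the exterior are pulled back along it.\<close>

lemma powi_powi_sign:
  fixes z :: complex
  assumes "\<sigma> = 1 \<or> \<sigma> = -1"
  shows "(z powi \<sigma>) powi \<sigma> = z"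
  using assms by (auto simp: power_int_minus)

lemma side_eq_image: assumes "\<sigma> = 1 \<or> \<sigma> = -1"
  shows "side \<sigma> = (\<lambda>z. z powi \<sigma>) ` side 1"
proof -
  have "z \<in> (\<lambda>z. z powi \<sigma>) ` side 1" if "z \<in> side \<sigma>" for z
    using that powi_mem_side(1)[OF assms, of "z powi \<sigma>"] powi_powi_sign[OF assms, of z]
    by (intro image_eqI[of _ _ "z powi \<sigma>"]) auto
  then show ?thesis using powi_mem_side(1)[OF assms] by auto
qed

lemma continuous_on_powi_sign:
  assumes "0 \<notin> A"
  shows "continuous_on A (\<lambda>z::complex. z powi k)"
  using assms by (intro holomorphic_on_imp_continuous_on holomorphic_intros) auto

lemma open_side: assumes "\<sigma> = 1 \<or> \<sigma> = -1" shows "open (side \<sigma>)"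
proof -
  have "open {z::complex. 1 < norm z}" by (intro open_Collect_less continuous_intros)
  then show ?thesis using assms by (auto simp: side_pos side_neg intro!: open_Diff)
qed

lemma connected_side: assumes "\<sigma> = 1 \<or> \<sigma> = -1" and "finite S" shows "connected (side \<sigma> - S)"
proof -
  have "connected (side 1)" unfolding side_pos
    by (intro connected_open_delete) auto
  then have "connected (side \<sigma>)"
    unfolding side_eq_image[OF assms(1)]
    by (intro connected_continuous_image continuous_on_powi_sign) (auto simp: side_def)
  then show ?thesis using connected_open_delete_finite[of "side \<sigma>" S] assms open_side[OF assms(1)] by simp
qed

section \<open>Integrals over the unit circle\<close>

lemma circle_integral_uminus:
  "contour_integral (circlepath 0 1) (\<lambda>z. g (- z)) = - contour_integral (circlepath 0 1) g"
proof -
  \<comment> \<open>Half a turn of the circle is the same closed path started half a period later;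
    the sign in the claim comes from d(-z).\<close>
  have "shiftpath (1/2) (circlepath 0 1) = uminus \<circ> circlepath 0 1"
    by (rule ext) (auto simp: shiftpath_def circlepath exp_add exp_diff ring_distribs mult.commute)
  then have "contour_integral (uminus \<circ> circlepath 0 1) g = contour_integral (circlepath 0 1) g"
    using contour_integral_shiftpath[of "circlepath 0 1" "1/2" g] by simp
  then have "- contour_integral (circlepath 0 1) (\<lambda>x. g (- x)) = contour_integral (circlepath 0 1) g"
    by (simp add: contour_integral_negatepath)
  then show ?thesis by (metis minus_minus)
qed

text \<open>Inversion reverses the circle and has derivative -w^(-2); the two signs cancel.\<close>

lemma circle_integral_inverse:
  "contour_integral (circlepath 0 1) g = contour_integral (circlepath 0 1) (\<lambda>w. g (w powi (-1)) * w powi (-2))"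
proof -
  have "inverse \<circ> circlepath 0 1 = reversepath (circlepath 0 1)"
    by (rule ext) (auto simp: reversepath_def circlepath exp_diff exp_minus ring_distribs inverse_eq_divide)
  then have "- contour_integral (circlepath 0 1) g = contour_integral (inverse \<circ> circlepath 0 1) g"
    by (simp add: contour_integral_reversepath)
  also have "\<dots> = contour_integral (circlepath 0 1) (\<lambda>w. deriv inverse w * g (inverse w))"
    by (rule contour_integral_comp_analyticW[of _ "-{0}"]) (auto intro!: analytic_intros)
  also have "\<dots> = contour_integral (circlepath 0 1) (\<lambda>w. - (g (w powi (-1)) * w powi (-2)))"
  proof (rule contour_integral_cong[OF refl])
    fix w :: complex assume "w \<in> path_image (circlepath 0 1)"
    then have "w \<noteq> 0" by auto
    then have "deriv inverse w = - (w powi (-2))"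
      by (intro DERIV_imp_deriv) (auto intro!: derivative_eq_intros simp: power2_eq_square power_int_minus)
    then show "deriv inverse w * g (inverse w) = - (g (w powi (-1)) * w powi (-2))"
      by (simp add: power_int_minus)
  qed
  finally show ?thesis by (simp add: contour_integral_neg)
qed

lemma cint_cong: "(\<And>z. norm z = 1 \<Longrightarrow> f z = g z) \<Longrightarrow> cint f = cint g"
  unfolding cint_def by (intro arg_cong2[where f="(/)"] contour_integral_cong) auto

lemma cint_uminus_arg: "cint (\<lambda>z. g (- z)) = - cint g"
  unfolding cint_def by (simp add: circle_integral_uminus)

lemma cint_powi: "\<sigma> = 1 \<or> \<sigma> = -1 \<Longrightarrow> cint g = cint (\<lambda>w. g (w powi \<sigma>) * w powi (\<sigma> - 1))"
  using circle_integral_inverse[of g] by (auto simp: cint_def)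

lemma circle_integrable:
  "continuous_on (sphere 0 1) f \<Longrightarrow> f contour_integrable_on (circlepath 0 1)"
  by (auto intro!: contour_integrable_continuous_circlepath)

lemma cint_add:
  assumes "continuous_on (sphere 0 1) f" "continuous_on (sphere 0 1) g"
  shows "cint (\<lambda>z. f z + g z) = cint f + cint g"
  unfolding cint_def using contour_integral_add[OF assms[THEN circle_integrable]] by (simp add: add_divide_distrib)

lemma cint_cmult:
  assumes "continuous_on (sphere 0 1) f"
  shows "cint (\<lambda>z. c * f z) = c * cint f"
  unfolding cint_def using contour_integral_lmul[OF assms[THEN circle_integrable]] by simp

lemma cint_sum:
  assumes "finite A" "\<And>a. a \<in> A \<Longrightarrow> continuous_on (sphere 0 1) (f a)"
  shows "cint (\<lambda>z. \<Sum>a\<in>A. f a z) = (\<Sum>a\<in>A. cint (f a))"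
  unfolding cint_def using contour_integral_sum[OF assms(1) circle_integrable[OF assms(2)]] by (simp add: sum_divide_distrib)

lemma cint_bound:
  assumes "continuous_on (sphere 0 1) f" "\<And>z. norm z = 1 \<Longrightarrow> norm (f z) \<le> B"
  shows "norm (cint f) \<le> B"
proof -
  have "0 \<le> B" using assms(2)[of 1] norm_ge_zero[of "f 1"] by (simp del: norm_ge_zero)
  have "norm (contour_integral (circlepath 0 1) f) \<le> B * (2 * pi * 1)"
    by (rule has_contour_integral_bound_circlepath[OF has_contour_integral_integral[OF circle_integrable[OF assms(1)]]])
       (use assms \<open>0 \<le> B\<close> in auto)
  then show ?thesis by (simp add: cint_def norm_divide norm_mult field_simps)
qed

lemma cint_sums:
  assumes "uniform_limit (sphere 0 1) (\<lambda>N z. \<Sum>s<N. f s z) g sequentially" "\<And>s. continuous_on (sphere 0 1) (f s)"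
  shows "(\<lambda>s. cint (f s)) sums cint g"
proof -
  have "(\<lambda>N. contour_integral (circlepath 0 1) (\<lambda>z. \<Sum>s<N. f s z)) \<longlonglongrightarrow> contour_integral (circlepath 0 1) g"
    by (rule contour_integral_uniform_limit_circlepath[OF _ assms(1)])
       (auto intro!: always_eventually circle_integrable continuous_intros assms(2))
  then have "(\<lambda>N. cint (\<lambda>z. \<Sum>s<N. f s z)) \<longlonglongrightarrow> cint g"
    unfolding cint_def by (intro tendsto_divide) auto
  then show ?thesis by (simp add: sums_def cint_sum assms)
qed

lemma cint_inverse_power_inside:
  assumes "norm p < 1"
  shows "cint (\<lambda>z. 1 / (z - p) ^ Suc k) = (if k = 0 then 1 else 0)"
proof -
  have "((\<lambda>u. 1 / (u - p) ^ Suc k) has_contour_integral (2 * pi) * \<i> / fact k * (deriv ^^ k) (\<lambda>_. 1) p) (circlepath 0 1)"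
    by (rule Cauchy_has_contour_integral_higher_derivative_circlepath) (use assms in \<open>auto intro!: continuous_intros\<close>)
  moreover have "(deriv ^^ k) (\<lambda>_. 1::complex) p = (if k = 0 then 1 else 0)"
    by (cases k) (auto simp del: funpow.simps simp: higher_deriv_const)
  ultimately have "contour_integral (circlepath 0 1) (\<lambda>u. 1 / (u - p) ^ Suc k) = (2 * pi) * \<i> / fact k * (if k = 0 then 1 else 0)"
    by (simp only: contour_integral_unique)
  then show ?thesis unfolding cint_def by (simp split: if_splits)
qed

lemma cint_inverse_power_outside:
  assumes "norm p > 1"
  shows "cint (\<lambda>z. 1 / (z - p) ^ k) = 0"
proof -
  have "((\<lambda>z. 1 / (z - p) ^ k) has_contour_integral 0) (circlepath 0 1)"
    by (rule Cauchy_theorem_convex_simple[of _ "cball 0 ((1 + norm p)/2)"]) (use assms in \<open>auto intro!: holomorphic_intros\<close>)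
  then show ?thesis by (simp add: cint_def contour_integral_unique)
qed

section \<open>Removable singularities and the integral as a limit at 0 or infinity\<close>

lemma continuous_on_cball_of_disc:
  assumes "finite S" "S \<subseteq> ball 0 1" "continuous_on (cball 0 1 - S) f" "continuous_on (ball 0 1) f"
  shows "continuous_on (cball 0 1) (f :: complex \<Rightarrow> complex)"
proof -
  have un: "ball 0 1 \<union> (cball 0 1 - S) = cball 0 1" using assms(2) by auto
  have "openin (top_of_set (cball 0 1)) (ball 0 1 :: complex set)"
    unfolding openin_open by (intro exI[of _ "ball 0 1"]) auto
  moreover have "openin (top_of_set (cball 0 1)) (cball 0 1 - S)"
    unfolding openin_open by (intro exI[of _ "- S"]) (use assms(1) in \<open>auto intro: finite_imp_closed\<close>)
  ultimately show ?thesis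
    using continuous_on_Un_local_open[of "ball 0 1" "cball 0 1 - S" f] assms(3,4) unfolding un by blast
qed

text \<open>Riemann's criterion is applied at each point of \<open>S\<close>. These points lie in
  the open disc, so continuity up to the circle survives the extension.\<close>

lemma removable_disc:
  assumes "finite S" "S \<subseteq> ball 0 1" "continuous_on (cball 0 1 - S) g" "g holomorphic_on (ball 0 1 - S)"
    and "\<And>p. p \<in> S \<Longrightarrow> ((\<lambda>z. (z - p) * g z) \<longlongrightarrow> 0) (at p)"
  obtains h where "continuous_on (cball 0 1) h" "h holomorphic_on (ball 0 1)" "\<And>z. z \<notin> S \<Longrightarrow> h z = g z"
proof -
  define h where "h z = (if z \<in> S then Lim (at z) g else g z)" for z
  have lim: "(g \<longlongrightarrow> h p) (at p)" if p: "p \<in> S" for p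
  proof -
    define U where "U = ball 0 1 - (S - {p})"
    have U: "open U" "p \<in> U" using p assms by (auto simp: U_def intro!: open_Diff finite_imp_closed)
    have "\<exists>k. k holomorphic_on U \<and> (\<forall>z \<in> U - {p}. k z = g z)"
    proof (subst holomorphic_on_extend_lim)
      have "U - {p} = ball 0 1 - S" using p by (auto simp: U_def)
      then show "g holomorphic_on U - {p}" using assms(4) by simp
    qed (use U assms(5) p in \<open>auto simp: interior_open\<close>)
    then obtain k where k: "k holomorphic_on U" "\<And>z. z \<in> U - {p} \<Longrightarrow> k z = g z" by blast
    have "(k \<longlongrightarrow> k p) (at p)"
      using holomorphic_on_imp_continuous_on[OF k(1)] U by (simp add: continuous_on_eq_continuous_at isCont_def)
    then have "(g \<longlongrightarrow> k p) (at p)"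
      by (rule Lim_transform_within_open[OF _ U]) (use k(2) in auto)
    then show ?thesis using p by (simp add: h_def tendsto_Lim)
  qed
  have ev: "\<forall>\<^sub>F z in at p. h z = g z" for p
  proof -
    have "open (- (S - {p}))" using assms(1) by (intro open_Compl finite_imp_closed) auto
    then show ?thesis unfolding eventually_at_topological by (intro exI[of _ "- (S - {p})"]) (auto simp: h_def)
  qed
  have holo: "h holomorphic_on ball 0 1"
  proof (rule no_isolated_singularity'[of S])
    show "(h \<longlongrightarrow> h p) (at p within ball 0 1)" if "p \<in> S" for p
      using lim[OF that] tendsto_cong[OF ev] by (meson tendsto_within_subset subset_UNIV)
    show "h holomorphic_on ball 0 1 - S"
      using assms(4) by (rule holomorphic_transform) (auto simp: h_def)
  qed (use assms in auto)
  moreover have "continuous_on (cball 0 1) h"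
  proof (rule continuous_on_cball_of_disc[OF assms(1,2)])
    show "continuous_on (cball 0 1 - S) h"
      using assms(3) by (rule continuous_on_eq) (auto simp: h_def)
  qed (rule holomorphic_on_imp_continuous_on[OF holo])
  ultimately show ?thesis using that[of h] by (auto simp: h_def)
qed

text \<open>Multiplication by z makes 0 one more removable point. The extension \<open>h\<close> of
  z g(z) has value c at 0, and Cauchy's formula at 0, which needs only continuity on the closed
  disc, returns this value.\<close>

lemma cint_disc:
  assumes "finite S" "S \<subseteq> ball 0 1 - {0}" "continuous_on (cball 0 1 - ({0} \<union> S)) g" "g holomorphic_on (ball 0 1 - ({0} \<union> S))"
    and "\<And>p. p \<in> S \<Longrightarrow> ((\<lambda>z. (z - p) * g z) \<longlongrightarrow> 0) (at p)"
    and "((\<lambda>z. z * g z) \<longlongrightarrow> c) (at 0)"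
  shows "cint g = c"
proof -
  obtain h where h: "continuous_on (cball 0 1) h" "h holomorphic_on (ball 0 1)" "\<And>z. z \<notin> {0} \<union> S \<Longrightarrow> h z = z * g z"
  proof (rule removable_disc[of "{0} \<union> S" "\<lambda>z. z * g z"])
    fix p assume "p \<in> {0} \<union> S"
    moreover have "((\<lambda>z. z * (z * g z)) \<longlongrightarrow> 0 * c) (at 0)" by (intro tendsto_intros assms(6))
    moreover have "((\<lambda>z. z * ((z - p) * g z)) \<longlongrightarrow> p * 0) (at p)" if "p \<in> S" by (intro tendsto_intros assms(5) that)
    ultimately show "((\<lambda>z. (z - p) * (z * g z)) \<longlongrightarrow> 0) (at p)"
      by (auto simp: mult.left_commute)
  qed (use assms in \<open>auto intro!: continuous_intros holomorphic_intros\<close>)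
  have "((\<lambda>u. h u / (u - 0)) has_contour_integral (2 * of_real pi * \<i> * h 0)) (circlepath 0 1)"
    by (rule Cauchy_integral_circlepath) (use h in auto)
  then have "contour_integral (circlepath 0 1) (\<lambda>u. h u / u) = 2 * of_real pi * \<i> * h 0"
    by (simp add: contour_integral_unique)
  moreover have "contour_integral (circlepath 0 1) (\<lambda>u. h u / u) = contour_integral (circlepath 0 1) g"
  proof (rule contour_integral_cong[OF refl])
    fix x :: complex assume "x \<in> path_image (circlepath 0 1)"
    then have "x \<notin> {0} \<union> S" using assms(2) by auto
    then show "h x / x = g x" using h(3)[of x] by simp
  qed
  moreover have "h 0 = c"
  proof (rule LIM_unique)
    show "(h \<longlongrightarrow> h 0) (at 0)"
      using holomorphic_on_imp_continuous_on[OF h(2)] by (simp add: continuous_on_eq_continuous_at isCont_def)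
    have "open (- S)" using assms(1) by (intro open_Compl finite_imp_closed) auto
    then have "\<forall>\<^sub>F z in at 0. h z = z * g z"
      unfolding eventually_at_topological using assms(2) by (intro exI[of _ "- S"]) (auto simp: h(3))
    then show "(h \<longlongrightarrow> c) (at 0)" using assms(6) by (simp add: tendsto_cong)
  qed
  ultimately show ?thesis by (simp add: cint_def)
qed

text \<open>For \<open>\<sigma> = -1\<close> the limit \<open>c\<close> is the coefficient of 1/z at
  infinity. The substitution z = w^\<sigma> reduces the claim to \<open>cint_disc\<close>, and
  either end of the side becomes w = 0.\<close>

lemma cint_side:
  assumes \<sigma>: "\<sigma> = 1 \<or> \<sigma> = -1"
    and S: "finite S" "S \<subseteq> side \<sigma>" and g: "continuous_on (cside \<sigma> - S) g" "g holomorphic_on (side \<sigma> - S)"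
    and lim: "\<And>p. p \<in> S \<Longrightarrow> ((\<lambda>z. (z - p) * g z) \<longlongrightarrow> 0) (at p)"
    and lim_end: "((\<lambda>w. w powi \<sigma> * g (w powi \<sigma>)) \<longlongrightarrow> c) (at 0)"
  shows "cint g = c"
proof -
  define S' where "S' = (\<lambda>z. z powi \<sigma>) ` S"
  define g' where "g' w = g (w powi \<sigma>) * w powi (\<sigma> - 1)" for w
  have inS: "w powi \<sigma> \<in> S \<longleftrightarrow> w \<in> S'" for w
  proof
    assume "w powi \<sigma> \<in> S"
    then have "(w powi \<sigma>) powi \<sigma> \<in> S'" unfolding S'_def by (rule imageI)
    then show "w \<in> S'" by (simp add: powi_powi_sign[OF \<sigma>])
  qed (auto simp: S'_def powi_powi_sign[OF \<sigma>])
  have S': "S' \<subseteq> side 1" using S(2) powi_mem_side(1)[OF \<sigma>] by (auto simp flip: inS)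
  have "cint g' = c"
  proof (rule cint_disc)
    show "finite S'" "S' \<subseteq> ball 0 1 - {0}" using S S' by (auto simp: S'_def side_pos)
    have "continuous_on (cside 1 - S') (\<lambda>w. g (w powi \<sigma>))"
      by (rule continuous_on_compose2[OF g(1)])
         (auto simp: powi_mem_side(2)[OF \<sigma>] inS intro!: continuous_on_powi_sign dest: nonzero_cside)
    then have "continuous_on (cside 1 - S') g'"
      unfolding g'_def by (intro continuous_on_mult continuous_on_powi_sign) (auto dest: nonzero_cside)
    moreover have "cball 0 1 - ({0} \<union> S') = cside 1 - S'" by (auto simp: cside_pos)
    ultimately show "continuous_on (cball 0 1 - ({0} \<union> S')) g'" by simp
    have "(\<lambda>w. w powi \<sigma>) holomorphic_on (side 1 - S')"
      by (intro holomorphic_intros) (auto dest: nonzero_side)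
    then have "(g \<circ> (\<lambda>w. w powi \<sigma>)) holomorphic_on (side 1 - S')"
      by (rule holomorphic_on_compose_gen[OF _ g(2)]) (auto simp: powi_mem_side(1)[OF \<sigma>] inS)
    then have "g' holomorphic_on (side 1 - S')"
      unfolding g'_def o_def by (intro holomorphic_on_mult holomorphic_on_power_int) (auto dest: nonzero_side intro: holomorphic_intros)
    moreover have "ball 0 1 - ({0} \<union> S') = side 1 - S'" by (auto simp: side_pos)
    ultimately show "g' holomorphic_on (ball 0 1 - ({0} \<union> S'))" by simp
    have "((\<lambda>w. w * g' w) \<longlongrightarrow> c) (at 0)"
    proof (rule Lim_transform_eventually[OF lim_end])
      show "\<forall>\<^sub>F w in at 0. w powi \<sigma> * g (w powi \<sigma>) = w * g' w"
        using \<sigma> by (intro eventually_at_topological[THEN iffD2] exI[of _ UNIV]) (auto simp: g'_def power_int_minus field_simps power2_eq_square)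
    qed
    then show "((\<lambda>w. w * g' w) \<longlongrightarrow> c) (at 0)" .
    fix p assume "p \<in> S'"
    then have p: "p powi \<sigma> \<in> S" "p \<noteq> 0" using inS S' by (auto simp: side_def)
    have "((\<lambda>w. w powi \<sigma>) \<longlongrightarrow> p powi \<sigma>) (at p)"
      using p by (intro tendsto_intros) auto
    moreover have "\<forall>\<^sub>F w in at p. w powi \<sigma> \<noteq> p powi \<sigma>"
      using powi_powi_sign[OF \<sigma>] unfolding eventually_at_topological by (metis UNIV_I open_UNIV)
    ultimately have "filterlim (\<lambda>w. w powi \<sigma>) (at (p powi \<sigma>)) (at p)"
      by (rule filterlim_atI)
    then have "((\<lambda>w. (w powi \<sigma> - p powi \<sigma>) * g (w powi \<sigma>)) \<longlongrightarrow> 0) (at p)"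
      by (rule filterlim_compose[OF lim[OF p(1)]])
    \<comment> \<open>This factor converts \<open>w powi \<sigma> - p powi \<sigma>\<close> into w -
      p together with the Jacobian: 1/w - 1/p = -(w - p)/(w p), and multiplying by -p/w leaves (w -
      p) w^(-2).\<close>
    moreover have "((\<lambda>w. if \<sigma> = 1 then 1 else - (p / w)) \<longlongrightarrow> (if \<sigma> = 1 then 1 else - (p/p))) (at p)"
      using p by (cases "\<sigma> = 1") (auto intro!: tendsto_eq_intros)
    ultimately have "((\<lambda>w. (w powi \<sigma> - p powi \<sigma>) * g (w powi \<sigma>) * (if \<sigma> = 1 then 1 else - (p / w))) \<longlongrightarrow> 0 * (if \<sigma> = 1 then 1 else - (p/p))) (at p)"
      by (rule tendsto_mult)
    then have "((\<lambda>w. (w powi \<sigma> - p powi \<sigma>) * g (w powi \<sigma>) * (if \<sigma> = 1 then 1 else - (p / w))) \<longlongrightarrow> 0) (at p)"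
      by simp
    then show "((\<lambda>z. (z - p) * g' z) \<longlongrightarrow> 0) (at p)"
    proof (rule Lim_transform_eventually)
      have "\<forall>\<^sub>F w in at p. w \<noteq> 0" by (rule eventually_neq_at_within)
      then show "\<forall>\<^sub>F w in at p. (w powi \<sigma> - p powi \<sigma>) * g (w powi \<sigma>) * (if \<sigma> = 1 then 1 else - (p / w)) = (w - p) * g' w"
      proof eventually_elim
        case (elim w)
        have "(inverse w - inverse p) * (- (p * inverse w)) = (inverse p * p) * ((w - p) * (inverse w * inverse w))"
          unfolding inverse_diff_inverse[OF elim p(2)] minus_mult_minus mult_minus_left mult_minus_right by (simp only: mult_ac minus_minus)
        then show ?case using \<sigma> p(2) by (auto simp: g'_def power_int_minus divide_inverse power2_eq_square)
      qed
    qed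
  qed
  then show ?thesis using cint_powi[OF \<sigma>, of g] by (simp add: g'_def[abs_def])
qed

text \<open>Boundary uniqueness: pull back along \<open>\<zeta> \<mapsto> exp (i\<sigma>\<zeta>)\<close>, which maps the upper half plane to
  the given side of the unit circle, and reflect.\<close>

lemma zero_on_circle_imp_zero:
  assumes \<sigma>: "\<sigma> = 1 \<or> \<sigma> = -1" and S: "finite S" "S \<subseteq> side \<sigma>"
    and g: "continuous_on (cside \<sigma> - S) g" "g holomorphic_on (side \<sigma> - S)"
    and zero: "\<And>z. norm z = 1 \<Longrightarrow> g z = 0"
    and z: "z \<in> cside \<sigma> - S"
  shows "g z = 0"
proof (cases "norm z = 1")
  case False
  then have z: "z \<in> side \<sigma> - S" using cside_cases[OF _ \<sigma>] z by blast
  define e where "e \<zeta> = exp (\<i> * of_int \<sigma> * \<zeta>)" for \<zeta>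
  have e0: "e \<zeta> \<noteq> 0" for \<zeta> by (simp add: e_def)
  have ne: "norm (e \<zeta> powi \<sigma>) = exp (- Im \<zeta>)" for \<zeta>
    using \<sigma> by (auto simp: e_def power_int_minus norm_inverse exp_minus)
  obtain \<rho> where \<rho>: "\<rho> < 1" "\<rho> > 0" "\<And>p. p \<in> S \<Longrightarrow> norm (p powi \<sigma>) < \<rho>"
  proof -
    \<comment> \<open>The inserted 0 keeps the maximum defined when \<open>S\<close> is empty and
      the resulting \<open>\<rho>\<close> positive. The annulus between radius \<open>\<rho>\<close>
      and the circle, measured by the norm of \<open>z powi \<sigma>\<close>, then avoids
      \<open>S\<close>.\<close>
    define X where "X = insert 0 ((\<lambda>p. norm (p powi \<sigma>)) ` S)"
    have "Max X < 1" "0 \<le> Max X" using S by (auto simp: X_def side_def intro!: Max_ge)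
    moreover have "norm (p powi \<sigma>) \<le> Max X" if "p \<in> S" for p using that S by (intro Max_ge) (auto simp: X_def)
    ultimately show ?thesis
      using that[of "(1 + Max X)/2"] by force
  qed
  define \<delta> where "\<delta> = - ln \<rho>"
  have \<delta>: "\<delta> > 0" "exp (- \<delta>) = \<rho>" using \<rho> by (auto simp: \<delta>_def)
  \<comment> \<open>\<open>e\<close> maps the open upper half of this strip into the annulus free of
    \<open>S\<close> and the real line onto the circle; the lower half exists only through
    reflection.\<close>
  define V where "V = {\<zeta>. Im \<zeta> < \<delta>} \<inter> {\<zeta>. - \<delta> < Im \<zeta>}"
  have V: "open V" "connected V"
    unfolding V_def
     by (intro open_Int open_halfspace_Im_lt open_halfspace_Im_gt)
        (intro convex_connected convex_Int convex_halfspace_Im_lt convex_halfspace_Im_gt)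
  have mem: "e \<zeta> \<in> cside \<sigma> - S" if "\<zeta> \<in> V" "0 \<le> Im \<zeta>" for \<zeta>
  proof -
    have "norm (e \<zeta> powi \<sigma>) > \<rho>" unfolding ne using that \<delta> by (auto simp: V_def)
    moreover have "norm (e \<zeta> powi \<sigma>) \<le> 1" unfolding ne using that by simp
    ultimately show ?thesis using \<rho>(3)[of "e \<zeta>"] by (auto simp: cside_def e0)
  qed
  have mem': "e \<zeta> \<in> side \<sigma> - S" if "\<zeta> \<in> V" "0 < Im \<zeta>" for \<zeta>
    using mem[of \<zeta>] that by (auto simp: side_def e0 ne)
  define f where "f = g \<circ> e"
  have eh: "e holomorphic_on A" for A unfolding e_def by (intro holomorphic_intros)
  have f0: "f \<zeta> = 0" if "\<zeta> \<in> \<real>" for \<zeta>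
    using that \<sigma> by (auto simp: f_def e_def complex_is_Real_iff intro!: zero)
  have "(\<lambda>z. if 0 \<le> Im z then f z else cnj (f (cnj z))) holomorphic_on V"
  proof (rule Schwarz_reflection[OF V(1)])
    show "f holomorphic_on V \<inter> {z. 0 < Im z}" unfolding f_def
      by (rule holomorphic_on_compose_gen[OF eh g(2)]) (use mem' in blast)
    show "continuous_on (V \<inter> {z. 0 \<le> Im z}) f" unfolding f_def
      by (rule continuous_on_compose[OF holomorphic_on_imp_continuous_on[OF eh] continuous_on_subset[OF g(1)]])
         (use mem in blast)
  qed (auto simp: V_def f0)
  then have fz: "(if 0 \<le> Im \<zeta> then f \<zeta> else cnj (f (cnj \<zeta>))) = 0" if "\<zeta> \<in> V" for \<zeta>
  proof (rule analytic_continuation[where U="\<real>" and \<xi>=0])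
    show "(0::complex) islimpt \<real>"
      unfolding islimpt_approachable
    proof (intro allI impI)
      fix r :: real assume "r > 0"
      then show "\<exists>x'\<in>\<real>. x' \<noteq> 0 \<and> dist x' (0::complex) < r"
        by (intro bexI[of _ "of_real (r/2)"]) auto
    qed
  qed (use V that \<delta> in \<open>auto simp: V_def complex_is_Real_iff f0\<close>)
  define U where "U = {z \<in> side \<sigma>. \<rho> < norm (z powi \<sigma>)}"
  have Usub: "U \<subseteq> side \<sigma> - S" using \<rho>(3) by (force simp: U_def)
  have gU: "g u = 0" if u: "u \<in> U" for u
  proof -
    define \<zeta> where "\<zeta> = Ln u / (\<i> * of_int \<sigma>)"
    have "u \<noteq> 0" using u by (auto simp: U_def side_def)
    then have eu: "e \<zeta> = u" using \<sigma> by (auto simp: e_def \<zeta>_def)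
    have "exp (- Im \<zeta>) < 1" "exp (- \<delta>) < exp (- Im \<zeta>)" using u ne[of \<zeta>] \<delta> by (auto simp: eu U_def side_def)
    then have "\<zeta> \<in> V" "0 < Im \<zeta>" using \<delta> by (auto simp: V_def)
    then show ?thesis using fz[of \<zeta>] by (auto simp: f_def eu)
  qed
  have "open U"
  proof -
    have "U = (\<lambda>z. norm (z powi \<sigma>)) -` {\<rho><..} \<inter> side \<sigma>" by (auto simp: U_def)
    moreover have "continuous_on (side \<sigma>) (\<lambda>z. norm (z powi \<sigma>))"
      by (intro continuous_intros continuous_on_powi_sign) (auto simp: side_def)
    ultimately show ?thesis using open_side[OF \<sigma>] by (metis open_greaterThan continuous_on_open_vimage)
  qed
  moreover have "U \<noteq> {}"
  proof -
    have "e (\<i> * of_real (\<delta>/2)) \<in> U"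
      using \<delta> by (auto simp: U_def side_def ne e0 simp flip: \<delta>(2))
    then show ?thesis by blast
  qed
  \<comment> \<open>Vanishing on the open annulus \<open>U\<close> spreads over the side, which
    stays connected after a finite set is removed.\<close>
  ultimately show ?thesis
    by (intro analytic_continuation_open[of U "side \<sigma> - S" g "\<lambda>_. 0" z])
       (use Usub gU z S(1) g(2) open_side[OF \<sigma>] connected_side[OF \<sigma> S(1)] in \<open>auto intro!: open_Diff finite_imp_closed\<close>)
qed (use zero in auto)

subsection \<open>Jost solutions and their Fourier coefficients\<close>

text \<open>The information comes from infinity, so the value at 0 is bounded by a far value
  \<open>x j\<close> and the inhomogeneities collected on the way. Each exp (e j) is at least 1 and
  can therefore be put in front of the \<open>h\<close> terms as well.\<close>

lemma gronwall:
  fixes x e h :: "nat \<Rightarrow> real"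
  assumes "\<And>j. x j \<le> (1 + e j) * x (Suc j) + h j" "\<And>j. 0 \<le> e j" "\<And>j. 0 \<le> x j" "\<And>j. 0 \<le> h j"
  shows "x 0 \<le> exp (\<Sum>k<j. e k) * (x j + (\<Sum>k<j. h k))"
proof (induction j)
  case (Suc j)
  have "x j + (\<Sum>k<j. h k) \<le> (1 + e j) * x (Suc j) + h j + (\<Sum>k<j. h k)"
    using assms(1)[of j] by simp
  also have "\<dots> = (1 + e j) * x (Suc j) + (\<Sum>k<Suc j. h k)" by simp
  also have "\<dots> \<le> exp (e j) * x (Suc j) + exp (e j) * (\<Sum>k<Suc j. h k)"
  proof (intro add_mono mult_right_mono)
    show "(\<Sum>k<Suc j. h k) \<le> exp (e j) * (\<Sum>k<Suc j. h k)"
      using mult_right_mono[of 1 "exp (e j)" "\<Sum>k<Suc j. h k"] assms(2,4) by (simp add: sum_nonneg)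
  qed (use assms exp_ge_add_one_self[of "e j"] in auto)
  finally have "exp (\<Sum>k<j. e k) * (x j + (\<Sum>k<j. h k)) \<le> exp (\<Sum>k<j. e k) * (exp (e j) * (x (Suc j) + (\<Sum>k<Suc j. h k)))"
    by (intro mult_left_mono) (auto simp: algebra_simps)
  also have "\<dots> = exp (\<Sum>k<Suc j. e k) * (x (Suc j) + (\<Sum>k<Suc j. h k))"
    by (simp add: exp_add)
  finally show ?case using Suc.IH by simp
qed auto

lemma at_top_int_imp_sequence:
  assumes "(g \<longlongrightarrow> c) (at_top :: int filter)"
  shows "(\<lambda>j. g (n + int j)) \<longlonglongrightarrow> c"
proof -
  have "filterlim (\<lambda>j. n + int j) at_top sequentially"
    unfolding filterlim_at_top
  proof
    fix Z
    show "\<forall>\<^sub>F j in sequentially. Z \<le> n + int j"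
      by (rule eventually_sequentiallyI[of "nat (Z - n)"]) auto
  qed
  then show ?thesis using assms by (rule filterlim_compose[rotated])
qed

lemma cint_monomial: "cint (\<lambda>z. z powi e) = (if e = -1 then 1 else 0)"
proof (cases "0 \<le> e")
  case True
  have "((\<lambda>z. z powi e) has_contour_integral 0) (circlepath 0 1)"
    by (rule Cauchy_theorem_convex_simple[of _ UNIV]) (use True in \<open>auto intro!: holomorphic_intros\<close>)
  then show ?thesis using True by (simp add: cint_def contour_integral_unique)
next
  case False
  define k where "k = nat (- e - 1)"
  have "cint (\<lambda>z. z powi e) = cint (\<lambda>z. 1 / (z - 0) ^ Suc k)"
    using False by (intro cint_cong) (auto simp: k_def power_int_def nat_diff_distrib inverse_eq_divide power_one_over simp flip: power_Suc)
  also have "\<dots> = (if e = -1 then 1 else 0)"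
    using False by (subst cint_inverse_power_inside) (auto simp: k_def)
  finally show ?thesis .
qed

text \<open>Recursions \<open>v\<^sub>n = (D + E\<^sub>n) v\<^sub>n\<^sub>+\<^sub>1\<close> in the variable \<open>u = z\<^sup>\<sigma>\<close>, where the diagonal matrix \<open>D\<close> has
  the entry \<open>1/u\<close> at position \<open>\<kappa>\<close> and \<open>u\<close> at the other one, and \<open>E\<^sub>n = \<alpha>\<^sub>n u + \<beta>\<^sub>n / u\<close> is small.
  All four Jost solutions (the ones normalised at \<open>-\<infinity>\<close> after reversing the index) are of this kind.\<close>

locale jost_recursion =
  fixes \<sigma> :: int and \<kappa> :: nat and \<alpha> \<beta> :: "int \<Rightarrow> nat \<Rightarrow> nat \<Rightarrow> complex" and \<epsilon> :: "int \<Rightarrow> real"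
  assumes \<sigma>: "\<sigma> = 1 \<or> \<sigma> = -1" and \<kappa>: "\<kappa> < 2"
    and \<alpha>: "\<And>n i j. i < 2 \<Longrightarrow> j < 2 \<Longrightarrow> norm (\<alpha> n i j) \<le> \<epsilon> n"
    and \<beta>: "\<And>n i j. i < 2 \<Longrightarrow> j < 2 \<Longrightarrow> norm (\<beta> n i j) \<le> \<epsilon> n"
    and summable_weighted: "\<And>n. summable (\<lambda>j. real j * \<epsilon> (n + int j))"
begin

definition sg :: "nat \<Rightarrow> int" where "sg i = (if i = \<kappa> then -1 else 1)"

definition satisfies :: "complex \<Rightarrow> (int \<Rightarrow> nat \<Rightarrow> complex) \<Rightarrow> bool" where
  "satisfies z v \<longleftrightarrow> (\<forall>n. \<forall>i<2. v n i = z powi (\<sigma> * sg i) * v (n+1) i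
      + (\<Sum>j<2. (\<alpha> n i j * z powi \<sigma> + \<beta> n i j * z powi (-\<sigma>)) * v (n+1) j))"

text \<open>One step of the recursion enlarges the sum over the components at most by the factor
  \<open>1 + 4 * \<epsilon> n\<close>: there are two components, and each receives one perturbation
  with u and one with 1/u.\<close>

definition tail :: "int \<Rightarrow> real" where "tail n = (\<Sum>j. 4 * \<epsilon> (n + int j))"

lemma eps_nonneg: "0 \<le> \<epsilon> n"
  using \<alpha>[of 0 0 n] norm_ge_zero[of "\<alpha> n 0 0"] by (simp del: norm_ge_zero)

lemma summable_eps: "summable (\<lambda>j. 4 * \<epsilon> (n + int j))"
proof -
  have "summable (\<lambda>j. real (Suc j) * \<epsilon> (n + int (Suc j)))"
    using summable_weighted[of n] by (subst summable_Suc_iff)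
  moreover have "norm (\<epsilon> (n + int (Suc j))) \<le> real (Suc j) * \<epsilon> (n + int (Suc j))" for j
    using mult_right_mono[of 1 "real (Suc j)" "\<epsilon> (n + int (Suc j))"] eps_nonneg by simp
  ultimately have "summable (\<lambda>j. \<epsilon> (n + int (Suc j)))"
    by (rule summable_comparison_test'[of _ 0])
  then show ?thesis by (subst (asm) summable_Suc_iff) (rule summable_mult)
qed

lemma tail_nonneg: "0 \<le> tail n"
  unfolding tail_def by (intro suminf_nonneg summable_eps) (simp add: eps_nonneg)

lemma partial_le_tail: "(\<Sum>k<j. 4 * \<epsilon> (n + int k)) \<le> tail n"
  unfolding tail_def by (intro sum_le_suminf summable_eps) (simp_all add: eps_nonneg)

lemma tail_mono: "tail (n + int j) \<le> tail n"
proof -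
  have "(\<Sum>k<j. 4 * \<epsilon> (n + int k)) + tail (n + int j) = tail n"
    using suminf_split_initial_segment[OF summable_eps[of n], of j] by (simp add: tail_def add_ac)
  moreover have "0 \<le> (\<Sum>k<j. 4 * \<epsilon> (n + int k))" by (intro sum_nonneg) (simp add: eps_nonneg)
  ultimately show ?thesis by linarith
qed

text \<open>Every index occurring in the tail from J on is at least J, so J times this tail is
  bounded by the tail of the weighted series.\<close>

lemma weighted_tail_tendsto: "(\<lambda>J. real J * tail (n + int J)) \<longlonglongrightarrow> 0"
proof (rule tendsto_sandwich[where f="\<lambda>_. 0" and h="\<lambda>J. \<Sum>j. 4 * (real (j + J) * \<epsilon> (n + int (j + J)))"])
  let ?g = "\<lambda>j. 4 * (real j * \<epsilon> (n + int j))"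
  have sg: "summable ?g" by (rule summable_mult[OF summable_weighted])
  show "\<forall>\<^sub>F J in sequentially. real J * tail (n + int J) \<le> (\<Sum>j. ?g (j + J))"
  proof (intro always_eventually allI)
    fix J
    have "real J * tail (n + int J) = (\<Sum>j. real J * (4 * \<epsilon> (n + int J + int j)))"
      unfolding tail_def by (rule suminf_mult[symmetric, OF summable_eps])
    also have "\<dots> \<le> (\<Sum>j. ?g (j + J))"
      by (intro suminf_le summable_mult[OF summable_eps] summable_ignore_initial_segment[OF sg])
         (auto simp: algebra_simps eps_nonneg)
    finally show "real J * tail (n + int J) \<le> (\<Sum>j. ?g (j + J))" .
  qed
  show "(\<lambda>J. \<Sum>j. ?g (j + J)) \<longlonglongrightarrow> 0"
    by (rule suminf_exist_split2[OF sg])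
qed (auto simp: tail_nonneg)

lemma tail_tendsto: "(\<lambda>J. tail (n + int J)) \<longlonglongrightarrow> 0"
proof (rule tendsto_sandwich[OF _ _ _ weighted_tail_tendsto[of n]])
  show "\<forall>\<^sub>F J in sequentially. tail (n + int J) \<le> real J * tail (n + int J)"
  proof (rule eventually_sequentiallyI[of 1])
    fix J :: nat assume "1 \<le> J"
    then show "tail (n + int J) \<le> real J * tail (n + int J)"
      using mult_right_mono[of 1 "real J" "tail (n + int J)"] tail_nonneg by simp
  qed
qed (auto simp: tail_nonneg)

text \<open>As j tends to infinity nothing remains of the far value, and only the inhomogeneity
  counts. With \<open>c = 0\<close> the conclusion becomes x 0 <= 0, the form that proves
  vanishing.\<close>

lemma gronwall_tail:
  assumes "\<And>j. x j \<le> (1 + 4 * \<epsilon> (n + int j)) * x (Suc j) + c * (4 * \<epsilon> (n + int j))"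
    and "\<And>j. 0 \<le> x j" and "0 \<le> c" and "x \<longlonglongrightarrow> 0"
  shows "x 0 \<le> exp (tail n) * (c * tail n)"
proof (rule LIMSEQ_le_const)
  show "(\<lambda>j. exp (tail n) * (x j + c * tail n)) \<longlonglongrightarrow> exp (tail n) * (c * tail n)"
    using assms(4) by (auto intro!: tendsto_eq_intros)
  have "x 0 \<le> exp (tail n) * (x j + c * tail n)" for j
  proof -
    have "x 0 \<le> exp (\<Sum>k<j. 4 * \<epsilon> (n + int k)) * (x j + (\<Sum>k<j. c * (4 * \<epsilon> (n + int k))))"
      by (rule gronwall) (use assms eps_nonneg in auto)
    also have "\<dots> \<le> exp (tail n) * (x j + c * tail n)"
      using partial_le_tail[of n j] assms(2,3) eps_nonneg unfolding sum_distrib_left[symmetric]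
      by (intro mult_mono add_left_mono mult_left_mono add_nonneg_nonneg mult_nonneg_nonneg sum_nonneg) auto
    finally show ?thesis .
  qed
  then show "\<exists>N. \<forall>j\<ge>N. x 0 \<le> exp (tail n) * (x j + c * tail n)" by blast
qed

lemma norm_step_le:
  assumes "norm z = 1" "i < 2"
  shows "norm (\<Sum>j<2. (\<alpha> n i j * z powi \<sigma> + \<beta> n i j * z powi (-\<sigma>)) * w j) \<le> 2 * \<epsilon> n * (\<Sum>j<2. norm (w j))"
proof -
  have "norm ((\<alpha> n i j * z powi \<sigma> + \<beta> n i j * z powi (-\<sigma>)) * w j) \<le> 2 * \<epsilon> n * norm (w j)" if "j < 2" for j
  proof -
    have "norm (\<alpha> n i j * z powi \<sigma> + \<beta> n i j * z powi (-\<sigma>)) \<le> \<epsilon> n + \<epsilon> n"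
      using \<alpha>[OF assms(2) that, of n] \<beta>[OF assms(2) that, of n]
      by (intro norm_triangle_le add_mono) (auto simp: norm_mult norm_power_int assms)
    then show ?thesis by (simp add: norm_mult mult_right_mono)
  qed
  then show ?thesis unfolding sum_distrib_left by (intro sum_norm_le) auto
qed

text \<open>This is the solution of the unperturbed recursion with matrix D that lives in the
  component \<open>\<kappa>\<close> alone, hence the prescribed asymptotics of a Jost
  solution.\<close>

definition free :: "complex \<Rightarrow> int \<Rightarrow> nat \<Rightarrow> complex" where
  "free z n i = (if i = \<kappa> then z powi (\<sigma> * n) else 0)"

lemma free_step: "z \<noteq> 0 \<Longrightarrow> free z n i = z powi (\<sigma> * sg i) * free z (n+1) i"
  by (auto simp: free_def sg_def power_int_add[symmetric] algebra_simps)

lemma sum_norm_free: "norm z = 1 \<Longrightarrow> (\<Sum>j<2. norm (free z n j)) = 1"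
  using \<kappa> by (auto simp: free_def numeral_2_eq_2 less_Suc_eq norm_power_int)

text \<open>The constant \<open>c\<close> covers two uses: \<open>c = 1\<close> compares a Jost
  solution with its asymptotics uniformly on the circle, and \<open>c = 0\<close> yields
  uniqueness.\<close>

lemma estimate:
  assumes z: "norm z = 1" and v: "satisfies z v"
    and lim: "\<And>i. i < 2 \<Longrightarrow> (\<lambda>j. v (n + int j) i - c * free z (n + int j) i) \<longlonglongrightarrow> 0"
  shows "(\<Sum>i<2. norm (v n i - c * free z n i)) \<le> exp (tail n) * (norm c * tail n)"
proof -
  define x where "x m = (\<Sum>i<2. norm (v m i - c * free z m i))" for m
  have step: "x m \<le> (1 + 4 * \<epsilon> m) * x (m+1) + norm c * (4 * \<epsilon> m)" for m
  proof -
    have "norm (v m i - c * free z m i) \<le> norm (v (m+1) i - c * free z (m+1) i) + 2 * \<epsilon> m * (x (m+1) + norm c)"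
      if i: "i < 2" for i
    proof -
      have "z \<noteq> 0" using z by auto
      have "v m i - c * free z m i = z powi (\<sigma> * sg i) * (v (m+1) i - c * free z (m+1) i)
          + (\<Sum>j<2. (\<alpha> m i j * z powi \<sigma> + \<beta> m i j * z powi (-\<sigma>)) * v (m+1) j)"
        using spec[OF v[unfolded satisfies_def], of m] i unfolding free_step[OF \<open>z \<noteq> 0\<close>, of m i]
        by (simp only: algebra_simps)
      also have "norm \<dots> \<le> norm (v (m+1) i - c * free z (m+1) i) + 2 * \<epsilon> m * (\<Sum>j<2. norm (v (m+1) j))"
        by (intro norm_triangle_le add_mono norm_step_le z i) (simp add: norm_mult norm_power_int z)
      also have "(\<Sum>j<2. norm (v (m+1) j)) \<le> (\<Sum>j<2. norm (v (m+1) j - c * free z (m+1) j) + norm c * norm (free z (m+1) j))"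
        by (intro sum_mono) (metis norm_mult norm_triangle_sub add.commute)
      also have "\<dots> = x (m+1) + norm c"
        using sum_norm_free[OF z, of "m+1"] by (simp add: x_def sum.distrib flip: sum_distrib_left)
      finally show ?thesis by (simp add: eps_nonneg mult_left_mono)
    qed
    then have "x m \<le> (\<Sum>i<2. norm (v (m+1) i - c * free z (m+1) i) + 2 * \<epsilon> m * (x (m+1) + norm c))"
      unfolding x_def[of m] by (intro sum_mono) auto
    then show ?thesis by (simp add: sum.distrib x_def algebra_simps)
  qed
  have "x (n + int 0) \<le> exp (tail n) * (norm c * tail n)"
  proof (rule gronwall_tail)
    show "x (n + int j) \<le> (1 + 4 * \<epsilon> (n + int j)) * x (n + int (Suc j)) + norm c * (4 * \<epsilon> (n + int j))" for j
      using step[of "n + int j"] by (simp add: add_ac)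
    show "(\<lambda>j. x (n + int j)) \<longlonglongrightarrow> 0"
      unfolding x_def using lim by (intro tendsto_null_sum tendsto_norm_zero) auto
  qed (auto simp: x_def sum_nonneg)
  then show ?thesis by (simp add: x_def)
qed

lemma uniqueness:
  assumes "norm z = 1" "satisfies z v" "\<And>i. i < 2 \<Longrightarrow> (\<lambda>j. v (n + int j) i) \<longlonglongrightarrow> 0" "i < 2"
  shows "v n i = 0"
proof -
  have "(\<Sum>i<2. norm (v n i)) \<le> 0" using estimate[of z v n 0] assms by simp
  then have "(\<Sum>i<2. norm (v n i)) = 0" by (simp add: antisym sum_nonneg)
  then show ?thesis using assms(4) by (simp add: sum_nonneg_eq_0_iff)
qed

lemma satisfies_lincomb:
  assumes "satisfies z v" "satisfies z w"
  shows "satisfies z (\<lambda>n i. a * v n i + b * w n i)"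
  unfolding satisfies_def
proof (intro allI impI)
  fix n and i :: nat assume i: "i < 2"
  note * = spec[OF assms(1)[unfolded satisfies_def], of n, rule_format, OF i] spec[OF assms(2)[unfolded satisfies_def], of n, rule_format, OF i]
  show "a * v n i + b * w n i = z powi (\<sigma> * sg i) * (a * v (n+1) i + b * w (n+1) i)
      + (\<Sum>j<2. (\<alpha> n i j * z powi \<sigma> + \<beta> n i j * z powi (-\<sigma>)) * (a * v (n+1) j + b * w (n+1) j))"
    by (simp only: * algebra_simps sum.distrib sum_distrib_left)
qed

text \<open>On Fourier coefficients, multiplication by u or 1/u shifts the index by one, so a window
  is controlled by the window at the next site that is longer by one at each end. The weight
  \<open>w\<close> takes up what remains when the free part is subtracted.\<close>

lemma window_step:
  fixes y :: "int \<Rightarrow> nat \<Rightarrow> int \<Rightarrow> real"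
  assumes "\<And>i l. i < 2 \<Longrightarrow> y n i l \<le> y (n+1) i (l - sg i) + \<epsilon> n * (\<Sum>j<2. y (n+1) j (l-1) + y (n+1) j (l+1)) + \<epsilon> n * w l"
    and nonneg: "\<And>n i l. 0 \<le> y n i l"
  shows "(\<Sum>l=a..b. \<Sum>i<2. y n i l) \<le> (1 + 4 * \<epsilon> n) * (\<Sum>l=a-1..b+1. \<Sum>i<2. y (n+1) i l) + 2 * \<epsilon> n * (\<Sum>l=a..b. w l)"
proof -
  have shift: "(\<Sum>l=a..b. g (l + c)) \<le> (\<Sum>l=a-1..b+1. g l)" if "\<bar>c\<bar> \<le> 1" "\<And>l. 0 \<le> g l" for c and g :: "int \<Rightarrow> real"
  proof -
    have "(\<Sum>l=a..b. g (l + c)) = (\<Sum>l\<in>(\<lambda>l. l + c) ` {a..b}. g l)"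
      by (subst sum.reindex) (auto simp: inj_on_def)
    also have "\<dots> \<le> (\<Sum>l=a-1..b+1. g l)"
      using that by (intro sum_mono2) auto
    finally show ?thesis .
  qed
  let ?W = "\<Sum>l=a-1..b+1. \<Sum>i<2. y (n+1) i l"
  have "(\<Sum>l=a..b. \<Sum>i<2. y n i l)
      \<le> (\<Sum>l=a..b. \<Sum>i<2. y (n+1) i (l - sg i) + \<epsilon> n * (\<Sum>j<2. y (n+1) j (l-1) + y (n+1) j (l+1)) + \<epsilon> n * w l)"
    by (intro sum_mono assms) auto
  also have "\<dots> = (\<Sum>i<2. \<Sum>l=a..b. y (n+1) i (l + - sg i)) + 2 * \<epsilon> n * (\<Sum>l=a..b. (\<Sum>j<2. y (n+1) j (l + -1)))
       + 2 * \<epsilon> n * (\<Sum>l=a..b. (\<Sum>j<2. y (n+1) j (l+1))) + 2 * \<epsilon> n * (\<Sum>l=a..b. w l)"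
    by (subst sum.swap[of _ "{..<2}" "{a..b}"]) (simp add: sum.distrib sum_distrib_left algebra_simps)
  also have "\<dots> \<le> ?W + 2 * \<epsilon> n * ?W + 2 * \<epsilon> n * ?W + 2 * \<epsilon> n * (\<Sum>l=a..b. w l)"
  proof (intro add_mono mult_left_mono order_refl)
    have "(\<Sum>i<2. \<Sum>l=a..b. y (n+1) i (l + - sg i)) \<le> (\<Sum>i<2. \<Sum>l=a-1..b+1. y (n+1) i l)"
      by (intro sum_mono shift nonneg) (auto simp: sg_def)
    also have "\<dots> = ?W" by (rule sum.swap)
    finally show "(\<Sum>i<2. \<Sum>l=a..b. y (n+1) i (l + - sg i)) \<le> ?W" .
  qed (use nonneg eps_nonneg in \<open>auto intro!: shift[of "-1", simplified] shift[of 1, simplified] sum_nonneg\<close>)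
  finally show ?thesis by (simp add: algebra_simps)
qed

end

section \<open>Fourier coefficients and power series of a Jost solution\<close>

locale jost = jost_recursion +
  fixes f :: "int \<Rightarrow> nat \<Rightarrow> complex \<Rightarrow> complex"
  assumes sat: "\<And>z. norm z = 1 \<Longrightarrow> satisfies z (\<lambda>n i. f n i z)"
    and asym: "\<And>z n i. norm z = 1 \<Longrightarrow> i < 2 \<Longrightarrow> (\<lambda>j. f (n + int j) i z - free z (n + int j) i) \<longlonglongrightarrow> 0"
    and cont: "\<And>n i. i < 2 \<Longrightarrow> continuous_on (cside \<sigma>) (f n i)"
    and holo: "\<And>n i. i < 2 \<Longrightarrow> f n i holomorphic_on (side \<sigma>)"
begin

text \<open>This is the coefficient of u^l with u = z^\<sigma>. It equals \<open>Kc\<close> for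
  \<open>\<sigma> = 1\<close> and \<open>Kbc\<close> for \<open>\<sigma> = -1\<close>.\<close>

definition coef :: "int \<Rightarrow> nat \<Rightarrow> int \<Rightarrow> complex" where
  "coef n i l = cint (\<lambda>z. f n i z * z powi (- \<sigma> * l - 1))"

lemma cont_sphere: "i < 2 \<Longrightarrow> continuous_on (sphere 0 1) (f n i)"
  using cont[of i n] by (rule continuous_on_subset) (auto intro: sphere_in_cside)

lemma cont_powi_sphere: "continuous_on (sphere 0 1) (\<lambda>z::complex. z powi k)"
  by (rule continuous_on_powi_sign) auto

lemma coef_step:
  assumes i: "i < 2"
  shows "coef n i l = coef (n+1) i (l - sg i) + (\<Sum>j<2. \<alpha> n i j * coef (n+1) j (l-1) + \<beta> n i j * coef (n+1) j (l+1))"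
proof -
  have "coef n i l = cint (\<lambda>z. f (n+1) i z * z powi (- \<sigma> * (l - sg i) - 1)
      + (\<Sum>j<2. \<alpha> n i j * (f (n+1) j z * z powi (- \<sigma> * (l-1) - 1)) + \<beta> n i j * (f (n+1) j z * z powi (- \<sigma> * (l+1) - 1))))"
    unfolding coef_def
  proof (rule cint_cong)
    fix z :: complex assume z: "norm z = 1"
    then have "z \<noteq> 0" by auto
    then have p: "z powi (a + b) = z powi a * z powi b" for a b by (simp add: power_int_add)
    define w where "w = z powi (- \<sigma> * l - 1)"
    have e: "z powi (- \<sigma> * (l - sg i) - 1) = z powi (\<sigma> * sg i) * w" "z powi (- \<sigma> * (l-1) - 1) = z powi \<sigma> * w"
      "z powi (- \<sigma> * (l+1) - 1) = z powi (- \<sigma>) * w"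
      unfolding w_def p[symmetric] by (auto simp: algebra_simps)
    have "f n i z = z powi (\<sigma> * sg i) * f (n+1) i z + (\<Sum>j<2. (\<alpha> n i j * z powi \<sigma> + \<beta> n i j * z powi (-\<sigma>)) * f (n+1) j z)"
      using sat[OF z] i unfolding satisfies_def by blast
    then show "f n i z * z powi (- \<sigma> * l - 1) = f (n+1) i z * z powi (- \<sigma> * (l - sg i) - 1)
      + (\<Sum>j<2. \<alpha> n i j * (f (n+1) j z * z powi (- \<sigma> * (l-1) - 1)) + \<beta> n i j * (f (n+1) j z * z powi (- \<sigma> * (l+1) - 1)))"
      unfolding e w_def[symmetric] by (simp only: distrib_right distrib_left sum_distrib_right sum_distrib_left sum.distrib mult_ac)
  qed
  also have "\<dots> = coef (n+1) i (l - sg i) + (\<Sum>j<2. \<alpha> n i j * coef (n+1) j (l-1) + \<beta> n i j * coef (n+1) j (l+1))"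
  proof -
    define F where "F j m z = f (n+1) j z * z powi (- \<sigma> * m - 1)" for j m z
    have cF: "continuous_on (sphere 0 1) (F j m)" if "j < 2" for j m
      unfolding F_def by (intro continuous_intros cont_sphere cont_powi_sphere that)
    have "cint (\<lambda>z. a * F j b z + a' * F j c z) = a * cint (F j b) + a' * cint (F j c)" if "j < 2" for j a a' b c
      using cF[OF that] by (simp add: cint_add cint_cmult continuous_on_mult_left)
    moreover have "continuous_on (sphere 0 1) (\<lambda>z. a * F j b z + a' * F j c z)" if "j < 2" for j a a' b c
      by (intro continuous_intros cF that)
    ultimately have "cint (\<lambda>z. \<Sum>j<2. \<alpha> n i j * F j (l-1) z + \<beta> n i j * F j (l+1) z)
       = (\<Sum>j<2. \<alpha> n i j * cint (F j (l-1)) + \<beta> n i j * cint (F j (l+1)))"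
      by (subst cint_sum) auto
    moreover have "cint (\<lambda>z. F i (l - sg i) z + (\<Sum>j<2. \<alpha> n i j * F j (l-1) z + \<beta> n i j * F j (l+1) z))
       = cint (F i (l - sg i)) + cint (\<lambda>z. \<Sum>j<2. \<alpha> n i j * F j (l-1) z + \<beta> n i j * F j (l+1) z)"
      by (rule cint_add) (auto intro!: continuous_intros cF i)
    ultimately show ?thesis by (simp add: coef_def F_def[abs_def])
  qed
  finally show ?thesis .
qed

definition dev :: "int \<Rightarrow> nat \<Rightarrow> int \<Rightarrow> complex" where
  "dev n i l = coef n i l - (if i = \<kappa> \<and> l = n then 1 else 0)"

text \<open>A Fourier coefficient is bounded by the supremum on the circle. The bound carries no
  decay in \<open>l\<close>, but it tends to 0 as \<open>n\<close> grows and so supplies the limits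
  at infinity for the summed estimates.\<close>

lemma norm_dev_le:
  assumes i: "i < 2"
  shows "norm (dev n i l) \<le> exp (tail n) * tail n"
proof -
  have c: "continuous_on (sphere 0 1) (\<lambda>z. free z n i)"
    by (cases "i = \<kappa>") (simp_all add: free_def cont_powi_sphere)
  have free: "cint (\<lambda>z. free z n i * z powi (- \<sigma> * l - 1)) = (if i = \<kappa> \<and> l = n then 1 else 0)"
  proof (cases "i = \<kappa>")
    case True
    have "cint (\<lambda>z. free z n i * z powi (- \<sigma> * l - 1)) = cint (\<lambda>z. z powi (\<sigma> * (n - l) - 1))"
    proof (rule cint_cong)
      fix z :: complex assume "norm z = 1"
      then have "z \<noteq> 0" by auto
      then have "z powi (\<sigma> * n) * z powi (- \<sigma> * l - 1) = z powi (\<sigma> * n + (- \<sigma> * l - 1))"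
        by (simp only: power_int_add simp_thms)
      also have "\<sigma> * n + (- \<sigma> * l - 1) = \<sigma> * (n - l) - 1" by (simp add: algebra_simps)
      finally show "free z n i * z powi (- \<sigma> * l - 1) = z powi (\<sigma> * (n - l) - 1)" by (simp add: free_def True)
    qed
    then show ?thesis unfolding cint_monomial using \<sigma> True by auto
  qed (simp add: free_def cint_def)
  have c': "continuous_on (sphere 0 1) (\<lambda>z. free z n i * z powi (- \<sigma> * l - 1))"
    by (intro continuous_intros c cont_powi_sphere)
  have "cint (\<lambda>z. f n i z * z powi (- \<sigma> * l - 1) + (-1) * (free z n i * z powi (- \<sigma> * l - 1)))
      = cint (\<lambda>z. f n i z * z powi (- \<sigma> * l - 1)) + cint (\<lambda>z. (-1) * (free z n i * z powi (- \<sigma> * l - 1)))"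
    by (intro cint_add continuous_intros cont_sphere cont_powi_sphere c i)
  also have "\<dots> = dev n i l"
    unfolding cint_cmult[OF c'] free by (simp add: dev_def coef_def)
  finally have "dev n i l = cint (\<lambda>z. f n i z * z powi (- \<sigma> * l - 1) + (-1) * (free z n i * z powi (- \<sigma> * l - 1)))" ..
  also have "norm \<dots> \<le> exp (tail n) * tail n"
  proof (rule cint_bound)
    fix z :: complex assume z: "norm z = 1"
    have "norm (f n i z * z powi (- \<sigma> * l - 1) + (-1) * (free z n i * z powi (- \<sigma> * l - 1)))
       = norm ((f n i z - 1 * free z n i) * z powi (- \<sigma> * l - 1))" by (simp add: algebra_simps)
    also have "\<dots> = norm (f n i z - 1 * free z n i)" by (simp add: norm_mult norm_power_int z)
    also have "\<dots> \<le> (\<Sum>i<2. norm (f n i z - 1 * free z n i))"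
      by (rule member_le_sum) (use i in auto)
    also have "\<dots> \<le> exp (tail n) * (norm (1::complex) * tail n)"
      by (rule estimate[OF z sat[OF z]]) (use asym[OF z] in simp)
    finally show "norm (f n i z * z powi (- \<sigma> * l - 1) + (-1) * (free z n i * z powi (- \<sigma> * l - 1))) \<le> exp (tail n) * tail n"
      by simp
  qed (intro continuous_intros cont_sphere cont_powi_sphere c i)
  finally show ?thesis .
qed

lemma norm_dev_shift_le:
  assumes "i < 2"
  shows "norm (dev (n + int J) i l) \<le> exp (tail n) * tail (n + int J)"
proof -
  have "norm (dev (n + int J) i l) \<le> exp (tail (n + int J)) * tail (n + int J)" by (rule norm_dev_le[OF assms])
  also have "\<dots> \<le> exp (tail n) * tail (n + int J)" by (intro mult_right_mono) (auto simp: tail_mono tail_nonneg)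
  finally show ?thesis .
qed

lemma norm_alpha_beta_sum:
  assumes "i < 2"
  shows "norm (\<Sum>j<2. \<alpha> n i j * a j + \<beta> n i j * b j) \<le> \<epsilon> n * (\<Sum>j<2. norm (a j) + norm (b j))"
  unfolding sum_distrib_left
proof (intro sum_norm_le norm_triangle_le)
  fix j :: nat assume "j \<in> {..<2}"
  then show "norm (\<alpha> n i j * a j) + norm (\<beta> n i j * b j) \<le> \<epsilon> n * (norm (a j) + norm (b j))"
    using \<alpha>[OF assms, of j n] \<beta>[OF assms, of j n] by (auto simp: norm_mult distrib_left intro!: add_mono mult_right_mono)
qed

lemma window_tendsto_0:
  fixes y :: "nat \<Rightarrow> nat \<Rightarrow> int \<Rightarrow> complex"
  assumes y: "\<And>J i l. i < 2 \<Longrightarrow> l \<le> b + int J \<Longrightarrow> norm (y J i l) \<le> exp (tail n) * tail (n + int J)"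
  shows "(\<lambda>J. \<Sum>l=a - int J..b + int J. \<Sum>i<2. norm (y J i l)) \<longlonglongrightarrow> 0"
proof (rule Lim_null_comparison)
  let ?w = "nat (b - a + 1)"
  show "\<forall>\<^sub>F J in sequentially. norm (\<Sum>l=a - int J..b + int J. \<Sum>i<2. norm (y J i l)) \<le> real (?w + 2 * J) * (2 * (exp (tail n) * tail (n + int J)))"
  proof (intro always_eventually allI)
    fix J
    have "norm (\<Sum>l=a - int J..b + int J. \<Sum>i<2. norm (y J i l)) = (\<Sum>l=a - int J..b + int J. \<Sum>i<2. norm (y J i l))"
      unfolding real_norm_def by (intro abs_of_nonneg sum_nonneg norm_ge_zero)
    also have "\<dots> \<le> (\<Sum>l=a - int J..b + int J. \<Sum>i<(2::nat). exp (tail n) * tail (n + int J))"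
      by (intro sum_mono y) auto
    also have "\<dots> = real (card {a - int J..b + int J}) * (2 * (exp (tail n) * tail (n + int J)))" by simp
    also have "\<dots> \<le> real (?w + 2 * J) * (2 * (exp (tail n) * tail (n + int J)))"
      by (intro mult_right_mono) (auto simp: tail_nonneg)
    finally show "norm (\<Sum>l=a - int J..b + int J. \<Sum>i<2. norm (y J i l)) \<le> real (?w + 2 * J) * (2 * (exp (tail n) * tail (n + int J)))" .
  qed
  have "(\<lambda>J. 2 * exp (tail n) * (real ?w * tail (n + int J) + 2 * (real J * tail (n + int J)))) \<longlonglongrightarrow> 2 * exp (tail n) * (real ?w * 0 + 2 * 0)"
    by (intro tendsto_intros tail_tendsto weighted_tail_tendsto)
  then show "(\<lambda>J. real (?w + 2 * J) * (2 * (exp (tail n) * tail (n + int J)))) \<longlonglongrightarrow> 0"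
    by (simp add: algebra_simps)
qed

text \<open>The window grows by one on either side at each step, so its length at \<open>n + J\<close> is linear in \<open>J\<close>;
  this is why the weighted sums of \<open>\<epsilon>\<close> have to converge.\<close>

lemma dev_window: "(\<Sum>l=a..b. \<Sum>i<2. norm (dev n i l)) \<le> exp (tail n) * tail n"
proof -
  define x where "x J = (\<Sum>l=a - int J..b + int J. \<Sum>i<2. norm (dev (n + int J) i l))" for J
  have "x 0 \<le> exp (tail n) * (1 * tail n)"
  proof (rule gronwall_tail[where x = x and n = n and c = 1])
    fix J
    let ?m = "n + int J"
    \<comment> \<open>The free part at site \<open>?m + 1\<close> sits at index
      \<open>?m + 1\<close>; the u term moves it to \<open>?m + 2\<close> and the 1/u term to
      \<open>?m\<close>. The total mass 2 times \<open>2 * \<epsilon> ?m\<close> gives the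
      inhomogeneity \<open>4 * \<epsilon> ?m\<close>.\<close>
    let ?w = "\<lambda>l. (if l = ?m + 2 then 1 else 0) + (if l = ?m then 1 else 0 :: real)"
    have "x J \<le> (1 + 4 * \<epsilon> ?m) * (\<Sum>l=a - int J - 1..b + int J + 1. \<Sum>i<2. norm (dev (?m+1) i l))
       + 2 * \<epsilon> ?m * (\<Sum>l=a - int J..b + int J. ?w l)"
      unfolding x_def
    proof (rule window_step[where y = "\<lambda>n i l. norm (dev n i l)" and n = ?m and w = ?w])
      fix i :: nat and l assume i: "i < 2"
      let ?d = "\<lambda>j l. if j = \<kappa> \<and> l = ?m + 1 then 1 else 0 :: complex"
      have eq: "dev ?m i l = dev (?m+1) i (l - sg i)
         + (\<Sum>j<2. \<alpha> ?m i j * dev (?m+1) j (l-1) + \<beta> ?m i j * dev (?m+1) j (l+1))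
         + (\<Sum>j<2. \<alpha> ?m i j * ?d j (l-1) + \<beta> ?m i j * ?d j (l+1))"
        unfolding dev_def coef_step[OF i, of ?m l] by (auto simp: algebra_simps sum.distrib sum_subtractf sg_def)
      have le: "norm (dev ?m i l) \<le> norm (dev (?m+1) i (l - sg i))
         + \<epsilon> ?m * (\<Sum>j<2. norm (dev (?m+1) j (l-1)) + norm (dev (?m+1) j (l+1)))
         + \<epsilon> ?m * (\<Sum>j<2. norm (?d j (l-1)) + norm (?d j (l+1)))"
        unfolding eq by (intro norm_triangle_le add_mono norm_alpha_beta_sum i order_refl)
      have w: "(\<Sum>j<2. norm (?d j (l-1)) + norm (?d j (l+1))) = ?w l"
      proof -
        have "\<kappa> = 0 \<or> \<kappa> = 1" using \<kappa> by auto
        moreover have "l - 1 = ?m + 1 \<longleftrightarrow> l = ?m + 2" "l + 1 = ?m + 1 \<longleftrightarrow> l = ?m" by auto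
        ultimately show ?thesis by (elim disjE) (simp_all add: lessThan_nat_numeral lessThan_Suc)
      qed
      show "norm (dev ?m i l) \<le> norm (dev (?m+1) i (l - sg i))
         + \<epsilon> ?m * (\<Sum>j<2. norm (dev (?m+1) j (l-1)) + norm (dev (?m+1) j (l+1))) + \<epsilon> ?m * ?w l"
        using le unfolding w .
    qed auto
    also have "(\<Sum>l=a - int J..b + int J. ?w l) \<le> 2" by (auto simp: sum.distrib)
    finally have "x J \<le> (1 + 4 * \<epsilon> ?m) * (\<Sum>l=a - int J - 1..b + int J + 1. \<Sum>i<2. norm (dev (?m+1) i l)) + 2 * \<epsilon> ?m * 2"
      using eps_nonneg[of ?m] by (auto simp: mult_left_mono)
    then show "x J \<le> (1 + 4 * \<epsilon> ?m) * x (Suc J) + 1 * (4 * \<epsilon> ?m)"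
      by (simp add: x_def algebra_simps)
  next
    show "x \<longlonglongrightarrow> 0"
      unfolding x_def by (rule window_tendsto_0) (rule norm_dev_shift_le)
  qed (auto simp: x_def sum_nonneg)
  then show ?thesis by (simp add: x_def)
qed

text \<open>The window at site n + J ends at n + J - 1 and stays strictly below the diagonal. There
  \<open>coef\<close> and \<open>dev\<close> agree, so the recursion is homogeneous and its window
  sums still tend to 0; Gronwall with constant 0 forces them to vanish.\<close>

lemma coef_eq_0:
  assumes "l < n" "i < 2"
  shows "coef n i l = 0"
proof -
  define x where "x J = (\<Sum>k=l - int J..n - 1 + int J. \<Sum>i<2. norm (coef (n + int J) i k))" for J
  have "x 0 \<le> exp (tail n) * (0 * tail n)"
  proof (rule gronwall_tail[where x = x and n = n and c = 0])
    fix J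
    let ?m = "n + int J"
    have "x J \<le> (1 + 4 * \<epsilon> ?m) * (\<Sum>k=l - int J - 1..n - 1 + int J + 1. \<Sum>i<2. norm (coef (?m+1) i k))
       + 2 * \<epsilon> ?m * (\<Sum>l=l - int J..n - 1 + int J. 0)"
      unfolding x_def
    proof (rule window_step[where y = "\<lambda>n i l. norm (coef n i l)" and n = ?m and w = "\<lambda>_. 0"])
      fix i :: nat and l assume i: "i < 2"
      show "norm (coef ?m i l) \<le> norm (coef (?m+1) i (l - sg i))
         + \<epsilon> ?m * (\<Sum>j<2. norm (coef (?m+1) j (l-1)) + norm (coef (?m+1) j (l+1))) + \<epsilon> ?m * 0"
        unfolding coef_step[OF i, of ?m l] mult_zero_right add_0_right
        by (intro norm_triangle_le add_mono norm_alpha_beta_sum i order_refl)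
    qed auto
    then show "x J \<le> (1 + 4 * \<epsilon> ?m) * x (Suc J) + 0 * (4 * \<epsilon> ?m)"
      by (simp add: x_def algebra_simps)
  next
    show "x \<longlonglongrightarrow> 0"
      unfolding x_def
    proof (rule window_tendsto_0)
      fix J i k assume "i < (2::nat)" "k \<le> n - 1 + int J"
      then show "norm (coef (n + int J) i k) \<le> exp (tail n) * tail (n + int J)"
        using norm_dev_shift_le[of i n J k] by (simp add: dev_def)
    qed
  qed (auto simp: x_def sum_nonneg)
  then have "(\<Sum>k=l..n - 1. \<Sum>i<2. norm (coef n i k)) \<le> 0" by (simp add: x_def)
  then have "(\<Sum>k=l..n - 1. \<Sum>i<2. norm (coef n i k)) = 0" by (intro antisym sum_nonneg) auto
  then have "(\<Sum>i<2. norm (coef n i l)) = 0"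
    using assms(1) by (subst (asm) sum_nonneg_eq_0_iff) (auto intro!: sum_nonneg)
  then show ?thesis
    using assms(2) by (subst (asm) sum_nonneg_eq_0_iff) auto
qed

lemma coef_tendsto: "i < 2 \<Longrightarrow> (\<lambda>J. coef (n + int J) i (n + int J) - (if i = \<kappa> then 1 else 0)) \<longlonglongrightarrow> 0"
proof (rule Lim_null_comparison)
  assume i: "i < 2"
  show "\<forall>\<^sub>F J in sequentially. norm (coef (n + int J) i (n + int J) - (if i = \<kappa> then 1 else 0)) \<le> exp (tail n) * tail (n + int J)"
  proof (intro always_eventually allI)
    fix J
    show "norm (coef (n + int J) i (n + int J) - (if i = \<kappa> then 1 else 0)) \<le> exp (tail n) * tail (n + int J)"
      using norm_dev_shift_le[OF i, of n J "n + int J"] by (simp add: dev_def)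
  qed
  show "(\<lambda>J. exp (tail n) * tail (n + int J)) \<longlonglongrightarrow> 0"
    by (intro tendsto_mult_right_zero tail_tendsto)
qed

text \<open>The diagonal coefficients form a recursion of their own, because every term with u
  refers to an index below the diagonal.\<close>

lemma leading_step:
  assumes "i < 2"
  shows "coef n i n = (if i = \<kappa> then coef (n+1) i (n+1) else 0) + (\<Sum>j<2. \<beta> n i j * coef (n+1) j (n+1))"
  unfolding coef_step[OF assms, of n n] using assms by (auto simp: sg_def coef_eq_0)

lemma sum_dev_le:
  assumes "i < 2"
  shows "(\<Sum>s<N. norm (dev n i (n + int s))) \<le> exp (tail n) * tail n"
proof -
  have "(\<Sum>s<N. norm (dev n i (n + int s))) = (\<Sum>l\<in>(\<lambda>s. n + int s) ` {..<N}. norm (dev n i l))"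
    by (subst sum.reindex) (auto simp: inj_on_def)
  also have "\<dots> \<le> (\<Sum>l=n..n + int N. norm (dev n i l))"
    by (intro sum_mono2) auto
  also have "\<dots> \<le> (\<Sum>l=n..n + int N. \<Sum>i<2. norm (dev n i l))"
    using assms by (intro sum_mono member_le_sum) auto
  also have "\<dots> \<le> exp (tail n) * tail n" by (rule dev_window)
  finally show ?thesis .
qed

lemma summable_dev: "i < 2 \<Longrightarrow> summable (\<lambda>s. norm (dev n i (n + int s)))"
  by (rule summableI_nonneg_bounded) (auto intro: sum_dev_le)

lemma summable_coef: "i < 2 \<Longrightarrow> summable (\<lambda>s. norm (coef n i (n + int s)))"
proof -
  assume i: "i < 2"
  have "summable (\<lambda>s. if s = 0 then 1 else 0 :: real)" by (rule summable_single)
  then have "summable (\<lambda>s. norm (dev n i (n + int s)) + (if s = 0 then 1 else 0))"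
    using summable_dev[OF i] by (intro summable_add)
  then show ?thesis
  proof (rule summable_comparison_test'[of _ 0])
    fix s show "norm (norm (coef n i (n + int s))) \<le> norm (dev n i (n + int s)) + (if s = 0 then 1 else 0)"
      unfolding dev_def using norm_triangle_sub[of "coef n i n" 1] by auto
  qed
qed

text \<open>The factor u^n is split off, which leaves a power series in u = z^\<sigma> with
  absolutely summable coefficients for every integer \<open>n\<close>.\<close>

definition series :: "int \<Rightarrow> nat \<Rightarrow> complex \<Rightarrow> complex" where
  "series n i z = (\<Sum>s. coef n i (n + int s) * (z powi \<sigma>) ^ s)"

lemma series_uniform:
  assumes "i < 2"
  shows "uniform_limit {z. norm (z powi \<sigma>) \<le> 1} (\<lambda>N z. \<Sum>s<N. coef n i (n + int s) * (z powi \<sigma>) ^ s) (series n i) sequentially"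
  unfolding series_def
  by (rule Weierstrass_m_test[OF _ summable_coef[OF assms, of n]])
     (auto simp: norm_mult norm_power mult_left_le power_le_one)

lemma series_sums:
  assumes "i < 2" "norm (z powi \<sigma>) \<le> 1"
  shows "(\<lambda>s. coef n i (n + int s) * (z powi \<sigma>) ^ s) sums series n i z"
  unfolding series_def
  by (rule summable_sums, rule summable_comparison_test'[OF summable_coef[OF assms(1), of n]])
     (use assms(2) in \<open>auto simp: norm_mult norm_power mult_left_le power_le_one\<close>)

text \<open>This is the recursion for u^(-n) times the solution. The extra factor u removes all
  negative powers: \<open>1 + sg i\<close> is 0 or 2.\<close>

lemma series_step:
  assumes i: "i < 2" and z: "norm z = 1"
  shows "series n i z = (z powi \<sigma>) powi (1 + sg i) * series (n+1) i z
     + (\<Sum>j<2. \<alpha> n i j * ((z powi \<sigma>)\<^sup>2 * series (n+1) j z) + \<beta> n i j * series (n+1) j z)"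
proof (rule sums_unique2)
  define u where "u = z powi \<sigma>"
  have u: "norm u \<le> 1" by (simp add: u_def norm_power_int z)
  have S0: "(\<lambda>s. coef (n+1) j (n + int s + 1) * u ^ s) sums series (n+1) j z" if "j < 2" for j
    using series_sums[OF that, of z "n+1"] u by (simp add: u_def add_ac)
  \<comment> \<open>Shifting by two adds no terms, since the coefficients at indices n - 1 and n of
    the solution at site n + 1 lie below the diagonal.\<close>
  have S2: "(\<lambda>s. coef (n+1) j (n + int s - 1) * u ^ s) sums (u\<^sup>2 * series (n+1) j z)" if "j < 2" for j
  proof (subst sums_zero_iff_shift[of 2, symmetric])
    show "coef (n+1) j (n + int s - 1) * u ^ s = 0" if "s < 2" for s
      using that \<open>j < 2\<close> by (simp add: coef_eq_0)
    show "(\<lambda>s. coef (n+1) j (n + int (s + 2) - 1) * u ^ (s + 2)) sums (u\<^sup>2 * series (n+1) j z)"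
      using sums_mult[OF S0[OF that], of "u\<^sup>2"] by (simp add: power_add power2_eq_square mult_ac add_ac)
  qed
  show "(\<lambda>s. coef n i (n + int s) * (z powi \<sigma>) ^ s) sums series n i z"
    using series_sums[OF i, of z n] u by (simp add: u_def)
  have "(\<lambda>s. coef (n+1) i (n + int s - sg i) * u ^ s) sums (u powi (1 + sg i) * series (n+1) i z)"
    using S0[OF i] S2[OF i] by (auto simp: sg_def)
  moreover have "(\<lambda>s. \<Sum>j<2. \<alpha> n i j * (coef (n+1) j (n + int s - 1) * u ^ s) + \<beta> n i j * (coef (n+1) j (n + int s + 1) * u ^ s))
     sums (\<Sum>j<2. \<alpha> n i j * (u\<^sup>2 * series (n+1) j z) + \<beta> n i j * series (n+1) j z)"
    by (intro sums_sum sums_add sums_mult S0 S2) auto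
  ultimately have "(\<lambda>s. coef (n+1) i (n + int s - sg i) * u ^ s + (\<Sum>j<2. \<alpha> n i j * (coef (n+1) j (n + int s - 1) * u ^ s) + \<beta> n i j * (coef (n+1) j (n + int s + 1) * u ^ s)))
     sums (u powi (1 + sg i) * series (n+1) i z + (\<Sum>j<2. \<alpha> n i j * (u\<^sup>2 * series (n+1) j z) + \<beta> n i j * series (n+1) j z))"
    by (rule sums_add)
  moreover have "coef n i (n + int s) * u ^ s = coef (n+1) i (n + int s - sg i) * u ^ s + (\<Sum>j<2. \<alpha> n i j * (coef (n+1) j (n + int s - 1) * u ^ s) + \<beta> n i j * (coef (n+1) j (n + int s + 1) * u ^ s))" for s
    unfolding coef_step[OF i, of n "n + int s"] by (simp add: distrib_right distrib_left sum_distrib_left sum_distrib_right mult_ac)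
  ultimately show "(\<lambda>s. coef n i (n + int s) * (z powi \<sigma>) ^ s) sums ((z powi \<sigma>) powi (1 + sg i) * series (n+1) i z
     + (\<Sum>j<2. \<alpha> n i j * ((z powi \<sigma>)\<^sup>2 * series (n+1) j z) + \<beta> n i j * series (n+1) j z))"
    by (simp add: u_def)
qed

lemma satisfies_series:
  assumes z: "norm z = 1"
  shows "satisfies z (\<lambda>n i. z powi (\<sigma> * n) * series n i z)"
  unfolding satisfies_def
proof (intro allI impI)
  fix n and i :: nat assume i: "i < 2"
  have [simp]: "z \<noteq> 0" using z by auto
  let ?c = "z powi (\<sigma> * n)"
  have e: "?c * (z powi \<sigma>) powi (1 + sg i) = z powi (\<sigma> * sg i) * z powi (\<sigma> * (n + 1))"
    by (simp flip: power_int_mult power_int_add add: algebra_simps)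
  have e1: "?c * (z powi \<sigma>)\<^sup>2 = z powi \<sigma> * z powi (\<sigma> * (n + 1))"
    using power_int_add[of z "\<sigma> * n" \<sigma>] by (simp add: power2_eq_square algebra_simps)
  have e2: "?c = z powi (- \<sigma>) * z powi (\<sigma> * (n + 1))"
    by (simp flip: power_int_add add: algebra_simps)
  have d: "?c * (\<alpha> n i j * ((z powi \<sigma>)\<^sup>2 * w) + \<beta> n i j * w) = (\<alpha> n i j * z powi \<sigma> + \<beta> n i j * z powi (-\<sigma>)) * (z powi (\<sigma> * (n + 1)) * w)" for j w
  proof -
    have "?c * (\<alpha> n i j * ((z powi \<sigma>)\<^sup>2 * w) + \<beta> n i j * w) = \<alpha> n i j * (?c * (z powi \<sigma>)\<^sup>2) * w + \<beta> n i j * ?c * w"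
      by (simp only: distrib_left mult_ac)
    also have "\<dots> = \<alpha> n i j * (z powi \<sigma> * z powi (\<sigma> * (n + 1))) * w + \<beta> n i j * (z powi (- \<sigma>) * z powi (\<sigma> * (n + 1))) * w"
      using e1 e2 by simp
    finally show ?thesis by (simp only: distrib_right distrib_left mult_ac)
  qed
  show "?c * series n i z = z powi (\<sigma> * sg i) * (z powi (\<sigma> * (n + 1)) * series (n+1) i z)
      + (\<Sum>j<2. (\<alpha> n i j * z powi \<sigma> + \<beta> n i j * z powi (-\<sigma>)) * (z powi (\<sigma> * (n + 1)) * series (n+1) j z))"
    unfolding series_step[OF i z, of n] d[symmetric]
    by (simp only: distrib_left sum_distrib_left mult.assoc[symmetric] e)
qed

lemma series_asymptotics:
  assumes z: "norm z = 1" and i: "i < 2"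
  shows "norm (z powi (\<sigma> * n) * series n i z - free z n i) \<le> exp (tail n) * tail n"
proof -
  define u where "u = z powi \<sigma>"
  have u: "norm u = 1" by (simp add: u_def norm_power_int z)
  have "(\<lambda>s. coef n i (n + int s) * u ^ s) sums series n i z"
    using series_sums[OF i, of z n] u by (simp add: u_def)
  moreover have "(\<lambda>s. if s = 0 then (if i = \<kappa> then 1 else 0) else 0 :: complex) sums (if i = \<kappa> then 1 else 0)"
    by (rule sums_single[of 0 "\<lambda>_. if i = \<kappa> then 1 else 0"])
  ultimately have "(\<lambda>s. coef n i (n + int s) * u ^ s - (if s = 0 then (if i = \<kappa> then 1 else 0) else 0)) sums (series n i z - (if i = \<kappa> then 1 else 0))"
    by (rule sums_diff)
  moreover have "coef n i (n + int s) * u ^ s - (if s = 0 then (if i = \<kappa> then 1 else 0) else 0) = dev n i (n + int s) * u ^ s" for s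
    by (auto simp: dev_def)
  ultimately have S: "(\<lambda>s. dev n i (n + int s) * u ^ s) sums (series n i z - (if i = \<kappa> then 1 else 0))" by simp
  have sm: "summable (\<lambda>s. norm (dev n i (n + int s) * u ^ s))"
    using summable_dev[OF i] by (simp add: norm_mult norm_power u)
  have "norm (z powi (\<sigma> * n) * series n i z - free z n i) = norm (z powi (\<sigma> * n) * (series n i z - (if i = \<kappa> then 1 else 0)))"
    by (auto simp: free_def algebra_simps)
  also have "\<dots> = norm (\<Sum>s. dev n i (n + int s) * u ^ s)"
    unfolding sums_unique[OF S, symmetric] by (simp add: norm_mult norm_power_int z)
  also have "\<dots> \<le> (\<Sum>s. norm (dev n i (n + int s) * u ^ s))" by (rule summable_norm[OF sm])
  also have "\<dots> = (\<Sum>s. norm (dev n i (n + int s)))" by (simp add: norm_mult norm_power u)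
  also have "\<dots> \<le> exp (tail n) * tail n"
    by (rule suminf_le_const[OF summable_dev[OF i]]) (rule sum_dev_le[OF i])
  finally show ?thesis .
qed

text \<open>Uniqueness for the recursion replaces a uniqueness theorem for Fourier series.\<close>

lemma eq_series_circle:
  assumes z: "norm z = 1" and i: "i < 2"
  shows "f n i z = z powi (\<sigma> * n) * series n i z"
proof -
  have "(\<lambda>n i. 1 * f n i z + (-1) * (z powi (\<sigma> * n) * series n i z)) n i = 0"
  proof (rule uniqueness[OF z satisfies_lincomb[OF sat[OF z] satisfies_series[OF z]] _ i])
    fix i :: nat assume i: "i < 2"
    have "(\<lambda>j. exp (tail n) * tail (n + int j)) \<longlonglongrightarrow> 0"
      by (intro tendsto_mult_right_zero tail_tendsto)
    then have "(\<lambda>j. z powi (\<sigma> * (n + int j)) * series (n + int j) i z - free z (n + int j) i) \<longlonglongrightarrow> 0"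
    proof (rule Lim_null_comparison[rotated], intro always_eventually allI)
      fix j
      have "norm (z powi (\<sigma> * (n + int j)) * series (n + int j) i z - free z (n + int j) i) \<le> exp (tail (n + int j)) * tail (n + int j)"
        by (rule series_asymptotics[OF z i])
      also have "\<dots> \<le> exp (tail n) * tail (n + int j)" by (intro mult_right_mono) (auto simp: tail_mono tail_nonneg)
      finally show "norm (z powi (\<sigma> * (n + int j)) * series (n + int j) i z - free z (n + int j) i) \<le> exp (tail n) * tail (n + int j)" .
    qed
    from tendsto_diff[OF asym[OF z i, of n] this]
    show "(\<lambda>j. 1 * f (n + int j) i z + (-1) * (z powi (\<sigma> * (n + int j)) * series (n + int j) i z)) \<longlonglongrightarrow> 0"
      by simp
  qed
  then show ?thesis by simp
qed

lemma continuous_on_series: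
  assumes i: "i < 2" and A: "0 \<notin> A \<or> \<sigma> = 1" "A \<subseteq> {z. norm (z powi \<sigma>) \<le> 1}"
  shows "continuous_on A (series n i)"
proof (rule uniform_limit_theorem)
  show "uniform_limit A (\<lambda>N z. \<Sum>s<N. coef n i (n + int s) * (z powi \<sigma>) ^ s) (series n i) sequentially"
    by (rule uniform_limit_on_subset[OF series_uniform[OF i] A(2)])
  show "\<forall>\<^sub>F N in sequentially. continuous_on A (\<lambda>z. \<Sum>s<N. coef n i (n + int s) * (z powi \<sigma>) ^ s)"
    using A(1) by (intro always_eventually allI continuous_intros) (auto intro: continuous_on_powi_sign continuous_on_id)
qed simp

text \<open>Both sides are holomorphic inside and continuous up to the circle, so the identity on
  the circle extends by boundary uniqueness.\<close>

lemma eq_series: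
  assumes z: "z \<in> cside \<sigma>" and i: "i < 2"
  shows "f n i z = z powi (\<sigma> * n) * series n i z"
proof -
  define g where "g z = f n i z - z powi (\<sigma> * n) * series n i z" for z
  have cs: "continuous_on (cside \<sigma>) (series n i)"
    by (rule continuous_on_series[OF i]) (auto simp: cside_def)
  have hs: "series n i holomorphic_on side \<sigma>"
  proof (rule holomorphic_uniform_sequence[OF open_side[OF \<sigma>]])
    fix N show "(\<lambda>z. \<Sum>s<N. coef n i (n + int s) * (z powi \<sigma>) ^ s) holomorphic_on side \<sigma>"
      by (intro holomorphic_intros) (auto dest: nonzero_side)
  next
    fix x assume x: "x \<in> side \<sigma>"
    then obtain d where "d > 0" "cball x d \<subseteq> side \<sigma>" using open_side[OF \<sigma>] by (auto simp: open_contains_cball)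
    then show "\<exists>d>0. cball x d \<subseteq> side \<sigma> \<and> uniform_limit (cball x d) (\<lambda>N z. \<Sum>s<N. coef n i (n + int s) * (z powi \<sigma>) ^ s) (series n i) sequentially"
      by (intro exI[of _ d] conjI uniform_limit_on_subset[OF series_uniform[OF i]]) (auto simp: side_def)
  qed
  have "g z = 0"
  proof (rule zero_on_circle_imp_zero[OF \<sigma>, where S = "{}" and g = g])
    show "continuous_on (cside \<sigma> - {}) g"
      unfolding g_def using cs cont[OF i, of n] by (auto intro!: continuous_intros continuous_on_powi_sign dest: nonzero_cside)
    show "g holomorphic_on side \<sigma> - {}"
      unfolding g_def using hs holo[OF i, of n] by (auto intro!: holomorphic_intros dest: nonzero_side)
  qed (use z eq_series_circle[OF _ i] in \<open>auto simp: g_def\<close>)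
  then show ?thesis by (simp add: g_def)
qed

text \<open>Here \<open>w\<close> is the variable u itself, so 0 and infinity are both approached as
  w tends to 0. What remains is the continuity of the power series at 0.\<close>

lemma limit_at_end:
  assumes i: "i < 2"
  shows "((\<lambda>w. w powi (- n) * f n i (w powi \<sigma>)) \<longlongrightarrow> coef n i n) (at 0)"
proof -
  define p where "p w = (\<Sum>s. coef n i (n + int s) * w ^ s)" for w
  have "isCont p 0"
  proof -
    have "continuous_on (cball 0 1) p"
    proof (rule uniform_limit_theorem)
      show "uniform_limit (cball 0 1) (\<lambda>N w. \<Sum>s<N. coef n i (n + int s) * w ^ s) p sequentially"
        unfolding p_def
        by (rule Weierstrass_m_test[OF _ summable_coef[OF i, of n]])
          (auto simp: norm_mult norm_power mult_left_le power_le_one)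
    qed (auto intro!: always_eventually continuous_intros)
    then show ?thesis by (rule continuous_on_interior) simp
  qed
  moreover have "p 0 = coef n i n"
    unfolding p_def by (subst suminf_finite[of "{0}"]) auto
  ultimately have "(p \<longlongrightarrow> coef n i n) (at 0)" by (simp add: isCont_def)
  then show ?thesis
  proof (rule Lim_transform_within_open[where s="ball 0 1"])
    fix w :: complex assume w: "w \<in> ball 0 1" "w \<noteq> 0"
    then have "w \<in> cside 1" by (auto simp: cside_def)
    then have m: "w powi \<sigma> \<in> cside \<sigma>" by (simp add: powi_mem_side[OF \<sigma>])
    have "(w powi \<sigma>) powi (\<sigma> * n) = w powi n"
      using \<sigma> by (auto simp: power_int_mult power_int_minus)
    then show "p w = w powi (- n) * f n i (w powi \<sigma>)"
      unfolding eq_series[OF m i] using w powi_powi_sign[OF \<sigma>] by (simp add: series_def p_def power_int_minus)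
  qed auto
qed

end

subsection \<open>Powers of the matrix triplet\<close>

text \<open>The Taylor coefficient of order \<open>s\<close> of w^e at \<open>z\<close>. The
  generalised binomial coefficient covers negative \<open>e\<close>, where the expansion does not
  terminate.\<close>

definition taylor_powi :: "nat \<Rightarrow> int \<Rightarrow> complex \<Rightarrow> complex" where
  "taylor_powi s e z = (of_int e gchoose s) * z powi (e - int s)"

text \<open>Pascal's rule; it is one row of the identity by which a Jordan block raises the exponent
  \<open>e\<close> by one.\<close>

lemma taylor_powi_Suc:
  assumes "z \<noteq> 0"
  shows "taylor_powi (Suc s) (e + 1) z = z * taylor_powi (Suc s) e z + taylor_powi s e z"
proof -
  have "z powi (e - int s) = z * z powi (e - int (Suc s))"
    using power_int_add_1'[of z "e - int (Suc s)"] assms by simp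
  then show ?thesis
    unfolding taylor_powi_def using gbinomial_Suc_Suc[of "of_int e :: complex" s] by (simp add: algebra_simps)
qed

lemma taylor_powi_0: "z \<noteq> 0 \<Longrightarrow> taylor_powi 0 (e + 1) z = z * taylor_powi 0 e z"
  by (simp add: taylor_powi_def power_int_add)

lemma taylor_powi_exponent_0: "taylor_powi s 0 z = (if s = 0 then 1 else 0)"
  by (cases s) (auto simp: taylor_powi_def gbinomial_0)

lemma higher_deriv_powi:
  assumes "z \<noteq> 0"
  shows "(deriv ^^ s) (\<lambda>w. w powi e) z = fact s * taylor_powi s e z"
  using assms
proof (induction s arbitrary: z)
  case (Suc s)
  have "(deriv ^^ Suc s) (\<lambda>w. w powi e) z = deriv (\<lambda>w. fact s * taylor_powi s e w) z"
    unfolding funpow.simps o_apply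
  proof (rule complex_derivative_transform_within_open[of _ "- {0}"])
    have "(\<lambda>w. w powi e) holomorphic_on - {0}" by (intro holomorphic_intros) auto
    then show "(deriv ^^ s) (\<lambda>w. w powi e) holomorphic_on - {0}" by (rule holomorphic_higher_deriv) auto
    show "(\<lambda>w. fact s * taylor_powi s e w) holomorphic_on - {0}"
      unfolding taylor_powi_def by (intro holomorphic_intros) auto
  qed (use Suc in auto)
  also have "\<dots> = fact s * ((of_int e gchoose s) * (of_int (e - int s) * z powi (e - int s - 1)))"
    unfolding taylor_powi_def using Suc.prems
    by (intro DERIV_imp_deriv) (auto intro!: derivative_eq_intros)
  also have "\<dots> = fact s * ((of_int e gchoose s) * (of_int e - of_nat s)) * z powi (e - int (Suc s))"
    by (simp add: algebra_simps)
  also have "(of_int e gchoose s) * (of_int e - of_nat s) = of_nat (Suc s) * ((of_int e :: complex) gchoose Suc s)"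
    using gbinomial_mult_1[of "of_int e :: complex" s] by (simp add: algebra_simps)
  finally show ?case by (simp add: taylor_powi_def)
qed (simp add: taylor_powi_def)

text \<open>The Taylor orders decrease downwards because the Jordan block has its ones on the
  superdiagonal. This order also matches the one of the constants in \<open>Cblk\<close>.\<close>

definition Vblk :: "complex \<Rightarrow> nat \<Rightarrow> int \<Rightarrow> complex mat" where
  "Vblk z m e = mat m 1 (\<lambda>(i,_). taylor_powi (m - 1 - i) e z)"

lemma Ablk_Vblk:
  assumes "z \<noteq> 0"
  shows "Ablk z m * Vblk z m e = Vblk z m (e + 1)"
proof (rule eq_matI)
  fix i j assume "i < dim_row (Vblk z m (e + 1))" "j < dim_col (Vblk z m (e + 1))"
  then have i: "i < m" and j: "j = 0" by (auto simp: Vblk_def)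
  have "(Ablk z m * Vblk z m e) $$ (i, 0) = (\<Sum>k = 0..<m. (if i = k then z else if Suc i = k then 1 else 0) * taylor_powi (m - 1 - k) e z)"
    using i by (simp add: Ablk_def Vblk_def times_mat_def scalar_prod_def)
  also have "\<dots> = (\<Sum>k = 0..<m. (if k = i then z * taylor_powi (m - 1 - k) e z else 0) + (if k = Suc i then taylor_powi (m - 1 - k) e z else 0))"
    by (rule sum.cong) auto
  also have "\<dots> = z * taylor_powi (m - 1 - i) e z + (if Suc i < m then taylor_powi (m - 1 - Suc i) e z else 0)"
    using i by (simp add: sum.distrib)
  also have "\<dots> = taylor_powi (m - 1 - i) (e + 1) z"
  proof (cases "Suc i < m")
    case True
    then have "m - 1 - i = Suc (m - 1 - Suc i)" by simp
    then show ?thesis using True taylor_powi_Suc[OF assms] by simp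
  next
    case False
    then have "m - 1 - i = 0" by simp
    then show ?thesis using False taylor_powi_0[OF assms, of e] by simp
  qed
  finally show "(Ablk z m * Vblk z m e) $$ (i, j) = Vblk z m (e + 1) $$ (i, j)"
    using i j by (simp add: Vblk_def)
qed (auto simp: Ablk_def Vblk_def)

text \<open>The common form of B, of the vectors built from \<open>Vblk\<close> and of the transpose
  of C, so that all block computations are inductions over one list of indices.\<close>

definition stack :: "('a \<Rightarrow> complex mat) \<Rightarrow> 'a list \<Rightarrow> complex mat" where
  "stack F js = foldr (\<lambda>j M. F j @\<^sub>r M) js (0\<^sub>m 0 1)"

lemma stack_simps: "stack F [] = 0\<^sub>m 0 1" "stack F (j # js) = F j @\<^sub>r stack F js"
  by (simp_all add: stack_def)

lemma stack_carrier:
  "(\<And>j. j \<in> set js \<Longrightarrow> F j \<in> carrier_mat (d j) 1) \<Longrightarrow> stack F js \<in> carrier_mat (\<Sum>j\<leftarrow>js. d j) 1"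
  by (induction js) (auto simp: stack_simps)

lemma diag_stack:
  assumes "\<And>j. j \<in> set js \<Longrightarrow> A j \<in> carrier_mat (d j) (d j)" "\<And>j. j \<in> set js \<Longrightarrow> F j \<in> carrier_mat (d j) 1"
  shows "diag_block_mat (map A js) \<in> carrier_mat (\<Sum>j\<leftarrow>js. d j) (\<Sum>j\<leftarrow>js. d j)"
    and "diag_block_mat (map A js) * stack F js = stack (\<lambda>j. A j * F j) js"
    and "det (diag_block_mat (map A js)) = (\<Prod>j\<leftarrow>js. det (A j))"
  using assms
proof (induction js)
  case (Cons j js)
  {
    case 1
    then show ?case using Cons.IH(1) by (auto simp: Let_def)
  next
    case 2
    let ?d = "\<Sum>j\<leftarrow>js. d j"
    have c: "A j \<in> carrier_mat (d j) (d j)" "F j \<in> carrier_mat (d j) 1"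
      "diag_block_mat (map A js) \<in> carrier_mat ?d ?d"
      using 2 Cons.IH(1) by auto
    have c'': "stack F js \<in> carrier_mat ?d 1"
      by (rule stack_carrier) (use 2 in auto)
    have c': "stack (\<lambda>j. A j * F j) js \<in> carrier_mat ?d 1"
      by (rule stack_carrier) (use 2 in \<open>blast intro: mult_carrier_mat list.set_intros\<close>)
    have IH: "diag_block_mat (map A js) * stack F js = stack (\<lambda>j. A j * F j) js"
      using 2 Cons.IH(2) by auto
    show ?case
      unfolding stack_simps list.map diag_block_mat.simps Let_def append_rows_def
      by (subst mult_four_block_mat) (use c c' c'' in \<open>auto simp: IH\<close>)
  next
    case 3
    let ?d = "\<Sum>j\<leftarrow>js. d j"
    have c: "A j \<in> carrier_mat (d j) (d j)" "diag_block_mat (map A js) \<in> carrier_mat ?d ?d"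
      using 3 Cons.IH(1) by auto
    have IH: "det (diag_block_mat (map A js)) = (\<Prod>j\<leftarrow>js. det (A j))"
      using 3 Cons.IH(3) by auto
    show ?case unfolding list.map diag_block_mat.simps Let_def
      by (subst det_four_block_mat_upper_right_zero[OF c(1) _ _ c(2)]) (use c IH in auto)
  }
qed (auto simp: stack_simps)

lemma stack_dot_stack:
  assumes "\<And>j. j \<in> set js \<Longrightarrow> F j \<in> carrier_mat (d j) 1" "\<And>j. j \<in> set js \<Longrightarrow> G j \<in> carrier_mat (d j) 1"
  shows "(transpose_mat (stack F js) * stack G js) $$ (0,0) = (\<Sum>j\<leftarrow>js. \<Sum>i<d j. F j $$ (i,0) * G j $$ (i,0))"
  using assms
proof (induction js)
  case (Cons j js)
  let ?d = "\<Sum>j\<leftarrow>js. d j"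
  have dot: "(transpose_mat X * Y) $$ (0,0) = (\<Sum>i<n. X $$ (i,0) * Y $$ (i,0))"
    if "X \<in> carrier_mat n 1" "Y \<in> carrier_mat n 1" for X Y :: "complex mat" and n
    using that by (simp add: scalar_prod_def atLeast0LessThan)
  have c: "F j \<in> carrier_mat (d j) 1" "stack F js \<in> carrier_mat ?d 1" "G j \<in> carrier_mat (d j) 1" "stack G js \<in> carrier_mat ?d 1"
    using Cons.prems stack_carrier[of js F d] stack_carrier[of js G d] by auto
  have app: "(X @\<^sub>r Y) $$ (i,0) = (if i < a then X $$ (i,0) else Y $$ (i - a,0))"
    if "X \<in> carrier_mat a 1" "Y \<in> carrier_mat b 1" "i < a + b" for X Y :: "complex mat" and a b i
    using that by (auto simp: append_rows_def)
  have "(transpose_mat (stack F (j # js)) * stack G (j # js)) $$ (0,0) = (\<Sum>i<d j + ?d. (F j @\<^sub>r stack F js) $$ (i,0) * (G j @\<^sub>r stack G js) $$ (i,0))"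
    unfolding stack_simps by (rule dot) (use c in auto)
  also have "\<dots> = (\<Sum>i<d j + ?d. if i < d j then F j $$ (i,0) * G j $$ (i,0) else stack F js $$ (i - d j,0) * stack G js $$ (i - d j,0))"
    by (rule sum.cong) (use c in \<open>auto simp: app\<close>)
  also have "\<dots> = (\<Sum>i<d j. F j $$ (i,0) * G j $$ (i,0)) + (\<Sum>i<?d. stack F js $$ (i,0) * stack G js $$ (i,0))"
  proof -
    have "(\<Sum>i<a + b. h i) = (\<Sum>i<a. h i) + (\<Sum>i<b. h (a + i))" for a b and h :: "nat \<Rightarrow> complex"
      by (induction b) (auto simp: add_ac)
    then show ?thesis by simp
  qed
  also have "(\<Sum>i<?d. stack F js $$ (i,0) * stack G js $$ (i,0)) = (transpose_mat (stack F js) * stack G js) $$ (0,0)"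
    by (rule dot[symmetric]) (use c in auto)
  finally show ?case using Cons by simp
qed (simp add: stack_simps scalar_prod_def)

text \<open>The vectors \<open>V\<^sub>e\<close> stacked from the blocks \<^const>\<open>Vblk\<close> satisfy \<open>V\<^sub>0 = B\<close> and \<open>A V\<^sub>e = V\<^sub>e\<^sub>+\<^sub>1\<close>, hence
  \<open>A\<^sup>e B = V\<^sub>e\<close> for all integers \<open>e\<close>.\<close>

lemma triplet_power:
  assumes z: "\<And>j. j \<in> {1..N} \<Longrightarrow> zs j \<noteq> 0"
  shows "(Ctrip N ms cn * mat_powi (Atrip N zs ms) e * Btrip N ms) $$ (0,0)
    = (\<Sum>j=1..N. \<Sum>s<ms j. cn j s * taylor_powi s e (zs j))"
proof -
  define js where "js = [1..<N+1]"
  define d where "d = (\<Sum>j\<leftarrow>js. ms j)"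
  define A where "A = Atrip N zs ms"
  define V where "V e = stack (\<lambda>j. Vblk (zs j) (ms j) e) js" for e
  have js: "j \<in> set js \<Longrightarrow> zs j \<noteq> 0" for j using z by (auto simp: js_def)
  have cA: "Ablk (zs j) (ms j) \<in> carrier_mat (ms j) (ms j)" and cV: "Vblk (zs j) (ms j) e \<in> carrier_mat (ms j) 1" for j e
    by (auto simp: Ablk_def Vblk_def)
  have A: "A \<in> carrier_mat d d" unfolding A_def Atrip_def d_def js_def[symmetric] by (rule diag_stack(1)[OF cA cV])
  have Vc: "V e \<in> carrier_mat d 1" for e unfolding V_def d_def by (rule stack_carrier[OF cV])
  have AV: "A * V e = V (e + 1)" for e
  proof -
    have "A * V e = stack (\<lambda>j. Ablk (zs j) (ms j) * Vblk (zs j) (ms j) e) js"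
      unfolding A_def Atrip_def js_def[symmetric] V_def by (rule diag_stack(2)[OF cA cV])
    also have "\<dots> = V (e + 1)"
      unfolding V_def stack_def by (rule foldr_cong) (auto simp: Ablk_Vblk js)
    finally show ?thesis .
  qed
  have B: "Btrip N ms = V 0"
    unfolding Btrip_def js_def[symmetric] V_def stack_def
  proof (rule foldr_cong)
    fix j M
    have "Bblk (ms j) = Vblk (zs j) (ms j) 0"
      unfolding Bblk_def Vblk_def by (rule cong_mat) (auto simp: taylor_powi_exponent_0)
    then show "Bblk (ms j) @\<^sub>r M = Vblk (zs j) (ms j) 0 @\<^sub>r M" by simp
  qed auto
  \<comment> \<open>For negative \<open>e\<close> the power is formed with
    \<open>the (mat_inverse A)\<close>. The determinant is the product of the
    \<open>zs j ^ ms j\<close> and nonzero, so this is a genuine inverse, and it lowers the exponent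
    of \<open>V\<close> by one.\<close>
  have "det A = (\<Prod>j\<leftarrow>js. det (Ablk (zs j) (ms j)))"
    unfolding A_def Atrip_def js_def[symmetric] by (rule diag_stack(3)[OF cA cV])
  moreover have "det (Ablk (zs j) (ms j)) = zs j ^ ms j" for j
  proof -
    have "diag_mat (jordan_block (ms j) (zs j)) = map (\<lambda>_. zs j) [0..<ms j]" by (simp add: diag_mat_def)
    moreover have "upper_triangular (jordan_block (ms j) (zs j))" by (auto simp: upper_triangular_def)
    ultimately show ?thesis
      unfolding Ablk_def by (subst det_upper_triangular[OF _ jordan_block_carrier]) (simp_all add: map_replicate_const)
  qed
  ultimately have "det A \<noteq> 0" using js by (auto simp: prod_list_zero_iff)
  then have "A \<in> Units (ring_mat TYPE(complex) d ())" by (rule det_non_zero_imp_unit[OF A])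
  then obtain Ai where Ai: "mat_inverse A = Some Ai" using mat_inverse(1)[OF A, of "()"] by (cases "mat_inverse A") auto
  note Ai' = mat_inverse(2)[OF A Ai]
  have AiV: "Ai * V e = V (e - 1)" for e
  proof -
    have "Ai * V e = Ai * (A * V (e - 1))" by (simp add: AV)
    also have "\<dots> = (Ai * A) * V (e - 1)"
      by (rule assoc_mult_mat[symmetric, of _ d d _ d _ 1]) (use Ai' A Vc in auto)
    finally show ?thesis using Ai' Vc[of "e - 1"] by simp
  qed
  have pow: "X ^\<^sub>m k * V e' = V (e' + c * int k)"
    if X: "X \<in> carrier_mat d d" "\<And>e. X * V e = V (e + c)" for X c k e'
  proof (induction k arbitrary: e')
    case (Suc k)
    have "X ^\<^sub>m Suc k * V e' = X ^\<^sub>m k * (X * V e')"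
      using X(1) Vc by (simp add: assoc_mult_mat[of _ d d _ d _ 1])
    also have "\<dots> = V (e' + c * int (Suc k))" unfolding X(2) Suc.IH by (simp add: algebra_simps)
    finally show ?case .
  qed (use X left_mult_one_mat[OF Vc] in simp)
  have P: "mat_powi A e * V 0 = V e"
    unfolding mat_powi_def using pow[OF A AV, of "nat e" 0] pow[of Ai "-1" "nat (- e)" 0] Ai' AiV Ai by auto
  have P': "mat_powi A e \<in> carrier_mat d d"
    unfolding mat_powi_def using A Ai Ai' by auto
  have C: "Ctrip N ms cn = transpose_mat (stack (\<lambda>j. transpose_mat (Cblk (cn j) (ms j))) js)"
    by (simp add: Ctrip_def stack_def js_def)
  have cC: "transpose_mat (Cblk (cn j) (ms j)) \<in> carrier_mat (ms j) 1" for j by (simp add: Cblk_def)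
  have CC: "Ctrip N ms cn \<in> carrier_mat 1 d" unfolding C d_def using stack_carrier[OF cC] by simp
  have "Ctrip N ms cn * mat_powi A e * Btrip N ms = Ctrip N ms cn * V e"
    unfolding B using assoc_mult_mat[OF CC P' Vc[of 0]] by (simp add: P)
  also have "\<dots> $$ (0,0) = (\<Sum>j\<leftarrow>js. \<Sum>i<ms j. transpose_mat (Cblk (cn j) (ms j)) $$ (i,0) * Vblk (zs j) (ms j) e $$ (i,0))"
    unfolding C V_def by (rule stack_dot_stack[OF cC cV])
  also have "\<dots> = (\<Sum>j\<leftarrow>js. \<Sum>s<ms j. cn j s * taylor_powi s e (zs j))"
  proof (rule arg_cong[where f=sum_list], rule map_cong[OF refl])
    fix j
    have "(\<Sum>i<ms j. transpose_mat (Cblk (cn j) (ms j)) $$ (i,0) * Vblk (zs j) (ms j) e $$ (i,0))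
        = (\<Sum>i<ms j. cn j (ms j - 1 - i) * taylor_powi (ms j - 1 - i) e (zs j))"
      by (rule sum.cong) (auto simp: Cblk_def Vblk_def)
    also have "\<dots> = (\<Sum>s<ms j. cn j s * taylor_powi s e (zs j))"
      using sum.nat_diff_reindex[of "\<lambda>s. cn j s * taylor_powi s e (zs j)" "ms j"] by simp
    finally show "(\<Sum>i<ms j. transpose_mat (Cblk (cn j) (ms j)) $$ (i,0) * Vblk (zs j) (ms j) e $$ (i,0))
        = (\<Sum>s<ms j. cn j s * taylor_powi s e (zs j))" .
  qed
  also have "\<dots> = (\<Sum>j=1..N. \<Sum>s<ms j. cn j s * taylor_powi s e (zs j))"
  proof -
    have "set js = {1..N}" by (auto simp: js_def)
    moreover have "distinct js" by (simp add: js_def)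
    ultimately show ?thesis by (simp add: sum_list_distinct_conv_sum_set)
  qed
  finally show ?thesis by (simp add: A_def)
qed

subsection \<open>Residues at the bound states\<close>

definition taylor_coef :: "(complex \<Rightarrow> complex) \<Rightarrow> complex \<Rightarrow> nat \<Rightarrow> complex" where
  "taylor_coef f p s = (deriv ^^ s) f p / fact s"

lemma taylor_coef_mult:
  assumes "open S" "p \<in> S" "f holomorphic_on S" "g holomorphic_on S"
  shows "taylor_coef (\<lambda>z. f z * g z) p s = (\<Sum>i\<le>s. taylor_coef f p i * taylor_coef g p (s - i))"
proof -
  have "taylor_coef (\<lambda>z. f z * g z) p s = (\<Sum>i=0..s. of_nat (s choose i) * (deriv ^^ i) f p * (deriv ^^ (s-i)) g p) / fact s"
    unfolding taylor_coef_def higher_deriv_mult[OF assms(3,4,1,2)] ..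
  also have "\<dots> = (\<Sum>i\<le>s. taylor_coef f p i * taylor_coef g p (s - i))"
    unfolding sum_divide_distrib atLeast0AtMost
  proof (rule sum.cong[OF refl])
    fix i assume "i \<in> {..s}"
    then have "of_nat (s choose i) = (fact s / (fact i * fact (s - i)) :: complex)" by (intro binomial_fact) auto
    then show "of_nat (s choose i) * (deriv ^^ i) f p * (deriv ^^ (s-i)) g p / fact s = taylor_coef f p i * taylor_coef g p (s - i)"
      by (simp add: taylor_coef_def)
  qed
  finally show ?thesis .
qed

text \<open>The dependency relation says that, below order \<open>M\<close>, the expansion of f at p
  is the product of the expansion of g with the series of \<gamma>_l / l!. Multiplying by w and
  regrouping the product of formal power series gives the claim, and \<open>q < M\<close> keeps the
  calculation within the known orders.\<close>

lemma taylor_coef_mult_dependent: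
  assumes S: "open S" "p \<in> S" "f holomorphic_on S" "g holomorphic_on S" "w holomorphic_on S"
    and dep: "\<And>k. k < M \<Longrightarrow> (deriv ^^ k) f p = (\<Sum>l = 0..k. of_nat (k choose l) * \<gamma> (k - l) * (deriv ^^ l) g p)"
    and q: "q < M"
  shows "taylor_coef (\<lambda>z. f z * w z) p q = (\<Sum>l\<le>q. \<gamma> l / fact l * taylor_coef (\<lambda>z. g z * w z) p (q - l))"
proof -
  define \<Gamma> G W where "\<Gamma> = Abs_fps (\<lambda>l. \<gamma> l / fact l)" and "G = Abs_fps (taylor_coef g p)" and "W = Abs_fps (taylor_coef w p)"
  have f: "taylor_coef f p k = fps_nth (G * \<Gamma>) k" if k: "k < M" for k
  proof -
    have "taylor_coef f p k = (\<Sum>l=0..k. of_nat (k choose l) * \<gamma> (k - l) * (deriv ^^ l) g p / fact k)"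
      unfolding taylor_coef_def dep[OF k] sum_divide_distrib ..
    also have "\<dots> = (\<Sum>l=0..k. taylor_coef g p l * (\<gamma> (k - l) / fact (k - l)))"
    proof (rule sum.cong[OF refl])
      fix l assume "l \<in> {0..k}"
      then have "of_nat (k choose l) = (fact k / (fact l * fact (k - l)) :: complex)" by (intro binomial_fact) auto
      then show "of_nat (k choose l) * \<gamma> (k - l) * (deriv ^^ l) g p / fact k = taylor_coef g p l * (\<gamma> (k - l) / fact (k - l))"
        by (simp add: taylor_coef_def)
    qed
    finally show ?thesis by (simp add: fps_mult_nth G_def \<Gamma>_def)
  qed
  have "taylor_coef (\<lambda>z. f z * w z) p q = (\<Sum>i\<le>q. fps_nth (G * \<Gamma>) i * fps_nth W (q - i))"
    unfolding taylor_coef_mult[OF S(1,2,3,5)] using q by (intro sum.cong) (auto simp: f W_def)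
  also have "\<dots> = fps_nth (G * \<Gamma> * W) q" by (simp add: fps_mult_nth[of "G * \<Gamma>"] atLeast0AtMost)
  also have "G * \<Gamma> * W = \<Gamma> * (G * W)" by (simp add: mult_ac)
  also have "fps_nth \<dots> q = (\<Sum>l\<le>q. \<gamma> l / fact l * fps_nth (G * W) (q - l))"
    unfolding fps_mult_nth[of \<Gamma>] by (simp add: atLeast0AtMost \<Gamma>_def)
  also have "\<dots> = (\<Sum>l\<le>q. \<gamma> l / fact l * taylor_coef (\<lambda>z. g z * w z) p (q - l))"
    by (intro sum.cong) (auto simp: taylor_coef_mult[OF S(1,2,4,5)] fps_mult_nth atLeast0AtMost G_def W_def)
  finally show ?thesis .
qed

text \<open>A change of order in the triangle l + s < M with q = l + s. The inner sum over
  \<open>l\<close> is a norming constant up to the factor -2 or 2.\<close>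

lemma residue_by_dependency:
  fixes t \<gamma> :: "nat \<Rightarrow> complex"
  assumes S: "open S" "p \<in> S" "f holomorphic_on S" "g holomorphic_on S" "w holomorphic_on S"
    and dep: "\<And>k. k < M \<Longrightarrow> (deriv ^^ k) f p = (\<Sum>l = 0..k. of_nat (k choose l) * \<gamma> (k - l) * (deriv ^^ l) g p)"
  shows "(\<Sum>q<M. t (Suc q) * taylor_coef (\<lambda>z. f z * w z) p q)
    = (\<Sum>s<M. (\<Sum>l = 0..M - 1 - s. t (s + 1 + l) * \<gamma> l / fact l) * taylor_coef (\<lambda>z. g z * w z) p s)"
proof -
  let ?d = "taylor_coef (\<lambda>z. g z * w z) p"
  let ?g = "\<lambda>l s. t (Suc (l + s)) * (\<gamma> l / fact l * ?d s)"
  have "(\<Sum>q<M. t (Suc q) * taylor_coef (\<lambda>z. f z * w z) p q) = (\<Sum>q<M. \<Sum>l\<le>q. ?g l (q - l))"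
    by (intro sum.cong) (auto simp: taylor_coef_mult_dependent[OF S dep] sum_distrib_left)
  also have "\<dots> = (\<Sum>(l,s)\<in>{(l,s). l + s < M}. ?g l s)"
    by (rule sum.triangle_reindex[symmetric])
  also have "{(l,s). l + s < M} = prod.swap ` Sigma {..<M} (\<lambda>s. {0..M - 1 - s})"
    by (force simp: image_iff)
  also have "(\<Sum>(l,s)\<in>prod.swap ` Sigma {..<M} (\<lambda>s. {0..M - 1 - s}). ?g l s) = (\<Sum>(s,l)\<in>Sigma {..<M} (\<lambda>s. {0..M - 1 - s}). ?g l s)"
    by (subst sum.reindex) (auto intro!: sum.cong)
  also have "\<dots> = (\<Sum>s<M. \<Sum>l=0..M - 1 - s. ?g l s)"
    by (rule sum.Sigma[symmetric]) auto
  finally show ?thesis by (simp add: sum_distrib_left sum_distrib_right mult_ac add_ac)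
qed

lemma taylor_remainder_bounded:
  assumes "open S" "p \<in> S" "f holomorphic_on S"
  shows "\<exists>B. \<forall>\<^sub>F z in at p. norm ((f z - (\<Sum>s<Suc k. taylor_coef f p s * (z - p) ^ s)) / (z - p) ^ Suc k) \<le> B"
proof -
  obtain d where d: "d > 0" "cball p d \<subseteq> S" using assms(1,2) by (auto simp: open_contains_cball)
  have h: "(deriv ^^ i) f holomorphic_on S" for i by (rule holomorphic_higher_deriv[OF assms(3,1)])
  have "compact ((deriv ^^ Suc k) f ` cball p d)"
    by (intro compact_continuous_image holomorphic_on_imp_continuous_on holomorphic_on_subset[OF h d(2)]) auto
  then obtain B where B: "\<And>x. x \<in> cball p d \<Longrightarrow> norm ((deriv ^^ Suc k) f x) \<le> B"
    by (meson bounded_iff compact_imp_bounded imageI)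
  have "norm ((f z - (\<Sum>s<Suc k. taylor_coef f p s * (z - p) ^ s)) / (z - p) ^ Suc k) \<le> B / fact k" if z: "z \<in> cball p d" "z \<noteq> p" for z
  proof -
    have "norm ((deriv ^^ 0) f z - (\<Sum>i\<le>k. (deriv ^^ i) f p * (z-p) ^ i / (fact i))) \<le> B * norm (z - p)^(Suc k) / fact k"
    proof (rule complex_Taylor[of "cball p d"])
      fix i x assume "x \<in> cball p d"
      then have "x \<in> S" using d by auto
      then have "((deriv ^^ i) f has_field_derivative deriv ((deriv ^^ i) f) x) (at x)"
        by (rule holomorphic_derivI[OF h assms(1)])
      then show "((deriv ^^ i) f has_field_derivative (deriv ^^ Suc i) f x) (at x within cball p d)"
        by (simp add: has_field_derivative_at_within)
    qed (use B z d in auto)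
    then show ?thesis using z
      by (simp add: taylor_coef_def norm_divide norm_mult norm_power lessThan_Suc_atMost divide_simps mult_ac)
  qed
  moreover have "\<forall>\<^sub>F z in at p. z \<in> cball p d \<and> z \<noteq> p"
    unfolding eventually_at using d(1) by (intro exI[of _ d]) (auto simp: dist_commute)
  ultimately show ?thesis by (intro exI[of _ "B / fact k"]) (auto elim: eventually_mono)
qed

lemma bounded_times_null:
  fixes f g :: "'a \<Rightarrow> complex"
  assumes "\<exists>B. \<forall>\<^sub>F z in F. norm (f z) \<le> B" "(g \<longlongrightarrow> 0) F"
  shows "((\<lambda>z. g z * f z) \<longlongrightarrow> 0) F"
proof -
  obtain B where B: "\<forall>\<^sub>F z in F. norm (f z) \<le> B" using assms(1) by blast
  show ?thesis
  proof (rule Lim_null_comparison)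
    show "\<forall>\<^sub>F z in F. norm (g z * f z) \<le> norm (g z) * B"
      using B by eventually_elim (simp add: norm_mult mult_left_mono)
    show "((\<lambda>z. norm (g z) * B) \<longlongrightarrow> 0) F"
      by (intro tendsto_mult_left_zero tendsto_norm_zero assms(2))
  qed
qed

text \<open>The principal part at \<open>p\<close> of a product of a function with principal
  coefficients \<open>t\<close> and one with Taylor coefficients \<open>d\<close>: each t_(q+1) / (z
  - p)^(q+1) meets only the Taylor terms up to order q. Its residue is the sum of the t_(q+1)
  d_q.\<close>

definition principal_part :: "(nat \<Rightarrow> complex) \<Rightarrow> (nat \<Rightarrow> complex) \<Rightarrow> nat \<Rightarrow> complex \<Rightarrow> complex \<Rightarrow> complex" where
  "principal_part t d M p z = (\<Sum>q<M. t (Suc q) * (\<Sum>s<Suc q. d s / (z - p) ^ (Suc q - s)))"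

text \<open>The difference splits into H times the bounded remainder of T, plus multiples of Taylor
  remainders of H divided by the matching power of z - p. Both are bounded near \<open>p\<close>, so
  the factor z - p sends them to 0.\<close>

lemma minus_principal_part:
  assumes S: "open S" "p \<in> S" "H holomorphic_on S"
    and T: "\<exists>B. \<forall>\<^sub>F z in at p. norm (T z - (\<Sum>k = 1..M. t k / (z - p) ^ k)) \<le> B"
  shows "((\<lambda>z. (z - p) * (T z * H z - principal_part t (taylor_coef H p) M p z)) \<longlongrightarrow> 0) (at p)"
proof -
  let ?E = "\<lambda>q z. (H z - (\<Sum>s<Suc q. taylor_coef H p s * (z - p) ^ s)) / (z - p) ^ Suc q"
  have zp: "((\<lambda>z. z - p) \<longlongrightarrow> 0) (at p)" by (auto intro!: tendsto_eq_intros)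
  have "(H \<longlongrightarrow> H p) (at p)"
    using holomorphic_on_imp_continuous_on[OF S(3)] S by (simp add: continuous_on_eq_continuous_at isCont_def)
  then have "((\<lambda>z. (z - p) * H z) \<longlongrightarrow> 0 * H p) (at p)" by (intro tendsto_mult zp)
  then have "((\<lambda>z. (z - p) * H z * (T z - (\<Sum>k = 1..M. t k / (z - p) ^ k))) \<longlongrightarrow> 0) (at p)"
    by (intro bounded_times_null[OF T]) simp
  moreover have "((\<lambda>z. \<Sum>q<M. t (Suc q) * ((z - p) * ?E q z)) \<longlongrightarrow> (\<Sum>q<M. t (Suc q) * 0)) (at p)"
    by (intro tendsto_intros bounded_times_null zp taylor_remainder_bounded[OF S])
  ultimately have "((\<lambda>z. (z - p) * H z * (T z - (\<Sum>k = 1..M. t k / (z - p) ^ k)) + (\<Sum>q<M. t (Suc q) * ((z - p) * ?E q z))) \<longlongrightarrow> 0 + (\<Sum>q<M. t (Suc q) * 0)) (at p)"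
    by (rule tendsto_add)
  then have L: "((\<lambda>z. (z - p) * H z * (T z - (\<Sum>k = 1..M. t k / (z - p) ^ k)) + (\<Sum>q<M. t (Suc q) * ((z - p) * ?E q z))) \<longlongrightarrow> 0) (at p)"
    by simp
  show ?thesis
  proof (rule Lim_transform_within_open[OF L open_UNIV UNIV_I])
    fix z assume "z \<noteq> p"
    then have nz: "z - p \<noteq> 0" by simp
    have E: "?E q z = H z / (z - p) ^ Suc q - (\<Sum>s<Suc q. taylor_coef H p s / (z - p) ^ (Suc q - s))" for q
      unfolding diff_divide_distrib sum_divide_distrib
    proof (intro arg_cong2[where f="(-)"] refl sum.cong)
      fix s assume "s \<in> {..<Suc q}"
      then have "(z - p) ^ Suc q = (z - p) ^ s * (z - p) ^ (Suc q - s)" by (simp flip: power_add)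
      then show "taylor_coef H p s * (z - p) ^ s / (z - p) ^ Suc q = taylor_coef H p s / (z - p) ^ (Suc q - s)"
        using nz by simp
    qed
    have "(\<Sum>k = 1..M. t k / (z - p) ^ k) = (\<Sum>q<M. t (Suc q) / (z - p) ^ Suc q)"
      using sum.atLeast1_atMost_eq[of "\<lambda>k. t k / (z - p) ^ k" M] by simp
    then show "(z - p) * H z * (T z - (\<Sum>k = 1..M. t k / (z - p) ^ k)) + (\<Sum>q<M. t (Suc q) * ((z - p) * ?E q z))
        = (z - p) * (T z * H z - principal_part t (taylor_coef H p) M p z)"
      unfolding E principal_part_def
      by (simp only: right_diff_distrib sum_subtractf sum_distrib_left mult_ac times_divide_eq_right times_divide_eq_left)
         (simp add: sum_distrib_left mult_ac)
  qed
qed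

lemma principal_part_holomorphic: "p \<notin> A \<Longrightarrow> principal_part t d M p holomorphic_on A"
  unfolding principal_part_def by (intro holomorphic_intros) auto

lemma cint_principal_part:
  assumes \<sigma>: "\<sigma> = 1 \<or> \<sigma> = -1" and p: "p \<in> side \<sigma>"
  shows "cint (principal_part t d M p) = (if \<sigma> = 1 then \<Sum>q<M. t (Suc q) * d q else 0)"
proof -
  have np: "norm z = 1 \<Longrightarrow> z \<noteq> p" for z using p \<sigma> by (auto simp: side_def power_int_minus norm_inverse)
  have c: "continuous_on (sphere 0 1) (\<lambda>z. 1 / (z - p) ^ k)" for k
    by (intro continuous_intros) (use np in auto)
  have v: "cint (\<lambda>z. 1 / (z - p) ^ (Suc q - s)) = (if \<sigma> = 1 \<and> s = q then 1 else 0)" if "s < Suc q" for s q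
  proof (cases "\<sigma> = 1")
    case True
    then have "norm p < 1" using p by (simp add: side_pos)
    from cint_inverse_power_inside[OF this, of "q - s"] show ?thesis using that True by (auto simp: Suc_diff_le)
  next
    case False
    then have "norm p > 1" using p \<sigma> by (auto simp: side_neg)
    from cint_inverse_power_outside[OF this] show ?thesis using False by simp
  qed
  have ci: "continuous_on (sphere 0 1) (\<lambda>z. \<Sum>s<Suc q. d s * (1 / (z - p) ^ (Suc q - s)))" for q
    by (intro continuous_on_sum continuous_on_mult continuous_on_const c)
  have i: "cint (\<lambda>z. \<Sum>s<Suc q. d s * (1 / (z - p) ^ (Suc q - s))) = (\<Sum>s<Suc q. d s * cint (\<lambda>z. 1 / (z - p) ^ (Suc q - s)))" for q
  proof -
    have "cint (\<lambda>z. \<Sum>s<Suc q. d s * (1 / (z - p) ^ (Suc q - s))) = (\<Sum>s<Suc q. cint (\<lambda>z. d s * (1 / (z - p) ^ (Suc q - s))))"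
      by (intro cint_sum finite_lessThan continuous_on_mult continuous_on_const c)
    then show ?thesis unfolding cint_cmult[OF c] .
  qed
  have "cint (principal_part t d M p) = cint (\<lambda>z. \<Sum>q<M. t (Suc q) * (\<Sum>s<Suc q. d s * (1 / (z - p) ^ (Suc q - s))))"
    by (simp add: principal_part_def[abs_def] del: sum.lessThan_Suc)
  also have "\<dots> = (\<Sum>q<M. cint (\<lambda>z. t (Suc q) * (\<Sum>s<Suc q. d s * (1 / (z - p) ^ (Suc q - s)))))"
    by (intro cint_sum finite_lessThan continuous_on_mult continuous_on_const ci)
  also have "\<dots> = (\<Sum>q<M. t (Suc q) * (\<Sum>s<Suc q. d s * cint (\<lambda>z. 1 / (z - p) ^ (Suc q - s))))"
    unfolding cint_cmult[OF ci] i ..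
  also have "\<dots> = (\<Sum>q<M. t (Suc q) * (if \<sigma> = 1 then d q else 0))"
  proof (intro sum.cong refl arg_cong2[where f="(*)"])
    fix q
    have "(\<Sum>s<Suc q. d s * cint (\<lambda>z. 1 / (z - p) ^ (Suc q - s))) = (\<Sum>s<Suc q. if s = q then (if \<sigma> = 1 then d q else 0) else 0)"
      by (intro sum.cong) (auto simp: v)
    then show "(\<Sum>s<Suc q. d s * cint (\<lambda>z. 1 / (z - p) ^ (Suc q - s))) = (if \<sigma> = 1 then d q else 0)" by (simp only: sum.delta finite_lessThan) simp
  qed
  finally show ?thesis by simp
qed

text \<open>As z tends to infinity, z / (z - p)^k tends to 1 for k = 1 and to 0 for larger k, so
  exactly the residue survives. At the end z = 0 the function is regular and the factor z gives
  0.\<close>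

lemma principal_part_end:
  assumes \<sigma>: "\<sigma> = 1 \<or> \<sigma> = -1" and p: "p \<in> side \<sigma>"
  shows "((\<lambda>w. w powi \<sigma> * principal_part t d M p (w powi \<sigma>)) \<longlongrightarrow> (if \<sigma> = 1 then 0 else \<Sum>q<M. t (Suc q) * d q)) (at 0)"
proof -
  have p0: "p \<noteq> 0" using p by (rule nonzero_side)
  have k: "((\<lambda>w. w powi \<sigma> * (1 / (w powi \<sigma> - p) ^ Suc k)) \<longlongrightarrow> (if \<sigma> = -1 \<and> k = 0 then 1 else 0)) (at 0)" for k
  proof (cases "\<sigma> = 1")
    case True
    then show ?thesis using p0 by (auto intro!: tendsto_eq_intros)
  next
    case False
    then have s: "\<sigma> = -1" using \<sigma> by auto
    have "((\<lambda>w. w ^ k / (1 - p * w) ^ Suc k) \<longlongrightarrow> (if k = 0 then 1 else 0)) (at 0)"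
      by (auto intro!: tendsto_eq_intros simp: power_0_left)
    then show ?thesis
    proof (rule Lim_transform_within_open[where s=UNIV, THEN tendsto_eq_rhs])
      fix w :: complex assume "w \<noteq> 0"
      then have "inverse w - p = (1 - p * w) / w" by (simp add: field_simps)
      then show "w ^ k / (1 - p * w) ^ Suc k = w powi \<sigma> * (1 / (w powi \<sigma> - p) ^ Suc k)"
        using \<open>w \<noteq> 0\<close> by (simp add: s power_int_minus power_divide)
    qed (use s in auto)
  qed
  have k': "((\<lambda>w. w powi \<sigma> * (1 / (w powi \<sigma> - p) ^ (Suc q - s))) \<longlongrightarrow> (if \<sigma> = -1 \<and> s = q then 1 else 0)) (at 0)" if "s < Suc q" for q s
    using k[of "q - s"] that by (auto simp: Suc_diff_le)
  have "((\<lambda>w. \<Sum>q<M. t (Suc q) * (\<Sum>s<Suc q. d s * (w powi \<sigma> * (1 / (w powi \<sigma> - p) ^ (Suc q - s)))))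
     \<longlongrightarrow> (\<Sum>q<M. t (Suc q) * (\<Sum>s<Suc q. d s * (if \<sigma> = -1 \<and> s = q then 1 else 0)))) (at 0)"
    by (intro tendsto_sum tendsto_mult tendsto_const k') auto
  also have "(\<lambda>w. \<Sum>q<M. t (Suc q) * (\<Sum>s<Suc q. d s * (w powi \<sigma> * (1 / (w powi \<sigma> - p) ^ (Suc q - s)))))
     = (\<lambda>w. w powi \<sigma> * principal_part t d M p (w powi \<sigma>))"
    unfolding principal_part_def by (simp only: sum_distrib_left mult_ac times_divide_eq_right mult_1_left mult_1_right)
  also have "(\<Sum>q<M. t (Suc q) * (\<Sum>s<Suc q. d s * (if \<sigma> = -1 \<and> s = q then 1 else 0))) = (if \<sigma> = 1 then 0 else \<Sum>q<M. t (Suc q) * d q)"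
    using \<sigma> by (auto simp: if_distrib [of "\<lambda>x. _ * x"] sum.delta cong: if_cong)
  finally show ?thesis .
qed

text \<open>Principal parts are prescribed at \<open>zs j\<close> only; evenness transfers them to
  \<open>- zs j\<close>. \<open>T_end\<close> says that T is bounded near 0 or infinity, so that end
  contributes no pole of its own.\<close>

locale pole_data =
  fixes \<sigma> :: int and N :: nat and zs :: "nat \<Rightarrow> complex" and ms :: "nat \<Rightarrow> nat" and t :: "nat \<Rightarrow> nat \<Rightarrow> complex"
    and T :: "complex \<Rightarrow> complex" and S :: "complex set"
  assumes \<sigma>: "\<sigma> = 1 \<or> \<sigma> = -1"
    and S_def: "S = (\<Union>j\<in>{1..N}. {zs j, - zs j})"
    and zs_side: "\<And>j. j \<in> {1..N} \<Longrightarrow> zs j \<in> side \<sigma>"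
    and zs_distinct: "\<And>j k. j \<in> {1..N} \<Longrightarrow> k \<in> {1..N} \<Longrightarrow> j \<noteq> k \<Longrightarrow> zs j \<noteq> zs k \<and> zs j \<noteq> - zs k"
    and T_holo: "T holomorphic_on (side \<sigma> - S)"
    and T_cont: "continuous_on (cside \<sigma> - S) T"
    and T_even: "\<And>z. z \<in> cside \<sigma> - S \<Longrightarrow> T (- z) = T z"
    and T_end: "\<exists>B. \<forall>\<^sub>F w in at 0. norm (T (w powi \<sigma>)) \<le> B"
    and T_res: "\<And>j. j \<in> {1..N} \<Longrightarrow> \<exists>B. \<forall>\<^sub>F z in at (zs j). norm (T z - (\<Sum>k = 1..ms j. t j k / (z - zs j) ^ k)) \<le> B"
begin

lemma finite_S: "finite S" and S_side: "S \<subseteq> side \<sigma>" and zs_S: "j \<in> {1..N} \<Longrightarrow> zs j \<in> S \<and> - zs j \<in> S"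
  using zs_side uminus_side_iff[OF \<sigma>] by (auto simp: S_def)

lemma zs_nonzero: "j \<in> {1..N} \<Longrightarrow> zs j \<noteq> - zs j"
  using nonzero_side[OF zs_side[of j]] by (auto simp: eq_neg_iff_add_eq_0)

text \<open>The principal parts are subtracted in the odd combination \<open>P\<^sub>j(z) - P\<^sub>j(-z)\<close>, which takes care of the
  pole at \<open>-z\<^sub>j\<close> as well. Inside the disc they carry the whole integral, outside the coefficient of \<open>1/z\<close>
  at infinity.\<close>

lemma cint_odd:
  assumes H: "H holomorphic_on side \<sigma>" "continuous_on (cside \<sigma>) H"
    and odd: "\<And>z. z \<in> cside \<sigma> \<Longrightarrow> H (- z) = - H z"
    and H_end: "((\<lambda>w. w powi \<sigma> * H (w powi \<sigma>)) \<longlongrightarrow> 0) (at 0)"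
  shows "cint (\<lambda>z. T z * H z) = 2 * of_int \<sigma> * (\<Sum>j=1..N. \<Sum>q<ms j. t j (Suc q) * taylor_coef H (zs j) q)"
proof -
  define pp where "pp j = principal_part (t j) (taylor_coef H (zs j)) (ms j) (zs j)" for j
  define P where "P z = (\<Sum>j=1..N. pp j z - pp j (- z))" for z
  define g where "g z = T z * H z - P z" for z
  define b where "b = (\<Sum>j=1..N. \<Sum>q<ms j. t j (Suc q) * taylor_coef H (zs j) q)"
  have pp_holo: "pp j holomorphic_on A" if "zs j \<notin> A" for j A
    unfolding pp_def by (rule principal_part_holomorphic[OF that])
  have pp_holo': "(\<lambda>z. pp j (- z)) holomorphic_on A" if "- zs j \<notin> A" for j A
  proof -
    have "(pp j \<circ> uminus) holomorphic_on A"
      by (rule holomorphic_on_compose_gen[OF _ pp_holo[of j "- {zs j}"]]) (use that in \<open>auto intro!: holomorphic_intros\<close>)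
    then show ?thesis by (simp add: o_def)
  qed
  have P_holo: "P holomorphic_on A" if "A \<inter> S = {}" for A
    unfolding P_def using that by (intro holomorphic_on_sum holomorphic_on_diff pp_holo pp_holo') (use zs_S in blast)+
  have P_cont: "continuous_on A P" if "A \<inter> S = {}" for A
    using holomorphic_on_imp_continuous_on[OF P_holo[OF that]] .
  have P_odd: "P (- z) = - P z" for z
    unfolding P_def by (simp add: sum_negf[symmetric])
  have TH_cont: "continuous_on (cside \<sigma> - S) (\<lambda>z. T z * H z)"
    by (intro continuous_on_mult T_cont continuous_on_subset[OF H(2)]) auto
  have lim: "((\<lambda>z. (z - zs j) * g z) \<longlongrightarrow> 0) (at (zs j))" if j: "j \<in> {1..N}" for j
  proof -
    \<comment> \<open>\<open>Q\<close> collects all terms of \<open>P\<close> other than the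
      principal part at \<open>zs j\<close>. It is regular there because \<open>zs j\<close> differs
      from \<open>- zs j\<close> and from all other poles.\<close>
    define Q where "Q z = (\<Sum>i\<in>{1..N} - {j}. pp i z - pp i (- z)) - pp j (- z)" for z
    define U where "U = - (insert (- zs j) (\<Union>i\<in>{1..N} - {j}. {zs i, - zs i}))"
    have "open U" unfolding U_def by (intro open_Compl finite_imp_closed) auto
    moreover have "zs j \<in> U" unfolding U_def using zs_nonzero[OF j] zs_distinct[OF j] by fastforce
    moreover have "Q holomorphic_on U"
      unfolding Q_def by (intro holomorphic_on_sum holomorphic_on_diff pp_holo pp_holo') (auto simp: U_def)
    ultimately have "(Q \<longlongrightarrow> Q (zs j)) (at (zs j))"
      using holomorphic_on_imp_continuous_on[of Q U] by (simp add: continuous_on_eq_continuous_at isCont_def)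
    moreover have "((\<lambda>z. z - zs j) \<longlongrightarrow> 0) (at (zs j))" by (auto intro!: tendsto_eq_intros)
    ultimately have "((\<lambda>z. (z - zs j) * Q z) \<longlongrightarrow> 0 * Q (zs j)) (at (zs j))" by (intro tendsto_mult)
    moreover have "((\<lambda>z. (z - zs j) * (T z * H z - pp j z)) \<longlongrightarrow> 0) (at (zs j))"
      unfolding pp_def by (rule minus_principal_part[OF open_side[OF \<sigma>] zs_side[OF j] H(1) T_res[OF j]])
    ultimately have "((\<lambda>z. (z - zs j) * (T z * H z - pp j z) - (z - zs j) * Q z) \<longlongrightarrow> 0 - 0 * Q (zs j)) (at (zs j))"
      by (intro tendsto_diff)
    moreover have "g = (\<lambda>z. (T z * H z - pp j z) - Q z)"
      unfolding g_def P_def Q_def by (subst sum.remove[OF _ j]) auto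
    ultimately show ?thesis by (simp only: right_diff_distrib mult_zero_left diff_zero)
  qed
  have lim': "((\<lambda>z. (z - p) * g z) \<longlongrightarrow> 0) (at p)" if pS: "p \<in> S" for p
  proof -
    obtain j where j: "j \<in> {1..N}" "p = zs j \<or> p = - zs j" using pS by (auto simp: S_def)
    show ?thesis
    proof (cases "p = zs j")
      case False
      \<comment> \<open>No expansion is given at \<open>- zs j\<close>; the oddness of
        \<open>g\<close> transports the limit from \<open>zs j\<close>.\<close>
      then have p: "p = - zs j" using j by simp
      have "\<forall>\<^sub>F x in at (- zs j). - x \<noteq> zs j"
        unfolding eventually_at_filter by (rule always_eventually) (metis minus_minus)
      then have "filterlim uminus (at (zs j)) (at p)"
        unfolding p by (intro filterlim_atI) (auto intro!: tendsto_eq_intros)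
      then have L: "((\<lambda>z. (- z - zs j) * g (- z)) \<longlongrightarrow> 0) (at p)"
        by (rule filterlim_compose[OF lim[OF j(1)]])
      have "open (side \<sigma> - (S - {p}))" "p \<in> side \<sigma> - (S - {p})"
        using open_side[OF \<sigma>] finite_S S_side pS by (auto intro!: open_Diff finite_imp_closed)
      then show ?thesis
      proof (rule Lim_transform_within_open[OF L])
        fix z assume "z \<in> side \<sigma> - (S - {p})" "z \<noteq> p"
        then have z: "z \<in> cside \<sigma> - S" using side_subset_cside by auto
        then have "g (- z) = - g z" unfolding g_def using T_even[OF z] odd[of z] P_odd[of z] by auto
        then show "(- z - zs j) * g (- z) = (z - p) * g z" by (simp add: p algebra_simps)
      qed
    qed (use lim j in simp)
  qed
  have "((\<lambda>w. w powi \<sigma> * H (w powi \<sigma>) * T (w powi \<sigma>)) \<longlongrightarrow> 0) (at 0)"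
    by (rule bounded_times_null[OF T_end H_end])
  moreover have "((\<lambda>w. w powi \<sigma> * P (w powi \<sigma>)) \<longlongrightarrow> (if \<sigma> = 1 then 0 else 2 * b)) (at 0)"
  proof -
    have 1: "((\<lambda>w. w powi \<sigma> * pp j (w powi \<sigma>)) \<longlongrightarrow> (if \<sigma> = 1 then 0 else \<Sum>q<ms j. t j (Suc q) * taylor_coef H (zs j) q)) (at 0)"
      if "j \<in> {1..N}" for j
      unfolding pp_def by (rule principal_part_end[OF \<sigma> zs_side[OF that]])
    have "filterlim uminus (at 0) (at (0::complex))"
      by (intro filterlim_atI) (auto intro!: tendsto_eq_intros simp: eventually_at_filter)
    from filterlim_compose[OF 1 this]
    have 2: "((\<lambda>w. - (w powi \<sigma>) * pp j (- (w powi \<sigma>))) \<longlongrightarrow> (if \<sigma> = 1 then 0 else \<Sum>q<ms j. t j (Suc q) * taylor_coef H (zs j) q)) (at 0)"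
      if "j \<in> {1..N}" for j
      using that \<sigma> by (auto simp: power_int_minus)
    have "((\<lambda>w. \<Sum>j=1..N. w powi \<sigma> * pp j (w powi \<sigma>) + - (w powi \<sigma>) * pp j (- (w powi \<sigma>))) \<longlongrightarrow>
       (\<Sum>j=1..N. (if \<sigma> = 1 then 0 else \<Sum>q<ms j. t j (Suc q) * taylor_coef H (zs j) q) + (if \<sigma> = 1 then 0 else \<Sum>q<ms j. t j (Suc q) * taylor_coef H (zs j) q))) (at 0)"
      by (intro tendsto_sum tendsto_add 1 2)
    then show ?thesis by (auto simp: P_def b_def sum_distrib_left algebra_simps sum.distrib)
  qed
  ultimately have "((\<lambda>w. w powi \<sigma> * H (w powi \<sigma>) * T (w powi \<sigma>) - w powi \<sigma> * P (w powi \<sigma>)) \<longlongrightarrow> 0 - (if \<sigma> = 1 then 0 else 2 * b)) (at 0)"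
    by (rule tendsto_diff)
  then have g_end: "((\<lambda>w. w powi \<sigma> * g (w powi \<sigma>)) \<longlongrightarrow> (if \<sigma> = 1 then 0 else - 2 * b)) (at 0)"
    by (simp add: g_def algebra_simps split: if_splits)
  have cg: "cint g = (if \<sigma> = 1 then 0 else - 2 * b)"
  proof (rule cint_side[OF \<sigma> finite_S S_side _ _ lim' g_end])
    show "continuous_on (cside \<sigma> - S) g" unfolding g_def by (intro continuous_on_diff TH_cont P_cont) auto
    show "g holomorphic_on side \<sigma> - S"
      unfolding g_def by (intro holomorphic_on_diff holomorphic_on_mult T_holo P_holo holomorphic_on_subset[OF H(1)]) auto
  qed auto
  have sphere: "sphere 0 1 \<subseteq> cside \<sigma> - S"
  proof -
    have "norm z \<noteq> 1" if "z \<in> side \<sigma>" for z using that \<sigma> by (auto simp: side_def power_int_minus norm_inverse)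
    then show ?thesis using S_side by (auto simp: sphere_in_cside)
  qed
  have nz: "zs j \<notin> sphere 0 1" "- zs j \<notin> sphere 0 1" if "j \<in> {1..N}" for j
    using sphere zs_S[OF that] by blast+
  have cpp: "continuous_on (sphere 0 1) (pp j)" "continuous_on (sphere 0 1) (\<lambda>z. pp j (- z))" if "j \<in> {1..N}" for j
    using holomorphic_on_imp_continuous_on[OF pp_holo[OF nz(1)[OF that]]] holomorphic_on_imp_continuous_on[OF pp_holo'[OF nz(2)[OF that]]] .
  have "cint P = (\<Sum>j=1..N. cint (\<lambda>z. pp j z + (-1) * pp j (- z)))"
    unfolding P_def[abs_def] by (subst cint_sum[symmetric]) (auto intro!: continuous_intros cpp)
  also have "\<dots> = (\<Sum>j=1..N. 2 * cint (pp j))"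
  proof (rule sum.cong[OF refl])
    fix j assume j: "j \<in> {1..N}"
    have "cint (\<lambda>z. pp j z + (-1) * pp j (- z)) = cint (pp j) + cint (\<lambda>z. (-1) * pp j (- z))"
      by (intro cint_add continuous_intros cpp j)
    also have "cint (\<lambda>z. (-1) * pp j (- z)) = (-1) * cint (\<lambda>z. pp j (- z))"
      by (intro cint_cmult cpp j)
    finally show "cint (\<lambda>z. pp j z + (-1) * pp j (- z)) = 2 * cint (pp j)"
      by (simp add: cint_uminus_arg)
  qed
  also have "\<dots> = (\<Sum>j=1..N. 2 * (if \<sigma> = 1 then \<Sum>q<ms j. t j (Suc q) * taylor_coef H (zs j) q else 0))"
    unfolding pp_def by (intro sum.cong refl arg_cong2[where f="(*)"] cint_principal_part[OF \<sigma>] zs_side)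
  also have "\<dots> = (if \<sigma> = 1 then 2 * b else 0)"
    by (simp add: b_def sum_distrib_left)
  finally have cP: "cint P = (if \<sigma> = 1 then 2 * b else 0)" .
  have "cint (\<lambda>z. T z * H z) = cint (\<lambda>z. g z + P z)" by (simp add: g_def)
  also have "\<dots> = cint g + cint P"
  proof (rule cint_add)
    show cP': "continuous_on (sphere 0 1) P" using sphere by (intro P_cont) auto
    show "continuous_on (sphere 0 1) g"
      unfolding g_def by (intro continuous_on_diff cP' continuous_on_subset[OF TH_cont sphere])
  qed
  \<comment> \<open>Inside the disc the summands are 0 and 2 b, outside they are -2 b and 0; both
    totals equal 2 \<sigma> b.\<close>
  also have "\<dots> = 2 * of_int \<sigma> * b" using \<sigma> by (auto simp: cg cP)
  finally show ?thesis by (simp add: b_def)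
qed

text \<open>The weight \<open>w\<close> is bounded on the compact set \<open>K\<close>. Two cases
  are needed: a small disc around a pole, where the series is differentiated, and the unit circle,
  where it is integrated against \<open>R\<close>.\<close>

lemma uniform_series_times:
  assumes ul: "uniform_limit {z. norm (z powi \<sigma>) \<le> 1} (\<lambda>N z. \<Sum>s<N. k s * (z powi \<sigma>) ^ s) g sequentially"
    and cg: "continuous_on (cside \<sigma>) g" and K: "compact K" "K \<subseteq> cside \<sigma>" and w: "continuous_on K w"
    and a: "\<And>s z. z \<in> K \<Longrightarrow> a s z = w z * (z powi \<sigma>) ^ s" and h: "\<And>z. z \<in> K \<Longrightarrow> h z = w z * g z"
  shows "uniform_limit K (\<lambda>N z. \<Sum>s<N. k s * a s z) h sequentially"
proof -
  have bw: "bounded (w ` K)" using compact_continuous_image[OF w K(1)] by (rule compact_imp_bounded)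
  have bg: "bounded (g ` K)"
    using compact_continuous_image[OF continuous_on_subset[OF cg K(2)] K(1)] by (rule compact_imp_bounded)
  have "uniform_limit K (\<lambda>N z. w z * (\<Sum>s<N. k s * (z powi \<sigma>) ^ s)) (\<lambda>z. w z * g z) sequentially"
    by (intro uniform_lim_mult uniform_limit_const bw bg uniform_limit_on_subset[OF ul]) (use K(2) in \<open>auto simp: cside_def\<close>)
  then show ?thesis
    by (subst uniform_limit_cong[where g="\<lambda>N z. w z * (\<Sum>s<N. k s * (z powi \<sigma>) ^ s)" and i="\<lambda>z. w z * g z"])
       (auto simp: a h sum_distrib_left mult_ac)
qed

text \<open>Locally uniform limits of holomorphic functions may be differentiated term by term, and
  each term is a power of z. This exchanges the residue at \<open>p\<close> with the sum over the
  Fourier coefficients.\<close>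

lemma taylor_coef_series_sums:
  assumes ul: "uniform_limit {z. norm (z powi \<sigma>) \<le> 1} (\<lambda>N z. \<Sum>s<N. k s * (z powi \<sigma>) ^ s) g sequentially"
    and cg: "continuous_on (cside \<sigma>) g" and p: "p \<in> side \<sigma>"
    and h: "\<And>z. z \<in> side \<sigma> \<Longrightarrow> h z = z powi c * g z"
  shows "(\<lambda>s. k s * taylor_powi q (c + \<sigma> * int s) p) sums taylor_coef h p q"
proof -
  obtain d where d: "d > 0" "cball p d \<subseteq> side \<sigma>" using open_side[OF \<sigma>] p by (auto simp: open_contains_cball)
  have "uniform_limit (cball p d) (\<lambda>N z. \<Sum>s<N. k s * z powi (c + \<sigma> * int s)) h sequentially"
  proof (rule uniform_series_times[OF ul cg, where w = "\<lambda>z. z powi c"])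
    show "continuous_on (cball p d) (\<lambda>z. z powi c)" by (rule continuous_on_powi_sign) (use d nonzero_side in blast)
    fix z assume "z \<in> cball p d"
    then have z: "z \<in> side \<sigma>" using d by auto
    then show "h z = z powi c * g z" by (rule h)
    show "z powi (c + \<sigma> * int s) = z powi c * (z powi \<sigma>) ^ s" for s
      using nonzero_side[OF z] by (simp add: power_int_add power_int_mult)
  qed (use d side_subset_cside in auto)
  then have ul': "uniform_limit (ball p d) (\<lambda>N z. \<Sum>s<N. k s * z powi (c + \<sigma> * int s)) h sequentially"
    by (rule uniform_limit_on_subset) auto
  have nz: "0 \<notin> ball p d" using d(2) nonzero_side[of 0] ball_subset_cball by blast
  have pn: "p \<noteq> 0" using p by (rule nonzero_side)
  have ho: "(\<lambda>z. z powi e) holomorphic_on ball p d" for e using nz by (intro holomorphic_intros) auto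
  have hs: "(\<lambda>z. \<Sum>s<N. k s * z powi (c + \<sigma> * int s)) holomorphic_on ball p d" for N
    by (intro holomorphic_intros ho)
  have der: "(deriv ^^ q) (\<lambda>z. \<Sum>s<N. k s * z powi (c + \<sigma> * int s)) p = (\<Sum>s<N. k s * (fact q * taylor_powi q (c + \<sigma> * int s) p))" for N
  proof (induction N)
    case (Suc N)
    have "(deriv ^^ q) (\<lambda>z. (\<Sum>s<N. k s * z powi (c + \<sigma> * int s)) + k N * z powi (c + \<sigma> * int N)) p
      = (deriv ^^ q) (\<lambda>z. \<Sum>s<N. k s * z powi (c + \<sigma> * int s)) p + (deriv ^^ q) (\<lambda>z. k N * z powi (c + \<sigma> * int N)) p"
      by (rule higher_deriv_add[OF hs]) (use d(1) in \<open>auto intro!: holomorphic_on_mult ho\<close>)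
    also have "(deriv ^^ q) (\<lambda>z. k N * z powi (c + \<sigma> * int N)) p = k N * (deriv ^^ q) (\<lambda>z. z powi (c + \<sigma> * int N)) p"
      by (rule higher_deriv_cmult[OF ho]) (use d(1) in auto)
    finally show ?case by (simp add: Suc.IH higher_deriv_powi[OF pn])
  qed simp
  have "(\<lambda>N. (deriv ^^ q) (\<lambda>z. \<Sum>s<N. k s * z powi (c + \<sigma> * int s)) p) \<longlonglongrightarrow> (deriv ^^ q) h p"
    by (rule higher_deriv_complex_uniform_limit[OF ul']) (use d(1) hs in auto)
  then have "(\<lambda>s. k s * (fact q * taylor_powi q (c + \<sigma> * int s) p)) sums (deriv ^^ q) h p"
    unfolding der sums_def .
  from sums_divide[OF this, of "fact q"] show ?thesis by (simp add: taylor_coef_def mult.left_commute)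
qed

text \<open>For one site and one component, \<open>F\<close> plays the role of \<phi>,
  \<open>G\<close> of \<psi>, \<open>Gb\<close> of the \<psi> of the other side, and
  \<open>k s\<close> is the Fourier coefficient of index n + s. The term s = 0 is still included; it
  is split off only in the matrix form.\<close>

theorem kernel_equation:
  assumes F: "F holomorphic_on side \<sigma>" "continuous_on (cside \<sigma>) F"
    and F_par: "\<And>z. z \<in> cside \<sigma> \<Longrightarrow> F (- z) = (if even n then F z else - F z)"
    and F_end: "((\<lambda>w. w powi n * F (w powi \<sigma>)) \<longlongrightarrow> f0) (at 0)"
    and G: "G holomorphic_on side \<sigma>" "continuous_on (cside \<sigma>) G" "\<And>z. z \<in> cside \<sigma> \<Longrightarrow> G z = z powi (\<sigma> * n) * g z"
    and ul: "uniform_limit {z. norm (z powi \<sigma>) \<le> 1} (\<lambda>N z. \<Sum>s<N. k s * (z powi \<sigma>) ^ s) g sequentially"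
    and cg: "continuous_on (cside \<sigma>) g"
    and k_odd: "\<And>s. odd s \<Longrightarrow> k s = 0"
    and Gb: "continuous_on (sphere 0 1) Gb" "\<And>z. norm z = 1 \<Longrightarrow> Gb (- z) = (if even n then Gb z else - Gb z)"
    and R: "continuous_on (sphere 0 1) R"
    and circle: "\<And>z. norm z = 1 \<Longrightarrow> T z * F z = Gb z + R z * G z"
    and dep: "\<And>j q. j \<in> {1..N} \<Longrightarrow> q < ms j \<Longrightarrow>
        (deriv ^^ q) F (zs j) = (\<Sum>l = 0..q. of_nat (q choose l) * gam j (q - l) * (deriv ^^ l) G (zs j))"
    and nm: "n < m"
    and cn: "\<And>j s. cn j s = - 2 * of_int \<sigma> * (\<Sum>l = 0..ms j - 1 - s. t j (s + 1 + l) * gam j l / fact l)"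
    and Om: "\<And>l. Om l = (if even l then cint (\<lambda>z. R z * z powi (\<sigma> * l - 1))
        + (\<Sum>j=1..N. \<Sum>s<ms j. cn j s * taylor_powi s (\<sigma> * l - 1) (zs j)) else 0)"
  shows "(\<lambda>s. k s * Om (n + int s + m)) sums (- cint (\<lambda>z. Gb z * z powi (\<sigma> * m - 1)))"
proof (cases "even (n + m)")
  \<comment> \<open>For odd n + m the integrand is even, and rotating the circle by half a turn
    changes the sign of its integral, so it is 0. On the left a nonzero \<open>k s\<close> requires
    even s, and then \<open>Om\<close> has an odd index.\<close>
  case False
  have "cint (\<lambda>z. Gb z * z powi (\<sigma> * m - 1)) = cint (\<lambda>z. (\<lambda>z. Gb z * z powi (\<sigma> * m - 1)) (- z))"
    using False \<sigma> by (intro cint_cong) (auto simp: Gb(2) power_int_minus_left)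
  also have "\<dots> = - cint (\<lambda>z. Gb z * z powi (\<sigma> * m - 1))" by (rule cint_uminus_arg)
  finally have "cint (\<lambda>z. Gb z * z powi (\<sigma> * m - 1)) = 0" by simp
  moreover have "(\<lambda>s. k s * Om (n + int s + m)) = (\<lambda>_. 0)"
  proof
    show "k s * Om (n + int s + m) = 0" for s
      using False k_odd[of s] by (cases "odd s") (auto simp: Om)
  qed
  ultimately show ?thesis by simp
next
  case True
  define e where "e = \<sigma> * m - 1"
  define H where "H z = F z * z powi e" for z
  define h where "h z = G z * z powi e" for z
  have hpow: "(\<lambda>z. z powi e) holomorphic_on side \<sigma>" by (intro holomorphic_intros) (auto dest: nonzero_side)
  have cpow: "continuous_on (cside \<sigma>) (\<lambda>z. z powi e)" by (intro continuous_on_powi_sign) (auto dest: nonzero_cside)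
  have cpows: "continuous_on (sphere 0 1) (\<lambda>z::complex. z powi e')" for e' by (intro continuous_on_powi_sign) auto
  have sub: "sphere 0 1 \<subseteq> cside \<sigma>" by (auto intro: sphere_in_cside)
  have cGs: "continuous_on (sphere 0 1) G" by (rule continuous_on_subset[OF G(2) sub])
  have "cint (\<lambda>z. T z * H z) = 2 * of_int \<sigma> * (\<Sum>j=1..N. \<Sum>q<ms j. t j (Suc q) * taylor_coef H (zs j) q)"
  proof (rule cint_odd)
    show "H holomorphic_on side \<sigma>" unfolding H_def by (intro holomorphic_on_mult F hpow)
    show "continuous_on (cside \<sigma>) H" unfolding H_def by (intro continuous_on_mult F cpow)
    show "H (- z) = - H z" if "z \<in> cside \<sigma>" for z
      using True \<sigma> by (auto simp: H_def F_par[OF that] e_def power_int_minus_left)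
    \<comment> \<open>This is where n < m enters: the positive power w^(m-n) sends the finite limit
      of w^n F to 0.\<close>
    have "((\<lambda>w. w powi n * F (w powi \<sigma>) * w ^ nat (m - n)) \<longlongrightarrow> f0 * 0 ^ nat (m - n)) (at 0)"
      by (intro tendsto_intros F_end)
    then have "((\<lambda>w. w powi n * F (w powi \<sigma>) * w ^ nat (m - n)) \<longlongrightarrow> 0) (at 0)" using nm by (auto simp: power_0_left)
    then show "((\<lambda>w. w powi \<sigma> * H (w powi \<sigma>)) \<longlongrightarrow> 0) (at 0)"
    proof (rule Lim_transform_within_open[OF _ open_UNIV UNIV_I])
      fix w :: complex assume w: "w \<noteq> 0"
      have "w powi \<sigma> * (w powi \<sigma>) powi e = (w powi \<sigma>) powi (\<sigma> * m)"
        using w power_int_add[of "w powi \<sigma>" 1 e] by (simp add: e_def)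
      also have "\<dots> = w powi m" using powi_powi_sign[OF \<sigma>, of w] by (simp add: power_int_mult)
      also have "\<dots> = w powi n * w powi (m - n)" using w by (simp flip: power_int_add)
      also have "w powi (m - n) = w ^ nat (m - n)" using nm by (simp add: power_int_def)
      finally show "w powi n * F (w powi \<sigma>) * w ^ nat (m - n) = w powi \<sigma> * H (w powi \<sigma>)"
        by (simp add: H_def mult_ac)
    qed
  qed
  also have "\<dots> = 2 * of_int \<sigma> * (\<Sum>j=1..N. \<Sum>s<ms j. (\<Sum>l = 0..ms j - 1 - s. t j (s + 1 + l) * gam j l / fact l) * taylor_coef h (zs j) s)"
    unfolding H_def h_def
    by (intro arg_cong2[where f="(*)"] refl sum.cong residue_by_dependency[OF open_side[OF \<sigma>] zs_side F(1) G(1) hpow] dep) auto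
  also have "\<dots> = - (\<Sum>j=1..N. \<Sum>s<ms j. cn j s * taylor_coef h (zs j) s)"
    unfolding cn by (simp add: sum_distrib_left sum_negf[symmetric] mult_ac)
  finally have TH: "cint (\<lambda>z. T z * H z) = - (\<Sum>j=1..N. \<Sum>s<ms j. cn j s * taylor_coef h (zs j) s)" .
  have "cint (\<lambda>z. T z * H z) = cint (\<lambda>z. Gb z * z powi e + R z * (G z * z powi e))"
  proof (rule cint_cong)
    fix z :: complex assume "norm z = 1"
    from circle[OF this] have "T z * F z * z powi e = (Gb z + R z * G z) * z powi e" by simp
    then show "T z * H z = Gb z * z powi e + R z * (G z * z powi e)" by (simp add: H_def algebra_simps)
  qed
  also have "\<dots> = cint (\<lambda>z. Gb z * z powi e) + cint (\<lambda>z. R z * (G z * z powi e))"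
    by (intro cint_add continuous_intros Gb(1) R cGs cpows)
  finally have dec: "cint (\<lambda>z. T z * H z) = cint (\<lambda>z. Gb z * z powi e) + cint (\<lambda>z. R z * (G z * z powi e))" .
  have sum: "cint (\<lambda>z. R z * (G z * z powi e)) + (\<Sum>j=1..N. \<Sum>s<ms j. cn j s * taylor_coef h (zs j) s) = - cint (\<lambda>z. Gb z * z powi e)"
  proof -
    have "b + c = - a" if "x = a + b" "x = - c" for a b c x :: complex
      using trans[OF sym[OF that(1)] that(2)] by (simp only: eq_neg_iff_add_eq_0 add_ac)
    from this[OF dec TH] show ?thesis .
  qed
  \<comment> \<open>With l = n + s this is \<sigma> (l + m) - 1, the exponent in both parts of
    \<open>Om\<close>.\<close>
  have ex: "\<sigma> * n + e + \<sigma> * int s = \<sigma> * (n + int s + m) - 1" for s by (simp add: e_def algebra_simps)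
  have "(\<lambda>s. k s * taylor_powi q (\<sigma> * n + e + \<sigma> * int s) (zs j)) sums taylor_coef h (zs j) q" if "j \<in> {1..N}" for j q
  proof (rule taylor_coef_series_sums[OF ul cg zs_side[OF that]])
    fix z assume z: "z \<in> side \<sigma>"
    then have "z \<in> cside \<sigma>" using side_subset_cside by auto
    then show "h z = z powi (\<sigma> * n + e) * g z"
      using nonzero_side[OF z] by (simp add: h_def G(3) power_int_add)
  qed
  then have "(\<lambda>s. \<Sum>j=1..N. \<Sum>q<ms j. cn j q * (k s * taylor_powi q (\<sigma> * (n + int s + m) - 1) (zs j))) sums (\<Sum>j=1..N. \<Sum>q<ms j. cn j q * taylor_coef h (zs j) q)"
    unfolding ex by (intro sums_sum sums_mult)
  moreover have "(\<lambda>s. cint (\<lambda>z. k s * (R z * z powi (\<sigma> * n + e + \<sigma> * int s)))) sums cint (\<lambda>z. R z * (G z * z powi e))"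
  proof (rule cint_sums)
    show "uniform_limit (sphere 0 1) (\<lambda>N z. \<Sum>s<N. k s * (R z * z powi (\<sigma> * n + e + \<sigma> * int s))) (\<lambda>z. R z * (G z * z powi e)) sequentially"
    proof (rule uniform_series_times[OF ul cg, where w = "\<lambda>z. R z * z powi (\<sigma> * n + e)"])
      fix z :: complex assume "z \<in> sphere 0 1"
      then have z: "z \<in> cside \<sigma>" using sub by auto
      show "R z * (G z * z powi e) = R z * z powi (\<sigma> * n + e) * g z"
        using nonzero_cside[OF z] by (simp add: G(3)[OF z] power_int_add)
      show "R z * z powi (\<sigma> * n + e + \<sigma> * int s) = R z * z powi (\<sigma> * n + e) * (z powi \<sigma>) ^ s" for s
        using nonzero_cside[OF z] power_int_add[of z "\<sigma> * n + e" "\<sigma> * int s"] by (simp add: power_int_mult)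
    qed (use sub in \<open>auto intro!: continuous_intros R cpows\<close>)
  qed (intro continuous_intros R cpows)
  then have "(\<lambda>s. k s * cint (\<lambda>z. R z * z powi (\<sigma> * (n + int s + m) - 1))) sums cint (\<lambda>z. R z * (G z * z powi e))"
    unfolding ex by (subst (asm) cint_cmult) (intro continuous_intros R cpows)
  ultimately have "(\<lambda>s. k s * cint (\<lambda>z. R z * z powi (\<sigma> * (n + int s + m) - 1)) + (\<Sum>j=1..N. \<Sum>q<ms j. cn j q * (k s * taylor_powi q (\<sigma> * (n + int s + m) - 1) (zs j))))
     sums (- cint (\<lambda>z. Gb z * z powi e))"
    unfolding sum[symmetric] by (intro sums_add)
  \<comment> \<open>For odd s both sides vanish with \<open>k s\<close>; for even s the index of
    \<open>Om\<close> is even, so the branch with the integral and the residues applies.\<close>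
  moreover have "k s * Om (n + int s + m) = k s * cint (\<lambda>z. R z * z powi (\<sigma> * (n + int s + m) - 1)) + (\<Sum>j=1..N. \<Sum>q<ms j. cn j q * (k s * taylor_powi q (\<sigma> * (n + int s + m) - 1) (zs j)))" for s
  proof (cases "odd s")
    case False
    then have "even (n + int s + m)" using True by auto
    then show ?thesis by (simp add: Om distrib_left sum_distrib_left mult_ac)
  qed (simp add: k_odd)
  ultimately show ?thesis by (simp add: e_def)
qed

end

section \<open>The symmetry z -> -z\<close>

lemma (in jost_recursion) satisfies_uminus:
  assumes v: "satisfies (- z) v"
  shows "satisfies z (\<lambda>n i. (if even n then 1 else -1) * v n i)"
  unfolding satisfies_def
proof (intro allI impI)
  fix n and i :: nat assume i: "i < 2"
  \<comment> \<open>All powers of z in the one-step matrix are odd, so z -> -z changes the sign of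
    the matrix; the factor (-1)^n compensates for this at each step.\<close>
  have s: "odd (\<sigma> * sg i)" "odd \<sigma>" "odd (- \<sigma>)" using \<sigma> by (auto simp: sg_def)
  have "v n i = (- z) powi (\<sigma> * sg i) * v (n+1) i
      + (\<Sum>j<2. (\<alpha> n i j * (- z) powi \<sigma> + \<beta> n i j * (- z) powi (-\<sigma>)) * v (n+1) j)"
    using v i unfolding satisfies_def by blast
  then have "v n i = - (z powi (\<sigma> * sg i) * v (n+1) i
      + (\<Sum>j<2. (\<alpha> n i j * z powi \<sigma> + \<beta> n i j * z powi (-\<sigma>)) * v (n+1) j))"
    unfolding power_int_minus_left_odd[OF s(1)] power_int_minus_left_odd[OF s(2)] power_int_minus_left_odd[OF s(3)]
    by (simp add: sum_negf[symmetric] algebra_simps)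
  then show "(if even n then 1 else -1) * v n i = z powi (\<sigma> * sg i) * ((if even (n+1) then 1 else -1) * v (n+1) i)
      + (\<Sum>j<2. (\<alpha> n i j * z powi \<sigma> + \<beta> n i j * z powi (-\<sigma>)) * ((if even (n+1) then 1 else -1) * v (n+1) j))"
    by (cases "even n") (simp_all add: sum_negf)
qed

context jost
begin

text \<open>(-1)^n f_n(-z) solves the same recursion with the same asymptotics as f_n(z), so the two
  agree by uniqueness.\<close>

lemma parity_circle:
  assumes z: "norm z = 1" and i: "i < 2"
  shows "f n i (- z) = (if even n then f n i z else - f n i z)"
proof -
  have mz: "norm (- z) = 1" using z by simp
  have "odd \<sigma>" using \<sigma> by auto
  then have fr: "free (- z) n i = (if even n then 1 else -1) * free z n i" for n i
    by (simp add: free_def power_int_minus_left)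
  have "(\<lambda>n i. 1 * ((if even n then 1 else -1) * f n i (- z)) + (-1) * f n i z) n i = 0"
  proof (rule uniqueness[OF z satisfies_lincomb[OF satisfies_uminus[OF sat[OF mz]] sat[OF z]] _ i])
    fix i :: nat assume i: "i < 2"
    have "(\<lambda>j. (if even (n + int j) then 1 else -1) * (f (n + int j) i (- z) - free (- z) (n + int j) i)) \<longlonglongrightarrow> 0"
      by (rule Lim_null_comparison[OF _ tendsto_norm_zero[OF asym[OF mz i, of n]]]) (auto simp: norm_mult)
    from tendsto_diff[OF this asym[OF z i, of n]]
    show "(\<lambda>j. 1 * ((if even (n + int j) then 1 else -1) * f (n + int j) i (- z)) + (-1) * f (n + int j) i z) \<longlonglongrightarrow> 0"
      by (rule Lim_transform_eventually[OF _ always_eventually, THEN tendsto_eq_rhs]) (auto simp: fr algebra_simps)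
  qed
  then have "(if even n then 1 else -1) * f n i (- z) = f n i z" by simp
  then show ?thesis by (cases "even n") (simp_all, metis minus_minus)
qed

lemma parity:
  assumes z: "z \<in> cside \<sigma>" and i: "i < 2"
  shows "f n i (- z) = (if even n then f n i z else - f n i z)"
proof -
  define g where "g z = f n i (- z) - (if even n then 1 else -1) * f n i z" for z
  have "g z = 0"
  proof (rule zero_on_circle_imp_zero[OF \<sigma>, where S = "{}" and g = g])
    show "continuous_on (cside \<sigma> - {}) g"
      unfolding g_def
      by (intro continuous_intros continuous_on_compose2[OF cont[OF i]] continuous_on_subset[OF cont[OF i]])
         (auto simp: uminus_cside_iff[OF \<sigma>])
    have "(f n i \<circ> uminus) holomorphic_on side \<sigma>"
      by (rule holomorphic_on_compose_gen[OF _ holo[OF i]]) (auto intro!: holomorphic_intros simp: uminus_side_iff[OF \<sigma>])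
    then show "g holomorphic_on side \<sigma> - {}"
      unfolding g_def using holo[OF i, of n] by (auto intro!: holomorphic_intros simp: o_def)
  qed (use z parity_circle[OF _ i] in \<open>auto simp: g_def\<close>)
  then show ?thesis by (auto simp: g_def add_eq_0_iff2)
qed

lemma coef_odd:
  assumes i: "i < 2" and s: "odd s"
  shows "coef n i (n + int s) = 0"
proof -
  define g where "g z = f n i z * z powi (- \<sigma> * (n + int s) - 1)" for z
  have "cint g = cint (\<lambda>z. g (- z))"
    unfolding g_def using s \<sigma>
    by (intro cint_cong) (auto simp: parity_circle[OF _ i] power_int_minus_left)
  also have "\<dots> = - cint g" by (rule cint_uminus_arg)
  finally have "cint g = 0" by simp
  moreover have "coef n i (n + int s) = cint g" by (simp only: coef_def g_def[abs_def])
  ultimately show ?thesis by simp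
qed

end

text \<open>A zero at one site would propagate to every later site, since no factor vanishes, and
  contradict the limit 1. This spares any discussion of infinite products.\<close>

lemma backward_product_nonzero:
  fixes c :: "int \<Rightarrow> complex"
  assumes "\<And>n. c n = d n * c (n + 1)" "\<And>n. d n \<noteq> 0" "(\<lambda>j. c (n + int j)) \<longlonglongrightarrow> 1"
  shows "c n \<noteq> 0"
proof
  assume c0: "c n = 0"
  have "c (n + int j) = 0" for j
  proof (induction j)
    case (Suc j)
    then have "d (n + int j) * c (n + int j + 1) = 0" using assms(1)[of "n + int j"] by simp
    then show ?case using assms(2)[of "n + int j"] by (simp add: add_ac)
  qed (simp add: c0)
  then have "(\<lambda>j. 0 :: complex) \<longlonglongrightarrow> 1" using assms(3) by simp
  then show False by (simp add: LIMSEQ_const_iff)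
qed

text \<open>The third power makes j |a_j| of order 1/j^2. The constant 8 = 2^3 comes from j <= 2 (c
  + j), valid for large j.\<close>

lemma summable_weighted_of_decay:
  fixes a :: "nat \<Rightarrow> complex"
  assumes "(\<lambda>j. of_int (c + int j) ^ 3 * a j) \<longlonglongrightarrow> 0"
  shows "summable (\<lambda>j. real j * norm (a j))"
proof (rule summable_comparison_test_ev)
  have "\<forall>\<^sub>F j in sequentially. norm (of_int (c + int j) ^ 3 * a j) < 1"
    using tendstoD[OF assms, of 1] by simp
  moreover have "\<forall>\<^sub>F j in sequentially. j \<ge> nat (2 * \<bar>c\<bar> + 1)" by (rule eventually_ge_at_top)
  ultimately show "\<forall>\<^sub>F j in sequentially. norm (real j * norm (a j)) \<le> 8 * (1 / real j ^ 2)"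
  proof eventually_elim
    case (elim j)
    define x where "x = real_of_int (c + int j)"
    have x: "real j \<le> 2 * x" "real j > 0" using elim(2) by (auto simp: x_def)
    have "0 \<le> x" using x by linarith
    then have "norm (of_int (c + int j) :: complex) = x" unfolding norm_of_int x_def[symmetric] by simp
    then have "x ^ 3 * norm (a j) < 1" using elim(1) by (simp add: norm_mult norm_power)
    then have "real j ^ 3 * norm (a j) \<le> (2 * x) ^ 3 * norm (a j)"
      using x by (intro mult_right_mono power_mono) auto
    also have "\<dots> = 8 * (x ^ 3 * norm (a j))" by (simp add: power_mult_distrib)
    also have "\<dots> \<le> 8" using \<open>x ^ 3 * norm (a j) < 1\<close> by simp
    finally have "real j ^ 3 * norm (a j) \<le> 8" .
    then show ?case using x(2) by (simp add: field_simps power2_eq_square power3_eq_cube)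
  qed
  show "summable (\<lambda>j. 8 * (1 / real j ^ 2))"
    using inverse_power_summable[of 2, where ?'a = real] by (intro summable_mult) (simp add: inverse_eq_divide)
qed

lemma at_bot_int_imp_sequence:
  assumes "(g \<longlongrightarrow> c) (at_bot :: int filter)"
  shows "(\<lambda>j. g (n - int j)) \<longlonglongrightarrow> c"
proof -
  have "filterlim (\<lambda>j. n - int j) at_bot sequentially"
    unfolding filterlim_at_bot
  proof
    fix Z
    show "\<forall>\<^sub>F j in sequentially. n - int j \<le> Z"
      by (rule eventually_sequentiallyI[of "nat (n - Z)"]) auto
  qed
  then show ?thesis using assms by (rule filterlim_compose[rotated])
qed

text \<open>T W - 1 vanishes on the circle, hence on the whole side off \<open>S\<close>. Evenness
  of T and its boundedness at the end are then read off W, whose limit \<open>w0\<close> there is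
  nonzero.\<close>

lemma pole_data_of_wronskian:
  assumes \<sigma>: "\<sigma> = 1 \<or> \<sigma> = -1"
    and S_def: "S = (\<Union>j\<in>{1..N}. {zs j, - zs j})"
    and zs_side: "\<And>j. j \<in> {1..N} \<Longrightarrow> zs j \<in> side \<sigma>"
    and zs_distinct: "\<And>j k. j \<in> {1..N} \<Longrightarrow> k \<in> {1..N} \<Longrightarrow> j \<noteq> k \<Longrightarrow> zs j \<noteq> zs k \<and> zs j \<noteq> - zs k"
    and T: "T holomorphic_on (side \<sigma> - S)" "continuous_on (cside \<sigma> - S) T"
    and T_res: "\<And>j. j \<in> {1..N} \<Longrightarrow> \<exists>B. \<forall>\<^sub>F z in at (zs j). norm (T z - (\<Sum>k = 1..ms j. t j k / (z - zs j) ^ k)) \<le> B"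
    and W: "W holomorphic_on side \<sigma>" "continuous_on (cside \<sigma>) W" "\<And>z. z \<in> cside \<sigma> \<Longrightarrow> W (- z) = W z"
    and TW: "\<And>z. norm z = 1 \<Longrightarrow> T z * W z = 1"
    and W_end: "((\<lambda>w. W (w powi \<sigma>)) \<longlongrightarrow> w0) (at 0)" "w0 \<noteq> 0"
  shows "pole_data \<sigma> N zs ms t T S"
proof
  have fin: "finite S" and sub: "S \<subseteq> side \<sigma>" using zs_side uminus_side_iff[OF \<sigma>] by (auto simp: S_def)
  have neg: "- z \<in> S" if "z \<in> S" for z using that by (auto simp: S_def)
  have S_minus: "- z \<in> S \<longleftrightarrow> z \<in> S" for z using neg[of z] neg[of "- z"] by (metis minus_minus)
  have TW1: "T z * W z = 1" if "z \<in> cside \<sigma> - S" for z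
  proof -
    have "T z * W z - 1 = 0"
    proof (rule zero_on_circle_imp_zero[OF \<sigma> fin sub, where g = "\<lambda>z. T z * W z - 1"])
      show "continuous_on (cside \<sigma> - S) (\<lambda>z. T z * W z - 1)"
        by (intro continuous_intros T continuous_on_subset[OF W(2)]) auto
      show "(\<lambda>z. T z * W z - 1) holomorphic_on side \<sigma> - S"
        by (intro holomorphic_intros T holomorphic_on_subset[OF W(1)]) auto
    qed (use that TW in auto)
    then show ?thesis by simp
  qed
  show "T (- z) = T z" if z: "z \<in> cside \<sigma> - S" for z
  proof -
    have mz: "- z \<in> cside \<sigma> - S" using z by (simp add: S_minus uminus_cside_iff[OF \<sigma>])
    have "W z \<noteq> 0" using TW1[OF z] by auto
    then show ?thesis using TW1[OF z] TW1[OF mz] W(3)[of z] z by (metis DiffD1 mult_right_cancel)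
  qed
  show "\<exists>B. \<forall>\<^sub>F w in at 0. norm (T (w powi \<sigma>)) \<le> B"
  proof -
    have "((\<lambda>w. inverse (W (w powi \<sigma>))) \<longlongrightarrow> inverse w0) (at 0)" by (intro tendsto_intros W_end)
    moreover have "\<forall>\<^sub>F w in at 0. inverse (W (w powi \<sigma>)) = T (w powi \<sigma>)"
    proof -
      define U where "U = ball 0 1 - (\<lambda>z. z powi \<sigma>) ` S"
      have "open U" unfolding U_def using fin by (intro open_Diff finite_imp_closed) auto
      moreover have "0 \<in> U" using sub \<sigma> by (force simp: U_def side_def)
      ultimately have "\<forall>\<^sub>F w in at 0. w \<in> U \<and> w \<noteq> 0"
        unfolding eventually_at_topological by blast
      then show ?thesis
      proof eventually_elim
        case (elim w)
        then have "w powi \<sigma> \<in> side \<sigma>" by (simp add: powi_mem_side[OF \<sigma>] side_pos U_def)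
        moreover have "w powi \<sigma> \<notin> S"
        proof
          assume "w powi \<sigma> \<in> S"
          then have "(w powi \<sigma>) powi \<sigma> \<in> (\<lambda>z. z powi \<sigma>) ` S" by (rule imageI)
          then show False using elim by (simp add: powi_powi_sign[OF \<sigma>] U_def)
        qed
        ultimately have "T (w powi \<sigma>) * W (w powi \<sigma>) = 1" using side_subset_cside by (intro TW1) auto
        then show ?case by (metis inverse_unique mult.commute)
      qed
    qed
    ultimately have "((\<lambda>w. T (w powi \<sigma>)) \<longlongrightarrow> inverse w0) (at 0)" by (rule Lim_transform_eventually)
    then have "\<forall>\<^sub>F w in at 0. norm (T (w powi \<sigma>)) < norm (inverse w0) + 1"
      by (intro order_tendstoD[OF tendsto_norm]) auto
    then show ?thesis by (intro exI[of _ "norm (inverse w0) + 1"]) (auto elim: eventually_mono)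
  qed
qed (use assms in auto)

subsection \<open>The system (Q)\<close>

definition mat2 :: "complex \<Rightarrow> complex \<Rightarrow> complex \<Rightarrow> complex \<Rightarrow> nat \<Rightarrow> nat \<Rightarrow> complex" where
  "mat2 a b c d i j = (if i = 0 then (if j = 0 then a else b) else (if j = 0 then c else d))"

lemma sum_lessThan_2: "(\<Sum>j<(2::nat). g j) = g 0 + g 1"
  by (simp add: numeral_2_eq_2)

lemma less_2_cases': "i < (2::nat) \<Longrightarrow> (i = 0 \<Longrightarrow> P) \<Longrightarrow> (i = 1 \<Longrightarrow> P) \<Longrightarrow> P"
  by linarith

definition wronskian :: "(int \<Rightarrow> nat \<Rightarrow> complex \<Rightarrow> complex) \<Rightarrow> (int \<Rightarrow> nat \<Rightarrow> complex \<Rightarrow> complex) \<Rightarrow> int \<Rightarrow> complex \<Rightarrow> complex" where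
  "wronskian f g n z = f n 0 z * g n 1 z - f n 1 z * g n 0 z"

text \<open>The one-step matrix of (Q) has determinant 1, so (Q) preserves the determinant formed by
  two solutions.\<close>

lemma wronskian_const:
  assumes "solves_Q q r f" "solves_Q q r g" "norm z = 1"
  shows "wronskian f g n z = wronskian f g (n + int j) z"
proof -
  have z: "z \<noteq> 0" using assms(3) by auto
  have step: "wronskian f g n z = wronskian f g (n + 1) z" for n
  proof -
    define b d where "b = (z - inverse z) * q n" and "d = inverse z + b * r n"
    have f: "f n 0 z = z * f (n+1) 0 z + b * f (n+1) 1 z" "f n 1 z = z * r n * f (n+1) 0 z + d * f (n+1) 1 z"
      and g: "g n 0 z = z * g (n+1) 0 z + b * g (n+1) 1 z" "g n 1 z = z * r n * g (n+1) 0 z + d * g (n+1) 1 z"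
      using assms unfolding solves_Q_def b_def d_def by blast+
    have "wronskian f g n z = (z * d - b * (z * r n)) * wronskian f g (n + 1) z"
      unfolding wronskian_def f g by (simp add: algebra_simps)
    also have "z * d - b * (z * r n) = 1" using z by (simp add: d_def algebra_simps)
    finally show ?thesis by simp
  qed
  show ?thesis
  proof (induction j)
    case (Suc j)
    then show ?case using step[of "n + int j"] by (simp add: add_ac)
  qed simp
qed

locale potential =
  fixes q r :: "int \<Rightarrow> complex"
  assumes decay_q: "\<And>p::nat. ((\<lambda>n. of_int n ^ p * q n) \<longlongrightarrow> 0) at_top \<and> ((\<lambda>n. of_int n ^ p * q n) \<longlongrightarrow> 0) at_bot"
    and decay_r: "\<And>p::nat. ((\<lambda>n. of_int n ^ p * r n) \<longlongrightarrow> 0) at_top \<and> ((\<lambda>n. of_int n ^ p * r n) \<longlongrightarrow> 0) at_bot"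
    and nondeg1: "\<And>n. 1 - q n * r n \<noteq> 0"
    and nondeg2: "\<And>n. 1 + q n * r (n + 1) \<noteq> 0"
begin

lemma decay_qr: "((\<lambda>n. of_int n ^ p * (q n * r n)) \<longlongrightarrow> 0) at_top \<and> ((\<lambda>n. of_int n ^ p * (q n * r n)) \<longlongrightarrow> 0) at_bot"
proof -
  have "((\<lambda>n. (of_int n ^ p * q n) * (of_int n ^ 0 * r n)) \<longlongrightarrow> 0 * 0) F" if "F = at_top \<or> F = at_bot" for F
    using that decay_q[of p] decay_r[of 0] by (intro tendsto_mult) auto
  then show ?thesis by (simp add: mult_ac)
qed

definition eps :: "int \<Rightarrow> real" where "eps n = norm (q n) + norm (r n) + norm (q n * r n)"

lemma summable_eps_forward: "summable (\<lambda>j. real j * eps (n + int j))"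
proof -
  have "summable (\<lambda>j. real j * norm (g (n + int j)))" if "((\<lambda>n. of_int n ^ 3 * g n) \<longlongrightarrow> 0) at_top" for g :: "int \<Rightarrow> complex"
    by (rule summable_weighted_of_decay[of n]) (rule at_top_int_imp_sequence[OF that])
  then have "summable (\<lambda>j. real j * norm (q (n + int j)) + real j * norm (r (n + int j)) + real j * norm (q (n + int j) * r (n + int j)))"
    using decay_q[of 3] decay_r[of 3] decay_qr[of 3] by (intro summable_add) auto
  then show ?thesis by (simp add: eps_def algebra_simps)
qed

lemma summable_eps_backward: "summable (\<lambda>j. real j * eps (- (n + int j) - 1))"
proof -
  have *: "summable (\<lambda>j. real j * norm (g (- (n + int j) - 1)))" if "((\<lambda>n. of_int n ^ 3 * g n) \<longlongrightarrow> 0) at_bot" for g :: "int \<Rightarrow> complex"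
  proof (rule summable_weighted_of_decay[of "n + 1"])
    have e: "of_int (n + 1 + int j) ^ 3 * g (- (n + int j) - 1) = - (of_int (- n - 1 - int j) ^ 3 * g (- n - 1 - int j))" for j
    proof -
      have 1: "of_int (- n - 1 - int j) = - (of_int (n + 1 + int j) :: complex)" by simp
      have 2: "- n - 1 - int j = - (n + int j) - 1" by simp
      show ?thesis unfolding 1 unfolding 2 by (simp del: of_int_add)
    qed
    have "(\<lambda>j. - (of_int (- n - 1 - int j) ^ 3 * g (- n - 1 - int j))) \<longlonglongrightarrow> 0"
      using tendsto_minus[OF at_bot_int_imp_sequence[OF that, of "- n - 1"]] by simp
    then show "(\<lambda>j. of_int (n + 1 + int j) ^ 3 * g (- (n + int j) - 1)) \<longlonglongrightarrow> 0"
      unfolding e .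
  qed
  have "summable (\<lambda>j. real j * norm (q (- (n + int j) - 1)) + real j * norm (r (- (n + int j) - 1)) + real j * norm (q (- (n + int j) - 1) * r (- (n + int j) - 1)))"
    using decay_q[of 3] decay_r[of 3] decay_qr[of 3]
    by (intro summable_add *[of q] *[of r] *[of "\<lambda>n. q n * r n"]) auto
  then show ?thesis by (simp add: eps_def algebra_simps)
qed

text \<open>Coefficients of \<open>z\<close> and \<open>1/z\<close> in the matrix of (Q), without the free part \<open>diag(z, 1/z)\<close>, and the
  same for its inverse (it has determinant 1) with the index reversed: \<open>n\<close> becomes \<open>-n-1\<close>.\<close>

definition "Q1 n = mat2 0 (q n) (r n) (q n * r n)"
definition "Q2 n = mat2 0 (- q n) 0 (- (q n * r n))"
definition "Q1i n = mat2 (q (- n - 1) * r (- n - 1)) (- q (- n - 1)) (- r (- n - 1)) 0"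
definition "Q2i n = mat2 (- (q (- n - 1) * r (- n - 1))) (q (- n - 1)) 0 0"

lemmas Q_defs = Q1_def Q2_def Q1i_def Q2i_def mat2_def

lemma Q_bounds: "norm (Q1 n i j) \<le> eps n" "norm (Q2 n i j) \<le> eps n"
  "norm (Q1i n i j) \<le> eps (- n - 1)" "norm (Q2i n i j) \<le> eps (- n - 1)"
  by (auto simp: Q_defs eps_def)

text \<open>For \<open>\<sigma> = -1\<close> the variable u is 1/z, so the coefficient matrices of z
  and 1/z trade places. The index \<open>\<kappa>\<close> is the component in which the normalised
  solution does not tend to 0.\<close>

lemma rec_psi: "jost_recursion 1 1 Q1 Q2 eps" and rec_psib: "jost_recursion (-1) 0 Q2 Q1 eps"
  and rec_phi: "jost_recursion 1 0 Q1i Q2i (\<lambda>n. eps (- n - 1))" and rec_phib: "jost_recursion (-1) 1 Q2i Q1i (\<lambda>n. eps (- n - 1))"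
  by (unfold_locales; (rule Q_bounds summable_eps_forward summable_eps_backward | simp))+

lemma sat_psi:
  assumes f: "solves_Q q r f" and z: "norm z = 1"
  shows "jost_recursion.satisfies 1 1 Q1 Q2 z (\<lambda>n i. f n i z)" "jost_recursion.satisfies (-1) 0 Q2 Q1 z (\<lambda>n i. f n i z)"
proof -
  have f': "f n 0 z = z * f (n+1) 0 z + (z - inverse z) * q n * f (n+1) 1 z"
      "f n 1 z = z * r n * f (n+1) 0 z + (inverse z + (z - inverse z) * q n * r n) * f (n+1) 1 z" for n
    using f z unfolding solves_Q_def by blast+
  show "jost_recursion.satisfies 1 1 Q1 Q2 z (\<lambda>n i. f n i z)"
    unfolding jost_recursion.satisfies_def[OF rec_psi] jost_recursion.sg_def[OF rec_psi] sum_lessThan_2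
  proof (intro allI impI)
    fix n and i :: nat assume "i < 2"
    then show "f n i z = z powi (1 * (if i = 1 then -1 else 1)) * f (n+1) i z
      + ((Q1 n i 0 * z powi 1 + Q2 n i 0 * z powi - 1) * f (n + 1) 0 z + (Q1 n i 1 * z powi 1 + Q2 n i 1 * z powi - 1) * f (n + 1) 1 z)"
      by (elim less_2_cases') (simp_all only: f'[of n], simp_all add: Q_defs power_int_minus algebra_simps)
  qed
  show "jost_recursion.satisfies (-1) 0 Q2 Q1 z (\<lambda>n i. f n i z)"
    unfolding jost_recursion.satisfies_def[OF rec_psib] jost_recursion.sg_def[OF rec_psib] sum_lessThan_2
  proof (intro allI impI)
    fix n and i :: nat assume "i < 2"
    then show "f n i z = z powi (- 1 * (if i = 0 then -1 else 1)) * f (n+1) i z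
      + ((Q2 n i 0 * z powi - 1 + Q1 n i 0 * z powi - (- 1)) * f (n + 1) 0 z + (Q2 n i 1 * z powi - 1 + Q1 n i 1 * z powi - (- 1)) * f (n + 1) 1 z)"
      by (elim less_2_cases') (simp_all only: f'[of n], simp_all add: Q_defs power_int_minus algebra_simps)
  qed
qed

text \<open>As the one-step matrix has determinant 1, its inverse is its adjugate, and the solution
  at k + 1 is expressed by the one at k. With k = -n - 1 this is a recursion for the reversed index
  whose good end is again at +infinity.\<close>

lemma sat_phi:
  assumes f: "solves_Q q r f" and z: "norm z = 1"
  shows "jost_recursion.satisfies 1 0 Q1i Q2i z (\<lambda>n i. f (- n) i z)" "jost_recursion.satisfies (-1) 1 Q2i Q1i z (\<lambda>n i. f (- n) i z)"
proof -
  have z0: "z \<noteq> 0" using z by auto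
  have f': "f (- n) 0 z = (inverse z + (z - inverse z) * q (- n - 1) * r (- n - 1)) * f (- (n + 1)) 0 z - (z - inverse z) * q (- n - 1) * f (- (n + 1)) 1 z"
     "f (- n) 1 z = - z * r (- n - 1) * f (- (n + 1)) 0 z + z * f (- (n + 1)) 1 z" for n
  proof -
    define k where "k = - n - 1"
    have e: "- (n + 1) = k" "- n = k + 1" by (auto simp: k_def)
    define b where "b = (z - inverse z) * q k"
    have F: "f k 0 z = z * f (k+1) 0 z + b * f (k+1) 1 z"
      "f k 1 z = z * r k * f (k+1) 0 z + (inverse z + b * r k) * f (k+1) 1 z"
      using f z unfolding solves_Q_def b_def by blast+
    have iz: "inverse z * z = 1" using z0 by simp
    have 1: "(inverse z + b * r k) * f k 0 z - b * f k 1 z = f (k+1) 0 z"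
    proof -
      have "(inverse z + b * r k) * f k 0 z - b * f k 1 z = (inverse z * z) * f (k+1) 0 z"
        unfolding F by (simp add: algebra_simps del: left_inverse)
      then show ?thesis by (simp add: iz)
    qed
    have 2: "- z * r k * f k 0 z + z * f k 1 z = f (k+1) 1 z"
    proof -
      have "- z * r k * f k 0 z + z * f k 1 z = (inverse z * z) * f (k+1) 1 z"
        unfolding F by (simp add: algebra_simps del: left_inverse)
      then show ?thesis by (simp add: iz)
    qed
    show "f (- n) 0 z = (inverse z + (z - inverse z) * q (- n - 1) * r (- n - 1)) * f (- (n + 1)) 0 z - (z - inverse z) * q (- n - 1) * f (- (n + 1)) 1 z"
      using 1 unfolding e k_def[symmetric] b_def by simp
    show "f (- n) 1 z = - z * r (- n - 1) * f (- (n + 1)) 0 z + z * f (- (n + 1)) 1 z"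
      using 2 unfolding e k_def[symmetric] by simp
  qed
  show "jost_recursion.satisfies 1 0 Q1i Q2i z (\<lambda>n i. f (- n) i z)"
    unfolding jost_recursion.satisfies_def[OF rec_phi] jost_recursion.sg_def[OF rec_phi] sum_lessThan_2
  proof (intro allI impI)
    fix n and i :: nat assume "i < 2"
    then show "f (- n) i z = z powi (1 * (if i = 0 then -1 else 1)) * f (- (n+1)) i z
      + ((Q1i n i 0 * z powi 1 + Q2i n i 0 * z powi - 1) * f (- (n + 1)) 0 z + (Q1i n i 1 * z powi 1 + Q2i n i 1 * z powi - 1) * f (- (n + 1)) 1 z)"
      by (elim less_2_cases') (simp_all only: f'[of n], simp_all add: Q_defs power_int_minus algebra_simps)
  qed
  show "jost_recursion.satisfies (-1) 1 Q2i Q1i z (\<lambda>n i. f (- n) i z)"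
    unfolding jost_recursion.satisfies_def[OF rec_phib] jost_recursion.sg_def[OF rec_phib] sum_lessThan_2
  proof (intro allI impI)
    fix n and i :: nat assume "i < 2"
    then show "f (- n) i z = z powi (- 1 * (if i = 1 then -1 else 1)) * f (- (n+1)) i z
      + ((Q2i n i 0 * z powi - 1 + Q1i n i 0 * z powi - (- 1)) * f (- (n + 1)) 0 z + (Q2i n i 1 * z powi - 1 + Q1i n i 1 * z powi - (- 1)) * f (- (n + 1)) 1 z)"
      by (elim less_2_cases') (simp_all only: f'[of n], simp_all add: Q_defs power_int_minus algebra_simps)
  qed
qed

text \<open>The difference of the two sides solves (Q) and tends to 0 at +infinity, so uniqueness
  applies to it.\<close>

lemma decomposition:
  assumes sol: "solves_Q q r phi" "solves_Q q r psib" "solves_Q q r psi" and z: "norm z = 1"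
    and psi: "((\<lambda>n. psi n 0 z) \<longlongrightarrow> 0) at_top" "((\<lambda>n. psi n 1 z - z powi n) \<longlongrightarrow> 0) at_top"
    and psib: "((\<lambda>n. psib n 0 z - z powi (- n)) \<longlongrightarrow> 0) at_top" "((\<lambda>n. psib n 1 z) \<longlongrightarrow> 0) at_top"
    and phi: "((\<lambda>n. phi n 0 z - a * z powi (- n)) \<longlongrightarrow> 0) at_top" "((\<lambda>n. phi n 1 z - b * z powi n) \<longlongrightarrow> 0) at_top"
    and i: "i < 2"
  shows "phi n i z = a * psib n i z + b * psi n i z"
proof -
  interpret P: jost_recursion 1 1 Q1 Q2 eps by (rule rec_psi)
  have "(\<lambda>n i. 1 * phi n i z + (-1) * (a * psib n i z + b * psi n i z)) n i = 0"
  proof (rule P.uniqueness[OF z P.satisfies_lincomb[OF sat_psi(1)[OF sol(1) z] P.satisfies_lincomb[OF sat_psi(1)[OF sol(2) z] sat_psi(1)[OF sol(3) z]]] _ i])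
    fix i :: nat assume "i < 2"
    then have "((\<lambda>n. 1 * phi n i z + (-1) * (a * psib n i z + b * psi n i z)) \<longlongrightarrow> 0) at_top"
    proof (elim less_2_cases')
      assume i: "i = 0"
      have "((\<lambda>n. (phi n 0 z - a * z powi (- n)) - a * (psib n 0 z - z powi (- n)) - b * psi n 0 z) \<longlongrightarrow> 0 - a * 0 - b * 0) at_top"
        by (intro tendsto_intros phi psib psi)
      then show ?thesis by (simp add: i algebra_simps)
    next
      assume i: "i = 1"
      have "((\<lambda>n. (phi n 1 z - b * z powi n) - a * psib n 1 z - b * (psi n 1 z - z powi n)) \<longlongrightarrow> 0 - a * 0 - b * 0) at_top"
        by (intro tendsto_intros phi psib psi)
      then show ?thesis by (simp add: i algebra_simps)
    qed
    then show "(\<lambda>j. 1 * phi (n + int j) i z + (-1) * (a * psib (n + int j) i z + b * psi (n + int j) i z)) \<longlonglongrightarrow> 0"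
      by (rule at_top_int_imp_sequence)
  qed
  then show ?thesis by (simp only: mult_1 mult_minus1 add_uminus_conv_diff right_minus_eq)
qed

text \<open>The Wronskian is constant in n and is evaluated as n tends to +infinity, where the
  leading terms give z^(-n) z^n = 1.\<close>

lemma wronskian_psib_psi:
  assumes sol: "solves_Q q r psib" "solves_Q q r psi" and z: "norm z = 1"
    and psi: "((\<lambda>n. psi n 0 z) \<longlongrightarrow> 0) at_top" "((\<lambda>n. psi n 1 z - z powi n) \<longlongrightarrow> 0) at_top"
    and psib: "((\<lambda>n. psib n 0 z - z powi (- n)) \<longlongrightarrow> 0) at_top" "((\<lambda>n. psib n 1 z) \<longlongrightarrow> 0) at_top"
  shows "wronskian psib psi n z = 1"
proof -
  have z0: "z \<noteq> 0" using z by auto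
  define A B where "A = (\<lambda>n. psib n 0 z - z powi (- n))" and "B = (\<lambda>n. psi n 1 z - z powi n)"
  have AB: "(A \<longlongrightarrow> 0) at_top" "(B \<longlongrightarrow> 0) at_top" using psi psib by (auto simp: A_def B_def)
  have "((\<lambda>n. wronskian psib psi n z - 1) \<longlongrightarrow> 0) at_top"
  proof (rule Lim_null_comparison)
    show "\<forall>\<^sub>F n in at_top. norm (wronskian psib psi n z - 1) \<le> norm (A n) * norm (B n) + norm (A n) + norm (B n) + norm (psib n 1 z) * norm (psi n 0 z)"
    proof (intro always_eventually allI)
      fix n
      have zz: "z powi (- n) * z powi n = 1" using z0 by (simp add: power_int_minus)
      have "wronskian psib psi n z - 1 = (A n + z powi (- n)) * (B n + z powi n) - psib n 1 z * psi n 0 z - 1"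
        by (simp add: wronskian_def A_def B_def)
      also have "\<dots> = A n * B n + A n * z powi n + z powi (- n) * B n - psib n 1 z * psi n 0 z"
        using zz by (simp add: algebra_simps)
      also have "norm \<dots> \<le> norm (A n * B n) + norm (A n * z powi n) + norm (z powi (- n) * B n) + norm (psib n 1 z * psi n 0 z)"
        by (intro order_trans[OF norm_triangle_ineq4] add_mono order_trans[OF norm_triangle_ineq] order_refl)
      finally show "norm (wronskian psib psi n z - 1) \<le> norm (A n) * norm (B n) + norm (A n) + norm (B n) + norm (psib n 1 z) * norm (psi n 0 z)"
        by (simp add: norm_mult norm_power_int z)
    qed
    show "((\<lambda>n. norm (A n) * norm (B n) + norm (A n) + norm (B n) + norm (psib n 1 z) * norm (psi n 0 z)) \<longlongrightarrow> 0) at_top"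
      by (intro tendsto_add_zero tendsto_mult_zero tendsto_norm_zero AB psi psib)
  qed
  from at_top_int_imp_sequence[OF this, of n]
  have "(\<lambda>j. wronskian psib psi n z - 1) \<longlonglongrightarrow> 0"
    by (simp only: wronskian_const[OF sol z, of n, symmetric])
  then show ?thesis by (simp add: LIMSEQ_const_iff)
qed

end

subsection \<open>The Marchenko system\<close>

lemma mat_inverse_of_invertible:
  assumes A: "A \<in> carrier_mat n n" and inv: "invertible_mat (A :: complex mat)"
  shows "the (mat_inverse A) \<in> carrier_mat n n" "the (mat_inverse A) * A = 1\<^sub>m n"
proof -
  obtain B where B: "A * B = 1\<^sub>m (dim_row A)" "B * A = 1\<^sub>m (dim_row B)"
    using inv by (auto simp: invertible_mat_def inverts_mat_def)
  have "dim_col B = n" using arg_cong[OF B(1), of dim_col] A by simp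
  moreover have "dim_row B = n" using arg_cong[OF B(2), of dim_col] A by simp
  ultimately have Bc: "B \<in> carrier_mat n n" by auto
  have "det A * det B = 1" using det_mult[OF A Bc] B(1) A by simp
  then have "A \<in> Units (ring_mat TYPE(complex) n ())" by (intro det_non_zero_imp_unit[OF A]) auto
  then obtain Ai where "mat_inverse A = Some Ai" using mat_inverse(1)[OF A, of "()"] by (cases "mat_inverse A") auto
  with mat_inverse(2)[OF A this] show "the (mat_inverse A) \<in> carrier_mat n n" "the (mat_inverse A) * A = 1\<^sub>m n" by auto
qed

text \<open>Multiplying the scalar equations by the inverse of \<open>KKmat psi psib n n\<close>
  turns K into M. Since M at l = n is the identity, the term s = 0 is the kernel matrix itself and
  the sum then starts at l = n + 1. \<open>OmMat\<close> is antidiagonal, so \<open>A\<close> yields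
  column 0 and \<open>B\<close> column 1.\<close>

lemma marchenko_matrix_form:
  assumes inv: "invertible_mat (KKmat psi psib n n)"
    and A: "\<And>i. i < 2 \<Longrightarrow> (\<lambda>s. Kc psi n (n + int s) i * om (n + int s + m)) sums (- Kbc psib n m i)"
    and B: "\<And>i. i < 2 \<Longrightarrow> (\<lambda>s. Kbc psib n (n + int s) i * omb (n + int s + m)) sums (- Kc psi n m i)"
    and ij: "i < 2" "j < 2"
  shows "(\<lambda>s. (MMmat psi psib n (n + 1 + int s) * OmMat (om (n + 1 + int s + m)) (omb (n + 1 + int s + m))) $$ (i,j))
     sums (- (MMmat psi psib n m + OmMat (om (n + m)) (omb (n + m))) $$ (i,j))"
proof -
  define Ai where "Ai = the (mat_inverse (KKmat psi psib n n))"
  have K: "KKmat psi psib n l \<in> carrier_mat 2 2" for l by (simp add: KKmat_def)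
  have Ai: "Ai \<in> carrier_mat 2 2" "Ai * KKmat psi psib n n = 1\<^sub>m 2"
    using mat_inverse_of_invertible[OF K inv] by (simp_all add: Ai_def)
  define M where "M l = MMmat psi psib n l" for l
  have Mc: "M l \<in> carrier_mat 2 2" for l using Ai(1) K by (simp add: M_def MMmat_def Ai_def)
  have M: "M l $$ (i,0) = (\<Sum>a<2. Ai $$ (i,a) * Kbc psib n l a)" "M l $$ (i,1) = (\<Sum>a<2. Ai $$ (i,a) * Kc psi n l a)" for l
  proof -
    have "M l = Ai * KKmat psi psib n l" by (simp add: M_def MMmat_def Ai_def)
    then show "M l $$ (i,0) = (\<Sum>a<2. Ai $$ (i,a) * Kbc psib n l a)" "M l $$ (i,1) = (\<Sum>a<2. Ai $$ (i,a) * Kc psi n l a)"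
      using Ai(1) ij(1) by (simp_all add: KKmat_def scalar_prod_def atLeast0LessThan)
  qed
  have Mn: "M n = 1\<^sub>m 2" using Ai(2) by (simp add: M_def MMmat_def Ai_def)
  have Om: "(X * OmMat a b) $$ (i,0) = X $$ (i,1) * a" "(X * OmMat a b) $$ (i,1) = X $$ (i,0) * b" if "X \<in> carrier_mat 2 2" for X a b
    using that ij(1) by (auto simp: OmMat_def scalar_prod_def numeral_2_eq_2)
  have "(\<lambda>s. \<Sum>a<2. Ai $$ (i,a) * (Kc psi n (n + int s) a * om (n + int s + m))) sums (\<Sum>a<2. Ai $$ (i,a) * - Kbc psib n m a)"
    by (intro sums_sum sums_mult A) auto
  then have "(\<lambda>s. M (n + int s) $$ (i,1) * om (n + int s + m)) sums (- M m $$ (i,0))"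
    unfolding M by (simp add: sum_distrib_right sum_negf mult.assoc)
  from sums_split_initial_segment[OF this, of 1]
  have 0: "(\<lambda>s. M (n + 1 + int s) $$ (i,1) * om (n + 1 + int s + m)) sums (- (M m $$ (i,0) + M n $$ (i,1) * om (n + m)))"
    by (simp add: add_ac)
  have "(\<lambda>s. \<Sum>a<2. Ai $$ (i,a) * (Kbc psib n (n + int s) a * omb (n + int s + m))) sums (\<Sum>a<2. Ai $$ (i,a) * - Kc psi n m a)"
    by (intro sums_sum sums_mult B) auto
  then have "(\<lambda>s. M (n + int s) $$ (i,0) * omb (n + int s + m)) sums (- M m $$ (i,1))"
    unfolding M by (simp add: sum_distrib_right sum_negf mult.assoc)
  from sums_split_initial_segment[OF this, of 1]
  have 1: "(\<lambda>s. M (n + 1 + int s) $$ (i,0) * omb (n + 1 + int s + m)) sums (- (M m $$ (i,1) + M n $$ (i,0) * omb (n + m)))"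
    by (simp add: add_ac)
  have sum: "(M m + OmMat a b) $$ (i,0) = M m $$ (i,0) + M n $$ (i,1) * a" "(M m + OmMat a b) $$ (i,1) = M m $$ (i,1) + M n $$ (i,0) * b" for a b
    using ij(1) Mc[of m] by (auto simp: OmMat_def Mn)
  show ?thesis
    using ij(2)
  proof (elim less_2_cases')
    assume j: "j = 0"
    show ?thesis using 0 unfolding j M_def[symmetric] Om(1)[OF Mc] sum(1) .
  next
    assume j: "j = 1"
    show ?thesis using 1 unfolding j M_def[symmetric] Om(2)[OF Mc] sum(2) .
  qed
qed

section \<open>Leading coefficients of the Jost solutions\<close>

context potential
begin

text \<open>In row 1 the coefficient matrix of 1/u has only the diagonal entry -q_n r_n, so this
  coefficient obeys a scalar recursion.\<close>

lemma leading_coef_psi: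
  assumes "jost 1 1 Q1 Q2 eps f"
  shows "jost.coef 1 f n 1 n \<noteq> 0"
proof -
  interpret J: jost 1 1 Q1 Q2 eps f by fact
  show ?thesis
  proof (rule backward_product_nonzero[where c = "\<lambda>n. J.coef n 1 n" and d = "\<lambda>n. 1 - q n * r n"])
    show "J.coef n 1 n = (1 - q n * r n) * J.coef (n+1) 1 (n+1)" for n
      using J.leading_step[of 1 n] by (simp add: sum_lessThan_2 Q_defs algebra_simps)
    show "(\<lambda>j. J.coef (n + int j) 1 (n + int j)) \<longlonglongrightarrow> 1"
      using J.coef_tendsto[of 1 n] by (simp add: LIM_zero_iff)
  qed (rule nondeg1)
qed

text \<open>Component 1 of the leading vector is r_n times component 0. Substituting this at site n
  + 1 makes the recursion scalar, with factor 1 + q_n r_(n+1).\<close>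

lemma leading_coef_psib:
  assumes "jost (-1) 0 Q2 Q1 eps f"
  shows "jost.coef (-1) f n 1 n = r n * jost.coef (-1) f n 0 n" "jost.coef (-1) f n 0 n \<noteq> 0"
proof -
  interpret J: jost "-1" 0 Q2 Q1 eps f by fact
  have 0: "J.coef n 0 n = J.coef (n+1) 0 (n+1) + q n * J.coef (n+1) 1 (n+1)" for n
    using J.leading_step[of 0 n] by (simp add: sum_lessThan_2 Q_defs)
  have 1: "J.coef n 1 n = r n * J.coef n 0 n" for n
    using J.leading_step[of 1 n] unfolding 0[of n] by (simp add: sum_lessThan_2 Q_defs algebra_simps)
  show "J.coef n 1 n = r n * J.coef n 0 n" by (rule 1)
  show "J.coef n 0 n \<noteq> 0"
  proof (rule backward_product_nonzero[where c = "\<lambda>n. J.coef n 0 n" and d = "\<lambda>n. 1 + q n * r (n + 1)"])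
    show "J.coef n 0 n = (1 + q n * r (n + 1)) * J.coef (n+1) 0 (n+1)" for n
      unfolding 0[of n] 1[of "n+1"] by (simp add: algebra_simps)
    show "(\<lambda>j. J.coef (n + int j) 0 (n + int j)) \<longlonglongrightarrow> 1"
      using J.coef_tendsto[of 0 n] by (simp add: LIM_zero_iff)
  qed (rule nondeg2)
qed

text \<open>Row 1 of \<open>Q2i\<close> is zero, which removes component 1; the diagonal entry of
  row 0 then gives the factor 1 - q r at the reversed site.\<close>

lemma leading_coef_phi:
  assumes "jost 1 0 Q1i Q2i (\<lambda>n. eps (- n - 1)) f"
  shows "jost.coef 1 f n 1 n = 0" "jost.coef 1 f n 0 n \<noteq> 0"
proof -
  interpret J: jost 1 0 Q1i Q2i "\<lambda>n. eps (- n - 1)" f by fact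
  have 1: "J.coef n 1 n = 0" for n
    using J.leading_step[of 1 n] by (simp add: sum_lessThan_2 Q_defs)
  show "J.coef n 1 n = 0" by (rule 1)
  show "J.coef n 0 n \<noteq> 0"
  proof (rule backward_product_nonzero[where c = "\<lambda>n. J.coef n 0 n" and d = "\<lambda>n. 1 - q (- n - 1) * r (- n - 1)"])
    show "J.coef n 0 n = (1 - q (- n - 1) * r (- n - 1)) * J.coef (n+1) 0 (n+1)" for n
      using J.leading_step[of 0 n] 1[of "n+1"] by (simp add: sum_lessThan_2 Q_defs algebra_simps)
    show "(\<lambda>j. J.coef (n + int j) 0 (n + int j)) \<longlonglongrightarrow> 1"
      using J.coef_tendsto[of 0 n] by (simp add: LIM_zero_iff)
  qed (rule nondeg1)
qed

text \<open>Eliminating component 0 at n + 1 brings in q at the site -n - 2 next to r at -n - 1, so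
  the factor has the form 1 + q_k r_(k+1) with k = -n - 2.\<close>

lemma leading_coef_phib:
  assumes "jost (-1) 1 Q2i Q1i (\<lambda>n. eps (- n - 1)) f"
  shows "jost.coef (-1) f n 0 n = - q (- n - 1) * jost.coef (-1) f n 1 n" "jost.coef (-1) f n 1 n \<noteq> 0"
proof -
  interpret J: jost "-1" 1 Q2i Q1i "\<lambda>n. eps (- n - 1)" f by fact
  have 1: "J.coef n 1 n = J.coef (n+1) 1 (n+1) - r (- n - 1) * J.coef (n+1) 0 (n+1)" for n
    using J.leading_step[of 1 n] by (simp add: sum_lessThan_2 Q_defs)
  have 0: "J.coef n 0 n = - q (- n - 1) * J.coef n 1 n" for n
    using J.leading_step[of 0 n] unfolding 1[of n] by (simp add: sum_lessThan_2 Q_defs algebra_simps)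
  show "J.coef n 0 n = - q (- n - 1) * J.coef n 1 n" by (rule 0)
  show "J.coef n 1 n \<noteq> 0"
  proof (rule backward_product_nonzero[where c = "\<lambda>n. J.coef n 1 n" and d = "\<lambda>n. 1 + q (- n - 2) * r (- n - 1)"])
    show "J.coef n 1 n = (1 + q (- n - 2) * r (- n - 1)) * J.coef (n+1) 1 (n+1)" for n
      unfolding 1[of n] 0[of "n+1"] by (simp add: algebra_simps)
    have "- n - 2 + 1 = - n - 1" for n :: int by simp
    then show "1 + q (- n - 2) * r (- n - 1) \<noteq> 0" for n using nondeg2[of "- n - 2"] by metis
    show "(\<lambda>j. J.coef (n + int j) 1 (n + int j)) \<longlonglongrightarrow> 1"
      using J.coef_tendsto[of 1 n] by (simp add: LIM_zero_iff)
  qed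
qed

end

text \<open>\<open>f\<close> is the Jost solution normalised at \<open>+\<infinity>\<close> and \<open>h\<close> the one normalised at \<open>-\<infinity>\<close>, whence its
  reversed index. The constant \<open>c\<close> is \<open>-1\<close> inside and \<open>1\<close> outside the unit circle.\<close>

lemma one_sided_kernel_equation:
  assumes f: "jost \<sigma> \<kappa> \<alpha> \<beta> \<epsilon> f" and h: "jost \<sigma> \<kappa>' \<alpha>' \<beta>' \<epsilon>' (\<lambda>n. h (- n))"
    and S_def: "S = (\<Union>j\<in>{1..N}. {zs j, - zs j})"
    and zs_side: "\<And>j. j \<in> {1..N} \<Longrightarrow> zs j \<in> side \<sigma>"
    and zs_distinct: "\<And>j k. j \<in> {1..N} \<Longrightarrow> k \<in> {1..N} \<Longrightarrow> j \<noteq> k \<Longrightarrow> zs j \<noteq> zs k \<and> zs j \<noteq> - zs k"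
    and T: "T holomorphic_on (side \<sigma> - S)" "continuous_on (cside \<sigma> - S) T"
    and T_res: "\<And>j. j \<in> {1..N} \<Longrightarrow> \<exists>B. \<forall>\<^sub>F z in at (zs j). norm (T z - (\<Sum>k = 1..ms j. t j k / (z - zs j) ^ k)) \<le> B"
    and TW: "\<And>z. norm z = 1 \<Longrightarrow> T z * wronskian f h 0 z = c" "c \<noteq> 0"
    and lead: "jost.coef \<sigma> f 0 0 0 * jost.coef \<sigma> (\<lambda>n. h (- n)) 0 1 0 \<noteq> jost.coef \<sigma> f 0 1 0 * jost.coef \<sigma> (\<lambda>n. h (- n)) 0 0 0"
    and R: "continuous_on (sphere 0 1) R"
    and fb: "continuous_on (sphere 0 1) (fb n i)" "\<And>z. norm z = 1 \<Longrightarrow> fb n i (- z) = (if even n then fb n i z else - fb n i z)"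
    and circle: "\<And>z. norm z = 1 \<Longrightarrow> T z * h n i z = fb n i z + R z * f n i z"
    and dep: "\<And>j q. j \<in> {1..N} \<Longrightarrow> q < ms j \<Longrightarrow>
        (deriv ^^ q) (h n i) (zs j) = (\<Sum>l = 0..q. of_nat (q choose l) * gam j (q - l) * (deriv ^^ l) (f n i) (zs j))"
    and cn: "\<And>j s. cn j s = - 2 * of_int \<sigma> * (\<Sum>l = 0..ms j - 1 - s. t j (s + 1 + l) * gam j l / of_nat (fact l))"
    and Om: "\<And>l. Om l = (if even l then cint (\<lambda>z. R z * z powi (\<sigma> * l - 1))
        + (Ctrip N ms cn * mat_powi (Atrip N zs ms) (\<sigma> * l - 1) * Btrip N ms) $$ (0,0) else 0)"
    and i: "i < 2" and nm: "n < m"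
  shows "(\<lambda>s. jost.coef \<sigma> f n i (n + int s) * Om (n + int s + m)) sums (- cint (\<lambda>z. fb n i z * z powi (\<sigma> * m - 1)))"
proof -
  interpret f: jost \<sigma> \<kappa> \<alpha> \<beta> \<epsilon> f by (rule f)
  interpret h: jost \<sigma> \<kappa>' \<alpha>' \<beta>' \<epsilon>' "\<lambda>n. h (- n)" by (rule h)
  note \<sigma> = f.\<sigma>
  have h_holo: "h n i holomorphic_on side \<sigma>" and h_cont: "continuous_on (cside \<sigma>) (h n i)" if "i < 2" for n i
    using h.holo[OF that, of "- n"] h.cont[OF that, of "- n"] by simp_all
  have h_par: "h n i (- z) = (if even n then h n i z else - h n i z)" if "i < 2" "z \<in> cside \<sigma>" for n i z
    using h.parity[OF that(2,1), of "- n"] by simp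
  have h_end: "((\<lambda>w. w powi n * h n i (w powi \<sigma>)) \<longlongrightarrow> h.coef (- n) i (- n)) (at 0)" if "i < 2" for n i
    using h.limit_at_end[OF that, of "- n"] by simp
  define W where "W z = wronskian f h 0 z / c" for z
  interpret pole_data \<sigma> N zs ms t T S
  proof (rule pole_data_of_wronskian[OF \<sigma> S_def zs_side zs_distinct T T_res])
    show "W holomorphic_on side \<sigma>" unfolding W_def wronskian_def
      by (intro holomorphic_intros f.holo h_holo) (use TW(2) in auto)
    show "continuous_on (cside \<sigma>) W" unfolding W_def wronskian_def
      by (intro continuous_intros f.cont h_cont) (use TW(2) in auto)
    show "W (- z) = W z" if "z \<in> cside \<sigma>" for z
      using that by (simp add: W_def wronskian_def f.parity h_par)
    show "T z * W z = 1" if "norm z = 1" for z using TW(1)[OF that] TW(2) by (simp add: W_def)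
    \<comment> \<open>The Wronskian is taken at n = 0, where the powers of w required by
      \<open>limit_at_end\<close> are 1. Its limit is then the determinant of the leading
      coefficients.\<close>
    have "((\<lambda>w. ((w powi - 0 * f 0 0 (w powi \<sigma>)) * (w powi 0 * h 0 1 (w powi \<sigma>)) - (w powi - 0 * f 0 1 (w powi \<sigma>)) * (w powi 0 * h 0 0 (w powi \<sigma>))) / c)
       \<longlongrightarrow> (f.coef 0 0 0 * h.coef (- 0) 1 (- 0) - f.coef 0 1 0 * h.coef (- 0) 0 (- 0)) / c) (at 0)"
      by (intro tendsto_intros f.limit_at_end h_end) (use TW(2) in auto)
    then show "((\<lambda>w. W (w powi \<sigma>)) \<longlongrightarrow> (f.coef 0 0 0 * h.coef 0 1 0 - f.coef 0 1 0 * h.coef 0 0 0) / c) (at 0)"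
      by (simp add: W_def wronskian_def)
    show "(f.coef 0 0 0 * h.coef 0 1 0 - f.coef 0 1 0 * h.coef 0 0 0) / c \<noteq> 0"
      using lead TW(2) by simp
  qed
  have zs_nonzero': "zs j \<noteq> 0" if "j \<in> {1..N}" for j using nonzero_side[OF zs_side[OF that]] .
  show ?thesis
  proof (rule kernel_equation)
    show "h n i holomorphic_on side \<sigma>" "continuous_on (cside \<sigma>) (h n i)" by (intro h_holo h_cont i)+
    show "h n i (- z) = (if even n then h n i z else - h n i z)" if "z \<in> cside \<sigma>" for z by (rule h_par[OF i that])
    show "((\<lambda>w. w powi n * h n i (w powi \<sigma>)) \<longlongrightarrow> h.coef (- n) i (- n)) (at 0)" by (rule h_end[OF i])
    show "f n i holomorphic_on side \<sigma>" "continuous_on (cside \<sigma>) (f n i)" by (intro f.holo f.cont i)+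
    show "f n i z = z powi (\<sigma> * n) * f.series n i z" if "z \<in> cside \<sigma>" for z by (rule f.eq_series[OF that i])
    show "uniform_limit {z. norm (z powi \<sigma>) \<le> 1} (\<lambda>N z. \<Sum>s<N. f.coef n i (n + int s) * (z powi \<sigma>) ^ s) (f.series n i) sequentially"
      by (rule f.series_uniform[OF i])
    show "continuous_on (cside \<sigma>) (f.series n i)"
      by (rule f.continuous_on_series[OF i]) (auto simp: cside_def)
    show "f.coef n i (n + int s) = 0" if "odd s" for s by (rule f.coef_odd[OF i that])
    show "cn j s = - 2 * of_int \<sigma> * (\<Sum>l = 0..ms j - 1 - s. t j (s + 1 + l) * gam j l / fact l)" for j s
      using cn[of j s] by simp
    show "Om l = (if even l then cint (\<lambda>z. R z * z powi (\<sigma> * l - 1))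
        + (\<Sum>j=1..N. \<Sum>s<ms j. cn j s * taylor_powi s (\<sigma> * l - 1) (zs j)) else 0)" for l
      using Om[of l] triplet_power[where zs = zs and N = N and ms = ms and cn = cn and e = "\<sigma> * l - 1", OF zs_nonzero'] by simp
  qed (use fb R circle dep nm in auto)
qed

theorem theorem6p1:
  fixes q r :: "int \<Rightarrow> complex"
    and psi psib phi phib :: "int \<Rightarrow> nat \<Rightarrow> complex \<Rightarrow> complex"
    and T Tb R Rb :: "complex \<Rightarrow> complex"
    and N Nb :: nat
    and zs zbs :: "nat \<Rightarrow> complex"
    and ms mbs :: "nat \<Rightarrow> nat"
    and t tb gam gamb :: "nat \<Rightarrow> nat \<Rightarrow> complex"
  assumes
    \<comment> \<open>potentials: rapid decay and nondegeneracy\<close>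
    decay_q: "\<And>p::nat. ((\<lambda>n. of_int n ^ p * q n) \<longlongrightarrow> 0) at_top \<and> ((\<lambda>n. of_int n ^ p * q n) \<longlongrightarrow> 0) at_bot"
    and decay_r: "\<And>p::nat. ((\<lambda>n. of_int n ^ p * r n) \<longlongrightarrow> 0) at_top \<and> ((\<lambda>n. of_int n ^ p * r n) \<longlongrightarrow> 0) at_bot"
    and nondeg1: "\<And>n. 1 - q n * r n \<noteq> 0"
    and nondeg2: "\<And>n. 1 + q n * r (n + 1) \<noteq> 0"
    \<comment> \<open>Jost solutions: solutions of (Q) on the unit circle ...\<close>
    and Q_psi: "solves_Q q r psi" and Q_psib: "solves_Q q r psib"
    and Q_phi: "solves_Q q r phi" and Q_phib: "solves_Q q r phib"
    \<comment> \<open>... with the prescribed asymptotics ...\<close>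
    and as_psi: "\<And>z. norm z = 1 \<Longrightarrow> ((\<lambda>n. psi n 0 z) \<longlongrightarrow> 0) at_top
                     \<and> ((\<lambda>n. psi n 1 z - z powi n) \<longlongrightarrow> 0) at_top"
    and as_psib: "\<And>z. norm z = 1 \<Longrightarrow> ((\<lambda>n. psib n 0 z - z powi (- n)) \<longlongrightarrow> 0) at_top
                     \<and> ((\<lambda>n. psib n 1 z) \<longlongrightarrow> 0) at_top"
    and as_phi: "\<And>z. norm z = 1 \<Longrightarrow> ((\<lambda>n. phi n 0 z - z powi (- n)) \<longlongrightarrow> 0) at_bot
                     \<and> ((\<lambda>n. phi n 1 z) \<longlongrightarrow> 0) at_bot"
    and as_phib: "\<And>z. norm z = 1 \<Longrightarrow> ((\<lambda>n. phib n 0 z) \<longlongrightarrow> 0) at_bot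
                     \<and> ((\<lambda>n. phib n 1 z - z powi n) \<longlongrightarrow> 0) at_bot"
    \<comment> \<open>... and their analytic extensions (psi, phi inside, psib, phib outside the circle)\<close>
    and an_psi: "\<And>n i. psi n i holomorphic_on (ball 0 1 - {0}) \<and> continuous_on (cball 0 1 - {0}) (psi n i)"
    and an_phi: "\<And>n i. phi n i holomorphic_on (ball 0 1 - {0}) \<and> continuous_on (cball 0 1 - {0}) (phi n i)"
    and an_psib: "\<And>n i. psib n i holomorphic_on {z. 1 < norm z} \<and> continuous_on {z. 1 \<le> norm z} (psib n i)"
    and an_phib: "\<And>n i. phib n i holomorphic_on {z. 1 < norm z} \<and> continuous_on {z. 1 \<le> norm z} (phib n i)"
    \<comment> \<open>transmission and reflection coefficients on the circle\<close>
    and TR: "\<And>z. norm z = 1 \<Longrightarrow> ((\<lambda>n. phi n 0 z - z powi (- n) / T z) \<longlongrightarrow> 0) at_top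
                     \<and> ((\<lambda>n. phi n 1 z - R z * z powi n / T z) \<longlongrightarrow> 0) at_top"
    and TRb: "\<And>z. norm z = 1 \<Longrightarrow> ((\<lambda>n. phib n 0 z - Rb z * z powi (- n) / Tb z) \<longlongrightarrow> 0) at_top
                     \<and> ((\<lambda>n. phib n 1 z - z powi n / Tb z) \<longlongrightarrow> 0) at_top"
    \<comment> \<open>T meromorphic in the disk, Tb meromorphic outside, with the given poles\<close>
    and T_mero: "T holomorphic_on (ball 0 1 - ({0} \<union> (\<Union>j\<in>{1..N}. {zs j, - zs j})))
                 \<and> continuous_on (cball 0 1 - ({0} \<union> (\<Union>j\<in>{1..N}. {zs j, - zs j}))) T
                 \<and> not_essential T 0"
    and T_poles: "{z \<in> ball 0 1 - {0}. is_pole T z} = (\<Union>j\<in>{1..N}. {zs j, - zs j})"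
    and T_dist: "\<And>j k. j \<in> {1..N} \<Longrightarrow> k \<in> {1..N} \<Longrightarrow> j \<noteq> k \<Longrightarrow> zs j \<noteq> zs k \<and> zs j \<noteq> - zs k"
    and T_mult: "\<And>j. j \<in> {1..N} \<Longrightarrow> ms j \<ge> 1 \<and> zorder T (zs j) = - int (ms j)
                                     \<and> zorder T (- zs j) = - int (ms j)"
    and T_res: "\<And>j. j \<in> {1..N} \<Longrightarrow> \<exists>B. \<forall>\<^sub>F z in at (zs j).
                   norm (T z - (\<Sum>k = 1..ms j. t j k / (z - zs j) ^ k)) \<le> B"
    and Tb_mero: "Tb holomorphic_on ({z. 1 < norm z} - (\<Union>j\<in>{1..Nb}. {zbs j, - zbs j}))
                 \<and> continuous_on ({z. 1 \<le> norm z} - (\<Union>j\<in>{1..Nb}. {zbs j, - zbs j})) Tb"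
    and Tb_poles: "{z. 1 < norm z \<and> is_pole Tb z} = (\<Union>j\<in>{1..Nb}. {zbs j, - zbs j})"
    and Tb_dist: "\<And>j k. j \<in> {1..Nb} \<Longrightarrow> k \<in> {1..Nb} \<Longrightarrow> j \<noteq> k \<Longrightarrow> zbs j \<noteq> zbs k \<and> zbs j \<noteq> - zbs k"
    and Tb_mult: "\<And>j. j \<in> {1..Nb} \<Longrightarrow> mbs j \<ge> 1 \<and> zorder Tb (zbs j) = - int (mbs j)
                                     \<and> zorder Tb (- zbs j) = - int (mbs j)"
    and Tb_res: "\<And>j. j \<in> {1..Nb} \<Longrightarrow> \<exists>B. \<forall>\<^sub>F z in at (zbs j).
                   norm (Tb z - (\<Sum>k = 1..mbs j. tb j k / (z - zbs j) ^ k)) \<le> B"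
    \<comment> \<open>dependency constants\<close>
    and dep: "\<And>j k n i. j \<in> {1..N} \<Longrightarrow> k < ms j \<Longrightarrow> i < 2 \<Longrightarrow>
                (deriv ^^ k) (phi n i) (zs j)
                  = (\<Sum>l = 0..k. of_nat (k choose l) * gam j (k - l) * (deriv ^^ l) (psi n i) (zs j))"
    and depb: "\<And>j k n i. j \<in> {1..Nb} \<Longrightarrow> k < mbs j \<Longrightarrow> i < 2 \<Longrightarrow>
                (deriv ^^ k) (phib n i) (zbs j)
                  = (\<Sum>l = 0..k. of_nat (k choose l) * gamb j (k - l) * (deriv ^^ l) (psib n i) (zbs j))"
    \<comment> \<open>invertibility of [Kbar_nn K_nn] (stated in the paper as a fact)\<close>
    and Kinv: "\<And>n. invertible_mat (KKmat psi psib n n)"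
  shows "\<forall>n m. n < m \<longrightarrow> (\<forall>i < 2. \<forall>j < 2.
     (\<lambda>s. (MMmat psi psib n (n + 1 + int s)
            * OmMat (Omega R N zs ms (cnorm ms t gam) (n + 1 + int s + m))
                    (Omegab Rb Nb zbs mbs (cbnorm mbs tb gamb) (n + 1 + int s + m))) $$ (i,j))
     sums (- (MMmat psi psib n m
              + OmMat (Omega R N zs ms (cnorm ms t gam) (n + m))
                      (Omegab Rb Nb zbs mbs (cbnorm mbs tb gamb) (n + m))) $$ (i,j)))"
proof (intro allI impI)
  have one_lt_2: "(1::nat) < 2" by simp
  fix n m :: int and i j :: nat
  assume nm: "n < m" and i: "i < 2" and j: "j < 2"
  interpret potential q r by unfold_locales (fact decay_q decay_r nondeg1 nondeg2)+
  have psi: "jost 1 1 Q1 Q2 eps psi"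
  proof (intro jost.intro rec_psi jost_axioms.intro sat_psi(1)[OF Q_psi])
    fix z :: complex and n and i :: nat assume z: "norm z = 1" and i: "i < 2"
    show "(\<lambda>j. psi (n + int j) i z - jost_recursion.free 1 1 z (n + int j) i) \<longlonglongrightarrow> 0"
      unfolding jost_recursion.free_def[OF rec_psi] using i at_top_int_imp_sequence[OF conjunct1[OF as_psi[OF z]], of n] at_top_int_imp_sequence[OF conjunct2[OF as_psi[OF z]], of n]
      by (elim less_2_cases') simp_all
  qed (use an_psi in \<open>simp_all add: side_pos cside_pos\<close>)
  have psib: "jost (-1) 0 Q2 Q1 eps psib"
  proof (intro jost.intro rec_psib jost_axioms.intro sat_psi(2)[OF Q_psib])
    fix z :: complex and n and i :: nat assume z: "norm z = 1" and i: "i < 2"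
    show "(\<lambda>j. psib (n + int j) i z - jost_recursion.free (-1) 0 z (n + int j) i) \<longlonglongrightarrow> 0"
      unfolding jost_recursion.free_def[OF rec_psib] using i at_top_int_imp_sequence[OF conjunct1[OF as_psib[OF z]], of n] at_top_int_imp_sequence[OF conjunct2[OF as_psib[OF z]], of n]
      by (elim less_2_cases') simp_all
  qed (use an_psib in \<open>simp_all add: side_neg cside_neg\<close>)
  have phi: "jost 1 0 Q1i Q2i (\<lambda>n. eps (- n - 1)) (\<lambda>n. phi (- n))"
  proof (intro jost.intro rec_phi jost_axioms.intro sat_phi(1)[OF Q_phi])
    fix z :: complex and n and i :: nat assume z: "norm z = 1" and i: "i < 2"
    have e: "- (n + int j) = - n - int j" for j by simp
    show "(\<lambda>j. phi (- (n + int j)) i z - jost_recursion.free 1 0 z (n + int j) i) \<longlonglongrightarrow> 0"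
      unfolding jost_recursion.free_def[OF rec_phi] e using i at_bot_int_imp_sequence[OF conjunct1[OF as_phi[OF z]], of "- n"] at_bot_int_imp_sequence[OF conjunct2[OF as_phi[OF z]], of "- n"]
      by (elim less_2_cases') (simp_all add: add_ac)
  qed (use an_phi in \<open>simp_all add: side_pos cside_pos\<close>)
  have phib: "jost (-1) 1 Q2i Q1i (\<lambda>n. eps (- n - 1)) (\<lambda>n. phib (- n))"
  proof (intro jost.intro rec_phib jost_axioms.intro sat_phi(2)[OF Q_phib])
    fix z :: complex and n and i :: nat assume z: "norm z = 1" and i: "i < 2"
    have e: "- (n + int j) = - n - int j" for j by simp
    show "(\<lambda>j. phib (- (n + int j)) i z - jost_recursion.free (-1) 1 z (n + int j) i) \<longlonglongrightarrow> 0"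
      unfolding jost_recursion.free_def[OF rec_phib] e using i at_bot_int_imp_sequence[OF conjunct1[OF as_phib[OF z]], of "- n"] at_bot_int_imp_sequence[OF conjunct2[OF as_phib[OF z]], of "- n"]
      by (elim less_2_cases') simp_all
  qed (use an_phib in \<open>simp_all add: side_neg cside_neg\<close>)
  interpret J1: jost 1 1 Q1 Q2 eps psi by (rule psi)
  interpret J2: jost "-1" 0 Q2 Q1 eps psib by (rule psib)
  interpret J3: jost 1 0 Q1i Q2i "\<lambda>n. eps (- n - 1)" "\<lambda>n. phi (- n)" by (rule phi)
  interpret J4: jost "-1" 1 Q2i Q1i "\<lambda>n. eps (- n - 1)" "\<lambda>n. phib (- n)" by (rule phib)
  have nonconst: "\<not> ((\<lambda>n. 0 - z powi (k * n)) \<longlongrightarrow> 0) at_bot" if "norm z = 1" for z :: complex and k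
  proof
    assume "((\<lambda>n. 0 - z powi (k * n)) \<longlongrightarrow> 0) at_bot"
    from tendsto_norm_zero[OF at_bot_int_imp_sequence[OF this, of 0]]
    show False by (simp add: norm_power_int that LIMSEQ_const_iff)
  qed
  have w1: "wronskian psib psi n z = 1" if "norm z = 1" for n z
    using wronskian_psib_psi[OF Q_psib Q_psi that] as_psi[OF that] as_psib[OF that] by blast
  have T: "T z \<noteq> 0" "phi n i z = 1 / T z * psib n i z + R z / T z * psi n i z" if z: "norm z = 1" and i: "i < 2" for z n i
  proof -
    have d: "phi n i z = 1 / T z * psib n i z + R z / T z * psi n i z" if "i < 2" for n i
      by (rule decomposition[OF Q_phi Q_psib Q_psi z _ _ _ _ _ _ that])
         (use as_psi[OF z] as_psib[OF z] TR[OF z] in simp_all)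
    show "phi n i z = 1 / T z * psib n i z + R z / T z * psi n i z" by (rule d[OF i])
    show "T z \<noteq> 0"
    proof
      \<comment> \<open>Division by 0 is 0 in HOL, so T z = 0 would annihilate both terms of the
        decomposition and hence \<open>phi\<close>. This contradicts its normalisation at -infinity,
        where z^(-n) has modulus 1.\<close>
      assume "T z = 0"
      then have "phi n 0 z = 0" for n using d[of 0 n] by simp
      then show False using conjunct1[OF as_phi[OF z]] nonconst[OF z, of "-1"] by simp
    qed
  qed
  have Tb: "Tb z \<noteq> 0" "phib n i z = Rb z / Tb z * psib n i z + 1 / Tb z * psi n i z" if z: "norm z = 1" and i: "i < 2" for z n i
  proof -
    have d: "phib n i z = Rb z / Tb z * psib n i z + 1 / Tb z * psi n i z" if "i < 2" for n i
      by (rule decomposition[OF Q_phib Q_psib Q_psi z _ _ _ _ _ _ that])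
         (use as_psi[OF z] as_psib[OF z] TRb[OF z] in simp_all)
    show "phib n i z = Rb z / Tb z * psib n i z + 1 / Tb z * psi n i z" by (rule d[OF i])
    show "Tb z \<noteq> 0"
    proof
      assume "Tb z = 0"
      then have "phib n 1 z = 0" for n using d[of 1 n] by simp
      then show False using conjunct2[OF as_phib[OF z]] nonconst[OF z, of 1] by simp
    qed
  qed
  \<comment> \<open>Pairing the decomposition with \<open>psi\<close> isolates 1/T, pairing it with
    \<open>psib\<close> isolates R/T. The sign -1 comes from the order of the arguments in the
    Wronskian of \<open>psi\<close> and \<open>psib\<close>.\<close>
  have W: "T z * wronskian psi phi 0 z = - 1" "R z = T z * wronskian psib phi 0 z" if z: "norm z = 1" for z
  proof -
    have e: "phi 0 i z = 1 / T z * psib 0 i z + R z / T z * psi 0 i z" if "i < 2" for i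
      by (rule T(2)[OF z that])
    note e = e[of 0, OF zero_less_numeral] e[of 1, OF one_lt_2]
    have "wronskian psi phi 0 z = - (1 / T z) * wronskian psib psi 0 z" "wronskian psib phi 0 z = R z / T z * wronskian psib psi 0 z"
      unfolding wronskian_def e by (simp_all add: algebra_simps)
    then show "T z * wronskian psi phi 0 z = - 1" "R z = T z * wronskian psib phi 0 z"
      using T(1)[OF z, of 0] by (simp_all add: w1[OF z])
  qed
  have Wb: "Tb z * wronskian psib phib 0 z = 1" "Rb z = - (Tb z * wronskian psi phib 0 z)" if z: "norm z = 1" for z
  proof -
    have e: "phib 0 i z = Rb z / Tb z * psib 0 i z + 1 / Tb z * psi 0 i z" if "i < 2" for i
      by (rule Tb(2)[OF z that])
    note e = e[of 0, OF zero_less_numeral] e[of 1, OF one_lt_2]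
    have "wronskian psib phib 0 z = 1 / Tb z * wronskian psib psi 0 z" "wronskian psi phib 0 z = - (Rb z / Tb z) * wronskian psib psi 0 z"
      unfolding wronskian_def e by (simp_all add: algebra_simps)
    then show "Tb z * wronskian psib phib 0 z = 1" "Rb z = - (Tb z * wronskian psi phib 0 z)"
      using Tb(1)[OF z, of 0] by (simp_all add: w1[OF z])
  qed
  have phi_cont: "continuous_on (sphere 0 1) (phi n i)" "continuous_on (sphere 0 1) (phib n i)" if "i < 2" for n i
    using J3.cont_sphere[OF that, of "- n"] J4.cont_sphere[OF that, of "- n"] by simp_all
  define S Sb where "S = (\<Union>j\<in>{1..N}. {zs j, - zs j})" and "Sb = (\<Union>j\<in>{1..Nb}. {zbs j, - zbs j})"
  have zs_side: "zs j \<in> side 1" if "j \<in> {1..N}" for j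
  proof -
    have "zs j \<in> {z \<in> ball 0 1 - {0}. is_pole T z}" unfolding T_poles using that by blast
    then show ?thesis by (simp add: side_pos)
  qed
  have zbs_side: "zbs j \<in> side (-1)" if "j \<in> {1..Nb}" for j
  proof -
    have "zbs j \<in> {z. 1 < norm z \<and> is_pole Tb z}" unfolding Tb_poles using that by blast
    then show ?thesis by (simp add: side_neg)
  qed
  have sides: "side 1 - S = ball 0 1 - ({0} \<union> S)" "cside 1 - S = cball 0 1 - ({0} \<union> S)"
    by (auto simp: side_pos cside_pos)
  have sph: "sphere 0 1 \<subseteq> cside 1 - S" "sphere 0 1 \<subseteq> cside (-1) - Sb"
    using zs_side zbs_side by (fastforce simp: S_def Sb_def side_pos cside_pos side_neg cside_neg)+
  have T_cont: "continuous_on (cside 1 - S) T" and Tb_cont: "continuous_on (cside (-1) - Sb) Tb"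
    using T_mero[folded S_def] Tb_mero[folded Sb_def] unfolding sides cside_neg by blast+
  \<comment> \<open>Continuity of \<open>R\<close> is deduced from its expression through T and a
    Wronskian; the boundary values of both factors are continuous.\<close>
  have R_cont: "continuous_on (sphere 0 1) R"
  proof (rule continuous_on_eq)
    show "continuous_on (sphere 0 1) (\<lambda>z. T z * wronskian psib phi 0 z)"
      unfolding wronskian_def
      by (intro continuous_intros continuous_on_subset[OF T_cont sph(1)] phi_cont J2.cont_sphere) auto
  qed (simp add: W(2))
  have Rb_cont: "continuous_on (sphere 0 1) Rb"
  proof (rule continuous_on_eq)
    show "continuous_on (sphere 0 1) (\<lambda>z. - (Tb z * wronskian psi phib 0 z))"
      unfolding wronskian_def
      by (intro continuous_intros continuous_on_subset[OF Tb_cont sph(2)] phi_cont J1.cont_sphere) auto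
  qed (simp add: Wb(2))
  have A: "(\<lambda>s. Kc psi n (n + int s) i * Omega R N zs ms (cnorm ms t gam) (n + int s + m)) sums (- Kbc psib n m i)"
    if i: "i < 2" for i
  proof -
    have "(\<lambda>s. J1.coef n i (n + int s) * Omega R N zs ms (cnorm ms t gam) (n + int s + m)) sums (- cint (\<lambda>z. psib n i z * z powi (1 * m - 1)))"
    proof (rule one_sided_kernel_equation[where cn = "cnorm ms t gam" and gam = gam, OF psi phi S_def zs_side T_dist _ T_cont T_res W(1) _ _ R_cont _ _ _ _ _ _ i nm])
      show "T holomorphic_on side 1 - S" using T_mero[folded S_def] unfolding sides by blast
      \<comment> \<open>The second leading component of \<open>phi\<close> is 0, so the left-hand
        product vanishes, while the right-hand one consists of nonzero factors.\<close>
      show "J1.coef 0 0 0 * J3.coef 0 1 0 \<noteq> J1.coef 0 1 0 * J3.coef 0 0 0"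
        using leading_coef_psi[OF psi, of 0] leading_coef_phi[OF phi, of 0] by simp
      show "continuous_on (sphere 0 1) (psib n i)" by (rule J2.cont_sphere[OF i])
      show "psib n i (- z) = (if even n then psib n i z else - psib n i z)" if "norm z = 1" for z by (rule J2.parity_circle[OF that i])
      show "T z * phi n i z = psib n i z + R z * psi n i z" if "norm z = 1" for z
        using T(1)[OF that i] T(2)[OF that i, of n] by (simp add: field_simps)
      show "(deriv ^^ q) (phi n i) (zs j) = (\<Sum>l = 0..q. of_nat (q choose l) * gam j (q - l) * (deriv ^^ l) (psi n i) (zs j))"
        if "j \<in> {1..N}" "q < ms j" for j q by (rule dep[OF that i])
      show "Omega R N zs ms (cnorm ms t gam) l = (if even l then cint (\<lambda>z. R z * z powi (1 * l - 1))
        + (Ctrip N ms (cnorm ms t gam) * mat_powi (Atrip N zs ms) (1 * l - 1) * Btrip N ms) $$ (0,0) else 0)" for l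
        by (simp add: Omega_def)
    qed (simp_all add: cnorm_def)
    then show ?thesis by (simp add: J1.coef_def Kc_def Kbc_def)
  qed
  have B: "(\<lambda>s. Kbc psib n (n + int s) i * Omegab Rb Nb zbs mbs (cbnorm mbs tb gamb) (n + int s + m)) sums (- Kc psi n m i)"
    if i: "i < 2" for i
  proof -
    have "(\<lambda>s. J2.coef n i (n + int s) * Omegab Rb Nb zbs mbs (cbnorm mbs tb gamb) (n + int s + m)) sums (- cint (\<lambda>z. psi n i z * z powi (-1 * m - 1)))"
    proof (rule one_sided_kernel_equation[where cn = "cbnorm mbs tb gamb" and gam = gamb, OF psib phib Sb_def zbs_side Tb_dist _ Tb_cont Tb_res Wb(1) _ _ Rb_cont _ _ _ _ _ _ i nm])
      show "Tb holomorphic_on side (-1) - Sb" using Tb_mero[folded Sb_def] unfolding side_neg by blast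
      show "J2.coef 0 0 0 * J4.coef 0 1 0 \<noteq> J2.coef 0 1 0 * J4.coef 0 0 0"
      proof
        assume "J2.coef 0 0 0 * J4.coef 0 1 0 = J2.coef 0 1 0 * J4.coef 0 0 0"
        \<comment> \<open>The two component ratios are r_0 and -q_(-1), so the determinant is a
          nonzero product times 1 + q_(-1) r_0; the index is written as -1 + 1 to match
          \<open>nondeg2\<close>.\<close>
        then have "J2.coef 0 0 0 * J4.coef 0 1 0 * (1 + q (- 1) * r (- 1 + 1)) = 0"
          unfolding leading_coef_psib(1)[OF psib, of 0] leading_coef_phib(1)[OF phib, of 0] by (simp add: algebra_simps eq_neg_iff_add_eq_0)
        then show False
          using leading_coef_psib(2)[OF psib, of 0] leading_coef_phib(2)[OF phib, of 0] nondeg2[of "-1"] by simp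
      qed
      show "continuous_on (sphere 0 1) (psi n i)" by (rule J1.cont_sphere[OF i])
      show "psi n i (- z) = (if even n then psi n i z else - psi n i z)" if "norm z = 1" for z by (rule J1.parity_circle[OF that i])
      show "Tb z * phib n i z = psi n i z + Rb z * psib n i z" if "norm z = 1" for z
        using Tb(1)[OF that i] Tb(2)[OF that i, of n] by (simp add: field_simps)
      show "(deriv ^^ q) (phib n i) (zbs j) = (\<Sum>l = 0..q. of_nat (q choose l) * gamb j (q - l) * (deriv ^^ l) (psib n i) (zbs j))"
        if "j \<in> {1..Nb}" "q < mbs j" for j q by (rule depb[OF that i])
      show "Omegab Rb Nb zbs mbs (cbnorm mbs tb gamb) l = (if even l then cint (\<lambda>z. Rb z * z powi (- 1 * l - 1))
        + (Ctrip Nb mbs (cbnorm mbs tb gamb) * mat_powi (Atrip Nb zbs mbs) (- 1 * l - 1) * Btrip Nb mbs) $$ (0,0) else 0)" for l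
        by (simp add: Omegab_def)
    qed (simp_all add: cbnorm_def)
    then show ?thesis by (simp add: J2.coef_def Kc_def Kbc_def)
  qed
  show "(\<lambda>s. (MMmat psi psib n (n + 1 + int s)
            * OmMat (Omega R N zs ms (cnorm ms t gam) (n + 1 + int s + m))
                    (Omegab Rb Nb zbs mbs (cbnorm mbs tb gamb) (n + 1 + int s + m))) $$ (i,j))
     sums (- (MMmat psi psib n m
              + OmMat (Omega R N zs ms (cnorm ms t gam) (n + m))
                      (Omegab Rb Nb zbs mbs (cbnorm mbs tb gamb) (n + m))) $$ (i,j))"
    by (rule marchenko_matrix_form[OF Kinv A B i j])
qed

end
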